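(* In the setting below, the algebraic de Rham cohomology $H^1_{\mathrm{dR}}(X/A)$ is a free $A$-module with basis $\omega_{ij},\eta_{ij}$, $i\in\{1,\dots,N-1\}$, $j\in\{1,\dots,M-1\}$.
   Context: Let $N,M\geq2$ be integers and $W$ a commutative ring in which $NM$ is invertible and which contains a primitive $\mathrm{lcm}(N,M)$-th root of unity. Let $A=W[t,(t-t^2)^{-1}]$ and $X\subset\mathbb P^1_A\times\mathbb P^1_A$ (coordinates $(X_0:X_1)$, $(Y_0:Y_1)$) defined by $(X_0^N-X_1^N)(Y_0^M-Y_1^M)=tX_0^NY_0^M$ (smooth projective over $A$). Put $x=X_1/X_0$, $y=Y_1/Y_0$, $z=x^{-1}$, $w=y^{-1}$, $U_0=\{X_0Y_0\ne0\}$, $U_1=\{X_1Y_1\ne0\}$. $H^1_{\mathrm{dR}}(X/A)$ is computed as the first cohomology of the total complex of the Čech double complex of $\mathcal O_X\xrightarrow{d}\Omega^1_{X/A}$ for the cover $\{U_0,U_1\}$ (Čech differential $(u_0,u_1)\mapsto u_1-u_0$); so a class is given by $(f)\times(\omega_0,\omega_1)$ with $f\in\Gamma(U_0\cap U_1,\mathcal O_X)$, $\omega_k\in\Gamma(U_k,\Omega^1_{X/A})$, $df=\omega_1-\omega_0$. $\omega_{ij}:=N\frac{x^{i-1}y^{j-M}}{1-x^N}dx$ (a global $1$-form), viewed in $H^1_{\mathrm{dR}}$ as $(0)\times(\omega_{ij}|_{U_0},\omega_{ij}|_{U_1})$. $\eta_{ij}$ is the class of the cocycle $(x^iy^{j-M})\times(\eta^0_{ij},\eta^1_{ij})$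 where $\eta^0_{ij}=-\big(\frac{(j-M)t}{M}+\frac iN(1-x^N)\big)\omega_{ij}$ and $\eta^1_{ij}=-(j-M)(1-t)z^{N-i}w^{M-j-1}dw$. *)

theory Defs
  imports
    "HOL-Algebra.Algebraic_Closure_Type"
    "HOL-Library.Poly_Mapping"
    "HOL-Library.Product_Plus"
begin

section \<open>The base ring\<close>

definition primitive_root_of_unity :: "nat \<Rightarrow> 'w::comm_ring_1 \<Rightarrow> bool" where
  "primitive_root_of_unity n \<zeta> \<longleftrightarrow> 0 < n \<and> \<zeta> ^ n = 1 \<and> (\<forall>k. 0 < k \<and> k < n \<longrightarrow> \<zeta> ^ k \<noteq> 1)"

definition tt :: "'w::comm_ring_1 poly" where
  "tt = [:0, 1:] - [:0, 1:] ^ 2"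

lemma tt_power_nonzero: "tt ^ k \<noteq> (0 :: 'w::comm_ring_1 poly)"
proof -
  have tt: "tt = [:0, 1:] * ([:1, -1:] :: 'w poly)"
    by (simp add: tt_def power2_eq_square)
  have "tt ^ k = monom 1 k * ([:1, -1:] :: 'w poly) ^ k"
    unfolding tt power_mult_distrib monom_altdef by simp
  then have "coeff (tt ^ k :: 'w poly) k = 1"
    by (simp add: coeff_monom_mult poly_0_coeff_0 [symmetric])
  then show ?thesis
    by auto
qed

definition frac_rel :: "'w::comm_ring_1 poly \<times> nat \<Rightarrow> 'w poly \<times> nat \<Rightarrow> bool" where
  "frac_rel = (\<lambda>(p, m) (q, n). \<exists>k. p * tt ^ n * tt ^ k = q * tt ^ m * tt ^ k)"

lemma equivp_frac_rel: "equivp (frac_rel :: 'w::comm_ring_1 poly \<times> nat \<Rightarrow> _)"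
proof (rule equivpI)
  show "reflp (frac_rel :: 'w poly \<times> nat \<Rightarrow> _)"
    by (auto simp: reflp_def frac_rel_def)
  show "symp (frac_rel :: 'w poly \<times> nat \<Rightarrow> _)"
    by (auto simp: symp_def frac_rel_def intro: sym)
  show "transp (frac_rel :: 'w poly \<times> nat \<Rightarrow> _)"
  proof (rule transpI)
    fix a b c :: "'w poly \<times> nat"
    assume "frac_rel a b" "frac_rel b c"
    obtain p m q n r l where abc: "a = (p, m)" "b = (q, n)" "c = (r, l)"
      by (metis surj_pair)
    obtain k k' where k: "p * tt ^ n * tt ^ k = q * tt ^ m * tt ^ k"
      and k': "q * tt ^ l * tt ^ k' = r * tt ^ n * tt ^ k'"
      using \<open>frac_rel a b\<close> \<open>frac_rel b c\<close> abc by (auto simp: frac_rel_def)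
    have "p * tt ^ l * tt ^ (n + k + k') = (p * tt ^ n * tt ^ k) * (tt ^ l * tt ^ k')"
      by (simp add: power_add ac_simps)
    also have "\<dots> = (q * tt ^ l * tt ^ k') * (tt ^ m * tt ^ k)"
      by (simp only: k) (simp add: ac_simps)
    also have "\<dots> = r * tt ^ m * tt ^ (n + k + k')"
      by (simp only: k') (simp add: power_add ac_simps)
    finally show "frac_rel a c"
      unfolding abc frac_rel_def by auto
  qed
qed

text \<open>
  \<open>'w param_ring\<close> is the ring $A = W[t, (t - t^2)^{-1}]$, the localization of $W[t]$ at the powers
  of $t - t^2$; the pair \<open>(p, n)\<close> stands for $p / (t - t^2)^n$.
\<close>

quotient_type (overloaded) 'w param_ring = "'w::comm_ring_1 poly \<times> nat" / frac_rel
  by (rule equivp_frac_rel)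

lemma frac_relI: "p * tt ^ n = q * tt ^ m \<Longrightarrow> frac_rel (p, m) (q, n)"
  by (auto simp: frac_rel_def)

instantiation param_ring :: (comm_ring_1) comm_ring_1
begin

lift_definition zero_param_ring :: "'a param_ring" is "(0, 0)" .
lift_definition one_param_ring :: "'a param_ring" is "(1, 0)" .

lift_definition plus_param_ring :: "'a param_ring \<Rightarrow> 'a param_ring \<Rightarrow> 'a param_ring"
  is "\<lambda>(p, m) (q, n). (p * tt ^ n + q * tt ^ m, m + n)"
proof -
  fix a a' b b' :: "'a poly \<times> nat"
  assume rel: "frac_rel a a'" "frac_rel b b'"
  obtain p m p' m' q n q' n' where e: "a = (p, m)" "a' = (p', m')" "b = (q, n)" "b' = (q', n')"
    by (metis surj_pair)
  obtain k l where k: "p * tt ^ m' * tt ^ k = p' * tt ^ m * tt ^ k"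
    and l: "q * tt ^ n' * tt ^ l = q' * tt ^ n * tt ^ l"
    using rel e by (auto simp: frac_rel_def)
  have "(p * tt ^ n + q * tt ^ m) * tt ^ (m' + n') * tt ^ (k + l)
      = (p * tt ^ m' * tt ^ k) * (tt ^ n * tt ^ n' * tt ^ l)
        + (q * tt ^ n' * tt ^ l) * (tt ^ m * tt ^ m' * tt ^ k)"
    by (simp add: power_add algebra_simps)
  also have "\<dots> = (p' * tt ^ n' + q' * tt ^ m') * tt ^ (m + n) * tt ^ (k + l)"
    by (simp only: k l) (simp add: power_add algebra_simps)
  finally show "frac_rel ((case a of (p, m) \<Rightarrow> \<lambda>(q, n). (p * tt ^ n + q * tt ^ m, m + n)) b)
      ((case a' of (p, m) \<Rightarrow> \<lambda>(q, n). (p * tt ^ n + q * tt ^ m, m + n)) b')"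
    unfolding e frac_rel_def by auto
qed

lift_definition uminus_param_ring :: "'a param_ring \<Rightarrow> 'a param_ring"
  is "\<lambda>(p, m). (- p, m)"
  by (auto simp: frac_rel_def)

definition minus_param_ring :: "'a param_ring \<Rightarrow> 'a param_ring \<Rightarrow> 'a param_ring" where
  "minus_param_ring a b = a + (- b)"

lift_definition times_param_ring :: "'a param_ring \<Rightarrow> 'a param_ring \<Rightarrow> 'a param_ring"
  is "\<lambda>(p, m) (q, n). (p * q, m + n)"
proof -
  fix a a' b b' :: "'a poly \<times> nat"
  assume rel: "frac_rel a a'" "frac_rel b b'"
  obtain p m p' m' q n q' n' where e: "a = (p, m)" "a' = (p', m')" "b = (q, n)" "b' = (q', n')"
    by (metis surj_pair)
  obtain k l where k: "p * tt ^ m' * tt ^ k = p' * tt ^ m * tt ^ k"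
    and l: "q * tt ^ n' * tt ^ l = q' * tt ^ n * tt ^ l"
    using rel e by (auto simp: frac_rel_def)
  have "p * q * tt ^ (m' + n') * tt ^ (k + l)
      = (p * tt ^ m' * tt ^ k) * (q * tt ^ n' * tt ^ l)"
    by (simp add: power_add ac_simps)
  also have "\<dots> = p' * q' * tt ^ (m + n) * tt ^ (k + l)"
    by (simp only: k l) (simp add: power_add ac_simps)
  finally show "frac_rel ((case a of (p, m) \<Rightarrow> \<lambda>(q, n). (p * q, m + n)) b)
      ((case a' of (p, m) \<Rightarrow> \<lambda>(q, n). (p * q, m + n)) b')"
    unfolding e frac_rel_def by auto
qed

instance
proof
  fix a b c :: "'a param_ring"
  show "a * b * c = a * (b * c)"
    by transfer (auto intro!: frac_relI simp: ac_simps)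
  show "a * b = b * a"
    by transfer (auto intro!: frac_relI simp: ac_simps)
  show "1 * a = a"
    by transfer (auto intro!: frac_relI)
  show "a + b + c = a + (b + c)"
    by transfer (auto intro!: frac_relI simp: power_add algebra_simps)
  show "a + b = b + a"
    by transfer (auto intro!: frac_relI simp: power_add algebra_simps)
  show "0 + a = a"
    by transfer (auto intro!: frac_relI)
  show "- a + a = 0"
    by transfer (auto intro!: frac_relI)
  show "a - b = a + - b"
    by (rule minus_param_ring_def)
  show "(a + b) * c = a * c + b * c"
    by transfer (auto intro!: frac_relI simp: power_add algebra_simps)
  show "(0 :: 'a param_ring) \<noteq> 1"
    by transfer (auto simp: frac_rel_def tt_power_nonzero)
qed

end

lift_definition param :: "'w::comm_ring_1 param_ring" is "([:0, 1:], 0)" .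

lemma param_unit: "(param - param ^ 2) dvd (1 :: 'w::comm_ring_1 param_ring)"
proof -
  have "param - param ^ 2 = (abs_param_ring (tt, 0) :: 'w param_ring)"
    unfolding power2_eq_square minus_param_ring_def
    by transfer (auto intro!: frac_relI simp: tt_def power2_eq_square one_pCons)
  moreover have "abs_param_ring (tt, 0) * abs_param_ring (1, 1) = (1 :: 'w param_ring)"
    by (simp add: times_param_ring.abs_eq one_param_ring_def param_ring.abs_eq_iff frac_relI)
  ultimately show ?thesis
    by (metis dvd_triv_left)
qed


section \<open>Modules\<close>

definition generated_submodule :: "('r, 'k) ring_scheme \<Rightarrow> ('r, 'm, 'l) module_scheme \<Rightarrow> 'm set \<Rightarrow> 'm set" where
  "generated_submodule R M S = \<Inter>{H. submodule H R M \<and> S \<subseteq> H}"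

text \<open>
  The record type \<open>module\<close> extends \<open>ring\<close>; the fields \<open>mult\<close> and \<open>one\<close> play no role for a module
  and are left unspecified below.
\<close>

definition quotient_module :: "('r, 'm, 'l) module_scheme \<Rightarrow> 'm set \<Rightarrow> ('r, 'm set) module" where
  "quotient_module M H =
    \<lparr>carrier = a_rcosets\<^bsub>M\<^esub> H, monoid.mult = undefined, one = undefined,
     zero = H, add = set_add M, module.smult = (\<lambda>r C. \<Union>x\<in>C. H +>\<^bsub>M\<^esub> (r \<odot>\<^bsub>M\<^esub> x))\<rparr>"

definition free_with_basis ::
    "('r, 'k) ring_scheme \<Rightarrow> ('r, 'm, 'l) module_scheme \<Rightarrow> 'i set \<Rightarrow> ('i \<Rightarrow> 'm) \<Rightarrow> bool" where
  "free_with_basis R M I e \<longleftrightarrow>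
    module R M \<and> finite I \<and> e \<in> I \<rightarrow> carrier M \<and>
    (\<forall>m \<in> carrier M. \<exists>c \<in> I \<rightarrow> carrier R. m = (\<Oplus>\<^bsub>M\<^esub>i\<in>I. c i \<odot>\<^bsub>M\<^esub> e i)) \<and>
    (\<forall>c \<in> I \<rightarrow> carrier R. (\<Oplus>\<^bsub>M\<^esub>i\<in>I. c i \<odot>\<^bsub>M\<^esub> e i) = \<zero>\<^bsub>M\<^esub> \<longrightarrow> (\<forall>i\<in>I. c i = \<zero>\<^bsub>R\<^esub>))"


section \<open>Kaehler differentials\<close>

text \<open>
  For a ring homomorphism \<open>\<phi>\<close> from \<open>A\<close> to \<open>B\<close>, the \<open>B\<close>-module \<open>kaehler A \<phi> B\<close> is the quotient of
  the free module on symbols \<open>d b\<close>, \<open>b \<in> carrier B\<close>, by additivity, the Leibniz rule and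
  \<open>d (\<phi> a) = 0\<close>.  An element of the free module is its coefficient function.
\<close>

definition free_on_carrier :: "('b, 'k) ring_scheme \<Rightarrow> ('b, 'b \<Rightarrow> 'b) module" where
  "free_on_carrier B =
    \<lparr>carrier = {u. (\<forall>b. u b \<in> carrier B) \<and> finite {b. u b \<noteq> \<zero>\<^bsub>B\<^esub>} \<and> {b. u b \<noteq> \<zero>\<^bsub>B\<^esub>} \<subseteq> carrier B},
     monoid.mult = undefined, one = undefined,
     zero = (\<lambda>b. \<zero>\<^bsub>B\<^esub>), add = (\<lambda>u v b. u b \<oplus>\<^bsub>B\<^esub> v b), module.smult = (\<lambda>r u b. r \<otimes>\<^bsub>B\<^esub> u b)\<rparr>"

definition free_symbol :: "('b, 'k) ring_scheme \<Rightarrow> 'b \<Rightarrow> 'b \<Rightarrow> 'b" where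
  "free_symbol B b = (\<lambda>c. if c = b then \<one>\<^bsub>B\<^esub> else \<zero>\<^bsub>B\<^esub>)"

definition kaehler_relations ::
    "('a, 'j) ring_scheme \<Rightarrow> ('a \<Rightarrow> 'b) \<Rightarrow> ('b, 'k) ring_scheme \<Rightarrow> ('b \<Rightarrow> 'b) set" where
  "kaehler_relations A \<phi> B = (let F = free_on_carrier B; s = free_symbol B in
    {s (b \<oplus>\<^bsub>B\<^esub> c) \<ominus>\<^bsub>F\<^esub> (s b \<oplus>\<^bsub>F\<^esub> s c) | b c. b \<in> carrier B \<and> c \<in> carrier B} \<union>
    {s (b \<otimes>\<^bsub>B\<^esub> c) \<ominus>\<^bsub>F\<^esub> (b \<odot>\<^bsub>F\<^esub> s c \<oplus>\<^bsub>F\<^esub> c \<odot>\<^bsub>F\<^esub> s b) | b c. b \<in> carrier B \<and> c \<in> carrier B} \<union>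
    {s (\<phi> a) | a. a \<in> carrier A})"

definition kaehler_null ::
    "('a, 'j) ring_scheme \<Rightarrow> ('a \<Rightarrow> 'b) \<Rightarrow> ('b, 'k) ring_scheme \<Rightarrow> ('b \<Rightarrow> 'b) set" where
  "kaehler_null A \<phi> B = generated_submodule B (free_on_carrier B) (kaehler_relations A \<phi> B)"

definition kaehler ::
    "('a, 'j) ring_scheme \<Rightarrow> ('a \<Rightarrow> 'b) \<Rightarrow> ('b, 'k) ring_scheme \<Rightarrow> ('b, ('b \<Rightarrow> 'b) set) module" where
  "kaehler A \<phi> B = quotient_module (free_on_carrier B) (kaehler_null A \<phi> B)"

definition kaehler_d ::
    "('a, 'j) ring_scheme \<Rightarrow> ('a \<Rightarrow> 'b) \<Rightarrow> ('b, 'k) ring_scheme \<Rightarrow> 'b \<Rightarrow> ('b \<Rightarrow> 'b) set" where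
  "kaehler_d A \<phi> B b = kaehler_null A \<phi> B +>\<^bsub>free_on_carrier B\<^esub> free_symbol B b"

text \<open>
  The map of differentials induced by a homomorphism \<open>\<rho>\<close> of \<open>A\<close>-algebras from \<open>B\<close> to
  \<open>(B', \<phi>')\<close>: a coset represented by \<open>\<Sum> u\<^sub>b d b\<close> is sent to \<open>\<Sum> \<rho> u\<^sub>b d (\<rho> b)\<close>.
\<close>

definition kaehler_map ::
    "('a, 'j) ring_scheme \<Rightarrow> ('b, 'k) ring_scheme \<Rightarrow> ('a \<Rightarrow> 'c) \<Rightarrow> ('c, 'l) ring_scheme \<Rightarrow> ('b \<Rightarrow> 'c)
      \<Rightarrow> ('b \<Rightarrow> 'b) set \<Rightarrow> ('c \<Rightarrow> 'c) set" where
  "kaehler_map A B \<phi>' B' \<rho> C = the_elem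
    ((\<lambda>u. \<Oplus>\<^bsub>kaehler A \<phi>' B'\<^esub>b\<in>{b. u b \<noteq> \<zero>\<^bsub>B\<^esub>}. \<rho> (u b) \<odot>\<^bsub>kaehler A \<phi>' B'\<^esub> kaehler_d A \<phi>' B' (\<rho> b)) ` C)"


section \<open>The curve and its affine pieces\<close>

text \<open>
  Everything takes place in $A[X_0^{\pm 1}, X_1^{\pm 1}, Y_0^{\pm 1}, Y_1^{\pm 1}]$; the exponent
  \<open>(a0, a1, b0, b1)\<close> stands for $X_0^{a_0} X_1^{a_1} Y_0^{b_0} Y_1^{b_1}$.
\<close>

type_synonym expo = "int \<times> int \<times> int \<times> int"
type_synonym 'a laurent = "expo \<Rightarrow>\<^sub>0 'a"

abbreviation const :: "'a \<Rightarrow> 'a::comm_ring_1 laurent" where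
  "const a \<equiv> Poly_Mapping.single 0 a"

abbreviation mon :: "int \<Rightarrow> int \<Rightarrow> int \<Rightarrow> int \<Rightarrow> 'a::comm_ring_1 laurent" where
  "mon a0 a1 b0 b1 \<equiv> Poly_Mapping.single (a0, a1, b0, b1) 1"

definition X0 :: "'a::comm_ring_1 laurent" where "X0 = mon 1 0 0 0"
definition X1 :: "'a::comm_ring_1 laurent" where "X1 = mon 0 1 0 0"
definition Y0 :: "'a::comm_ring_1 laurent" where "Y0 = mon 0 0 1 0"
definition Y1 :: "'a::comm_ring_1 laurent" where "Y1 = mon 0 0 0 1"

definition curve_form :: "nat \<Rightarrow> nat \<Rightarrow> 'a \<Rightarrow> 'a::comm_ring_1 laurent" where
  "curve_form N M t = (X0 ^ N - X1 ^ N) * (Y0 ^ M - Y1 ^ M) - const t * X0 ^ N * Y0 ^ M"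

text \<open>
  An open set is given by the exponents occurring in the localization of
  $S = A[X_0, X_1, Y_0, Y_1]$ at the monomial whose non-vanishing defines it:
  $X_0 Y_0$ for \<open>U0\<close>, $X_1 Y_1$ for \<open>U1\<close>, and $X_0 Y_0 X_1 Y_1$ for the intersection \<open>U01\<close>.
  For such a monomial $g$ the ring of functions on $\{g \neq 0\} \subset X$ is the bidegree $(0,0)$
  part of $S[g^{-1}]$ modulo the bidegree $(0,0)$ part of the ideal generated by the equation.
\<close>

definition U0 :: "expo set" where "U0 = {(a0, a1, b0, b1). 0 \<le> a1 \<and> 0 \<le> b1}"
definition U1 :: "expo set" where "U1 = {(a0, a1, b0, b1). 0 \<le> a0 \<and> 0 \<le> b0}"
definition U01 :: "expo set" where "U01 = UNIV"

definition bidegree0 :: "expo set" where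
  "bidegree0 = {(a0, a1, b0, b1). a0 + a1 = 0 \<and> b0 + b1 = 0}"

definition ambient :: "expo set \<Rightarrow> 'a::comm_ring_1 laurent ring" where
  "ambient U = ring_of_type_algebra\<lparr>carrier := {p. Poly_Mapping.keys p \<subseteq> U \<inter> bidegree0}\<rparr>"

definition curve_ideal :: "nat \<Rightarrow> nat \<Rightarrow> 'a \<Rightarrow> expo set \<Rightarrow> 'a::comm_ring_1 laurent set" where
  "curve_ideal N M t U = {curve_form N M t * q | q. Poly_Mapping.keys q \<subseteq> U} \<inter> carrier (ambient U)"

definition OX :: "nat \<Rightarrow> nat \<Rightarrow> 'a \<Rightarrow> expo set \<Rightarrow> 'a::comm_ring_1 laurent set ring" where
  "OX N M t U = ambient U Quot curve_ideal N M t U"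

definition fn :: "nat \<Rightarrow> nat \<Rightarrow> 'a \<Rightarrow> expo set \<Rightarrow> 'a laurent \<Rightarrow> 'a::comm_ring_1 laurent set" where
  "fn N M t U p = curve_ideal N M t U +>\<^bsub>ambient U\<^esub> p"

definition scal :: "nat \<Rightarrow> nat \<Rightarrow> 'a \<Rightarrow> expo set \<Rightarrow> 'a \<Rightarrow> 'a::comm_ring_1 laurent set" where
  "scal N M t U a = fn N M t U (const a)"

text \<open>Restriction to \<open>U01\<close> sends a coset to the coset modulo the larger ideal that contains it.\<close>

definition res_fn :: "nat \<Rightarrow> nat \<Rightarrow> 'a \<Rightarrow> 'a::comm_ring_1 laurent set \<Rightarrow> 'a laurent set" where
  "res_fn N M t C = C <+>\<^bsub>ambient U01\<^esub> curve_ideal N M t U01"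

type_synonym 'a form = "('a laurent set \<Rightarrow> 'a laurent set) set"

definition Omega :: "nat \<Rightarrow> nat \<Rightarrow> 'a \<Rightarrow> expo set \<Rightarrow> ('a::comm_ring_1 laurent set, 'a form) module" where
  "Omega N M t U = kaehler ring_of_type_algebra (scal N M t U) (OX N M t U)"

definition dX :: "nat \<Rightarrow> nat \<Rightarrow> 'a \<Rightarrow> expo set \<Rightarrow> 'a::comm_ring_1 laurent set \<Rightarrow> 'a form" where
  "dX N M t U = kaehler_d ring_of_type_algebra (scal N M t U) (OX N M t U)"

definition res_form :: "nat \<Rightarrow> nat \<Rightarrow> 'a \<Rightarrow> expo set \<Rightarrow> 'a::comm_ring_1 form \<Rightarrow> 'a form" where
  "res_form N M t U =
    kaehler_map ring_of_type_algebra (OX N M t U) (scal N M t U01) (OX N M t U01) (res_fn N M t)"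


section \<open>De Rham cohomology\<close>

text \<open>
  The total complex of the Cech double complex is
  $(u_0, u_1) \mapsto (u_1 - u_0, d u_0, d u_1)$ followed by
  $(f, \omega_0, \omega_1) \mapsto d f - (\omega_1 - \omega_0)$.
\<close>

type_synonym 'a cochain = "'a laurent set \<times> 'a form \<times> 'a form"

definition cochains1 :: "nat \<Rightarrow> nat \<Rightarrow> 'a \<Rightarrow> ('a::comm_ring_1, 'a cochain) module" where
  "cochains1 N M t =
    \<lparr>carrier = carrier (OX N M t U01) \<times> carrier (Omega N M t U0) \<times> carrier (Omega N M t U1),
     monoid.mult = undefined, one = undefined,
     zero = (\<zero>\<^bsub>OX N M t U01\<^esub>, \<zero>\<^bsub>Omega N M t U0\<^esub>, \<zero>\<^bsub>Omega N M t U1\<^esub>),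
     add = (\<lambda>(f, \<omega>0, \<omega>1) (g, \<eta>0, \<eta>1).
       (f \<oplus>\<^bsub>OX N M t U01\<^esub> g, \<omega>0 \<oplus>\<^bsub>Omega N M t U0\<^esub> \<eta>0, \<omega>1 \<oplus>\<^bsub>Omega N M t U1\<^esub> \<eta>1)),
     module.smult = (\<lambda>a (f, \<omega>0, \<omega>1).
       (scal N M t U01 a \<otimes>\<^bsub>OX N M t U01\<^esub> f,
        scal N M t U0 a \<odot>\<^bsub>Omega N M t U0\<^esub> \<omega>0,
        scal N M t U1 a \<odot>\<^bsub>Omega N M t U1\<^esub> \<omega>1))\<rparr>"

definition cocycles1 :: "nat \<Rightarrow> nat \<Rightarrow> 'a \<Rightarrow> 'a::comm_ring_1 cochain set" where
  "cocycles1 N M t = {(f, \<omega>0, \<omega>1) \<in> carrier (cochains1 N M t).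
    dX N M t U01 f = res_form N M t U1 \<omega>1 \<ominus>\<^bsub>Omega N M t U01\<^esub> res_form N M t U0 \<omega>0}"

definition coboundaries1 :: "nat \<Rightarrow> nat \<Rightarrow> 'a \<Rightarrow> 'a::comm_ring_1 cochain set" where
  "coboundaries1 N M t =
    {(res_fn N M t u1 \<ominus>\<^bsub>OX N M t U01\<^esub> res_fn N M t u0, dX N M t U0 u0, dX N M t U1 u1) | u0 u1.
      u0 \<in> carrier (OX N M t U0) \<and> u1 \<in> carrier (OX N M t U1)}"

definition H1dR :: "nat \<Rightarrow> nat \<Rightarrow> 'a \<Rightarrow> ('a::comm_ring_1, 'a cochain set) module" where
  "H1dR N M t = quotient_module ((cochains1 N M t)\<lparr>carrier := cocycles1 N M t\<rparr>) (coboundaries1 N M t)"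

definition H1class :: "nat \<Rightarrow> nat \<Rightarrow> 'a \<Rightarrow> 'a::comm_ring_1 cochain \<Rightarrow> 'a cochain set" where
  "H1class N M t c = coboundaries1 N M t +>\<^bsub>(cochains1 N M t)\<lparr>carrier := cocycles1 N M t\<rparr>\<^esub> c"


section \<open>The classes $\omega_{ij}$ and $\eta_{ij}$\<close>

definition xx :: "'a::comm_ring_1 laurent" where "xx = mon (-1) 1 0 0"
definition zz :: "'a::comm_ring_1 laurent" where "zz = mon 1 (-1) 0 0"
definition ww :: "'a::comm_ring_1 laurent" where "ww = mon 0 0 1 (-1)"

text \<open>The power $y^k$ of $y = Y_1 / Y_0$, for an integer $k$.\<close>

definition ypow :: "int \<Rightarrow> 'a::comm_ring_1 laurent" where "ypow k = mon 0 0 (- k) k"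

definition omega_form01 :: "nat \<Rightarrow> nat \<Rightarrow> 'a \<Rightarrow> nat \<Rightarrow> nat \<Rightarrow> 'a::comm_ring_1 form" where
  "omega_form01 N M t i j =
    (fn N M t U01 (of_nat N * xx ^ (i - 1) * ypow (int j - int M))
       \<otimes>\<^bsub>OX N M t U01\<^esub> inv\<^bsub>OX N M t U01\<^esub> (fn N M t U01 (1 - xx ^ N)))
     \<odot>\<^bsub>Omega N M t U01\<^esub> dX N M t U01 (fn N M t U01 xx)"

text \<open>
  The formula for $\omega_{ij}$ makes sense literally only where $x$ and $y$ are invertible; on
  \<open>U0\<close> and \<open>U1\<close> the form is the section restricting to it on \<open>U01\<close>.
\<close>

definition omega_form :: "nat \<Rightarrow> nat \<Rightarrow> 'a \<Rightarrow> expo set \<Rightarrow> nat \<Rightarrow> nat \<Rightarrow> 'a::comm_ring_1 form" where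
  "omega_form N M t U i j =
    (THE \<theta>. \<theta> \<in> carrier (Omega N M t U) \<and> res_form N M t U \<theta> = omega_form01 N M t i j)"

definition omega :: "nat \<Rightarrow> nat \<Rightarrow> 'a \<Rightarrow> nat \<Rightarrow> nat \<Rightarrow> 'a::comm_ring_1 cochain set" where
  "omega N M t i j =
    H1class N M t (\<zero>\<^bsub>OX N M t U01\<^esub>, omega_form N M t U0 i j, omega_form N M t U1 i j)"

definition eta_form0 :: "nat \<Rightarrow> nat \<Rightarrow> 'a \<Rightarrow> nat \<Rightarrow> nat \<Rightarrow> 'a::comm_ring_1 form" where
  "eta_form0 N M t i j =
    \<ominus>\<^bsub>Omega N M t U0\<^esub>
      (fn N M t U0
         (const (of_int (int j - int M) * t * inv\<^bsub>ring_of_type_algebra\<^esub> (of_nat M))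
          + const (of_nat i * inv\<^bsub>ring_of_type_algebra\<^esub> (of_nat N)) * (1 - xx ^ N))
       \<odot>\<^bsub>Omega N M t U0\<^esub> omega_form N M t U0 i j)"

definition eta_form1 :: "nat \<Rightarrow> nat \<Rightarrow> 'a \<Rightarrow> nat \<Rightarrow> nat \<Rightarrow> 'a::comm_ring_1 form" where
  "eta_form1 N M t i j =
    \<ominus>\<^bsub>Omega N M t U1\<^esub>
      (fn N M t U1 (const (of_int (int j - int M) * (1 - t)) * zz ^ (N - i) * ww ^ (M - j - 1))
       \<odot>\<^bsub>Omega N M t U1\<^esub> dX N M t U1 (fn N M t U1 ww))"

definition eta :: "nat \<Rightarrow> nat \<Rightarrow> 'a \<Rightarrow> nat \<Rightarrow> nat \<Rightarrow> 'a::comm_ring_1 cochain set" where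
  "eta N M t i j =
    H1class N M t
      (fn N M t U01 (xx ^ i * ypow (int j - int M)), eta_form0 N M t i j, eta_form1 N M t i j)"

end

(*
  On each affine piece the curve has an equation e u^N v^M - u^N - v^M + e' = 0 with e e' = 1 - t,
  equivalently (1 - e u^N)(1 - e v^M) = t, where (u, v, e, e') is (x, y, 1, 1 - t) on U0 and U01 and
  (z, w, 1 - t, 1) on U1.  The Hamiltonian derivation D of the equation has D u and D v generating
  the unit ideal, so the differentials are free on the form theta with d p = (D p) theta; the two
  generators are related by theta1 = x^(N-2) y^(M-2) theta0.  A cochain thus becomes a triple of
  Laurent polynomials in x and y modulo the equation.

  The Newton polygon of the equation is the rectangle [0, N] x [0, M] with unit coefficients at its
  corners.  Reduction along the corners -x^N and -y^M writes every function on U01 as u1 - u0 plus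
  a combination of the x^i y^(j-M); as the latter lift to the cocycles eta_ij, it remains to treat
  cocycles (0, omega0, omega1), that is, global forms.  Conversely, the extremal points of the
  support of a multiple of the equation show that the x^i y^(j-M) are independent modulo
  O(U0) + O(U1), that O(U0) and O(U1) meet in constants, and that the global forms are spanned by
  the x^(i-1) y^(j-1) theta0 = omega_ij / (N M).
*)
theory Submission
  imports Defs
begin

section \<open>Quotient modules\<close>

text \<open>They are replaced by one observation: an extremal exponent of \<open>q\<close>, moved by
  a corner of coefficient -1, survives in the product with the equation. Each claim that a
  polynomial vanishes or splits is read off from the region in which such exponents may lie.

  The two families of classes reflect the extension 0 -> H^0(Omega) -> H^1_dR -> H^1(O) -> 0: the
  omegas are a basis of the subobject, and the etas lift a basis of the quotient. The explicit eta
  cocycles give surjectivity on the right. On the left, a global form that is a coboundary vanishes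
  because functions common to both charts are constant.

  The units enter at definite places. The inverses of t, N, M and of the constant coefficient e'
  certify that the partial derivatives of the equation generate the unit ideal; the inverse of t
  also inverts 1 - x^N on the overlap; and the inverse of N M normalises the coefficients of the
  omegas.\<close>

lemma (in abelian_group) minus_eq_zero_iff:
  assumes "a \<in> carrier G" "b \<in> carrier G"
  shows "a \<ominus> b = \<zero> \<longleftrightarrow> a = b"
proof
  assume "a \<ominus> b = \<zero>"
  then have "(a \<ominus> b) \<oplus> b = \<zero> \<oplus> b"
    by simp
  moreover have "(a \<ominus> b) \<oplus> b = a"
    using assms by (simp add: minus_eq a_assoc l_neg)
  ultimately show "a = b"
    using assms by simp
qed (use assms in \<open>simp add: minus_eq r_neg\<close>)

locale module_quotient = module R M for R (structure) and M (structure) +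
  fixes H
  assumes sub: "submodule H R M"
begin

abbreviation proj where "proj x \<equiv> H +>\<^bsub>M\<^esub> x"
abbreviation Q where "Q \<equiv> quotient_module M H"

lemma H_subset: "H \<subseteq> carrier M"
  and H_zero: "\<zero>\<^bsub>M\<^esub> \<in> H"
  and H_smult: "\<And>a x. a \<in> carrier R \<Longrightarrow> x \<in> H \<Longrightarrow> a \<odot>\<^bsub>M\<^esub> x \<in> H"
  using submoduleE[OF sub] subgroup.one_closed[OF submodule.axioms(1)[OF sub]] by auto

sublocale abelian_subgroup H M
  using submodule.axioms(1)[OF sub] a_comm_group by (rule abelian_subgroupI2[rotated])

lemma proj_self: "x \<in> carrier M \<Longrightarrow> x \<in> proj x"
  using H_zero by (force simp: a_r_coset_def')

lemma proj_eq_iff: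
  assumes "x \<in> carrier M" "y \<in> carrier M"
  shows "proj x = proj y \<longleftrightarrow> x \<ominus>\<^bsub>M\<^esub> y \<in> H"
proof -
  have "x \<in> proj x"
    using assms by (simp add: proj_self)
  then have "proj x = proj y \<longleftrightarrow> x \<in> proj y"
    using a_repr_independence'[of x y] assms by auto
  then show ?thesis
    using a_rcos_module[OF assms(2,1)] by (simp add: M.minus_eq)
qed

lemma mem_proj: "x \<in> carrier M \<Longrightarrow> y \<in> proj x \<Longrightarrow> y \<in> carrier M"
  by (rule a_elemrcos_carrier)

lemma carrier_Q: "carrier Q = proj ` carrier M"
  by (auto simp: quotient_module_def A_RCOSETS_def')

lemma proj_closed [simp]: "x \<in> carrier M \<Longrightarrow> proj x \<in> carrier Q"
  by (auto simp: carrier_Q)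

lemma add_Q:
  "x \<in> carrier M \<Longrightarrow> y \<in> carrier M \<Longrightarrow> proj x \<oplus>\<^bsub>Q\<^esub> proj y = proj (x \<oplus>\<^bsub>M\<^esub> y)"
  by (simp add: quotient_module_def a_rcos_sum)

lemma zero_Q: "\<zero>\<^bsub>Q\<^esub> = proj \<zero>\<^bsub>M\<^esub>"
  using H_subset by (simp add: quotient_module_def)

text \<open>The union that defines the scalar action has equal members: two representatives differ
  by an element of \<open>H\<close>, and \<open>H\<close> is stable under scalars.\<close>

lemma smult_Q:
  assumes "r \<in> carrier R" "x \<in> carrier M"
  shows "r \<odot>\<^bsub>Q\<^esub> proj x = proj (r \<odot>\<^bsub>M\<^esub> x)"
proof -
  have "proj (r \<odot>\<^bsub>M\<^esub> y) = proj (r \<odot>\<^bsub>M\<^esub> x)" if y: "y \<in> proj x" for y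
  proof -
    have yc: "y \<in> carrier M"
      using assms y by (auto intro: mem_proj)
    have "y \<ominus>\<^bsub>M\<^esub> x \<in> H"
      using a_rcos_module[OF assms(2) yc] y by (simp add: M.minus_eq)
    then have "r \<odot>\<^bsub>M\<^esub> (y \<ominus>\<^bsub>M\<^esub> x) \<in> H"
      using H_smult assms by simp
    then show ?thesis
      using assms yc by (simp add: proj_eq_iff M.minus_eq smult_r_distr smult_r_minus)
  qed
  moreover have "x \<in> proj x"
    using assms by (simp add: proj_self)
  ultimately have "(\<Union>y\<in>proj x. proj (r \<odot>\<^bsub>M\<^esub> y)) = proj (r \<odot>\<^bsub>M\<^esub> x)"
    by blast
  then show ?thesis
    by (simp add: quotient_module_def)
qed

lemma zero_Q_iff: "x \<in> carrier M \<Longrightarrow> proj x = \<zero>\<^bsub>Q\<^esub> \<longleftrightarrow> x \<in> H"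
  unfolding zero_Q using H_subset M.a_coset_join1[OF _ _ a_subgroup] M.a_coset_join2[OF _ a_subgroup]
  by auto

lemma module_Q: "module R Q"
proof (rule moduleI)
  show "cring R" ..
  show "abelian_group Q"
  proof (rule abelian_groupI)
    show "\<exists>y\<in>carrier Q. y \<oplus>\<^bsub>Q\<^esub> x = \<zero>\<^bsub>Q\<^esub>" if "x \<in> carrier Q" for x
    proof -
      obtain u where "u \<in> carrier M" "x = proj u"
        using \<open>x \<in> carrier Q\<close> by (auto simp: carrier_Q)
      then show ?thesis
        by (intro bexI[of _ "proj (\<ominus>\<^bsub>M\<^esub> u)"]) (auto simp: add_Q zero_Q M.l_neg)
    qed
  qed (auto simp: carrier_Q add_Q zero_Q M.a_ac)
qed (auto simp: carrier_Q add_Q smult_Q smult_l_distr smult_r_distr smult_assoc1)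

end

text \<open>The carrier itself belongs to the family that is intersected, so the intersection stays
  inside it.\<close>

lemma (in module) generated_submodule_is_submodule:
  assumes "S \<subseteq> carrier M"
  shows "submodule (generated_submodule R M S) R M"
proof (rule submoduleI)
  show "generated_submodule R M S \<subseteq> carrier M"
    using assms carrier_is_submodule unfolding generated_submodule_def by blast
  show "\<zero>\<^bsub>M\<^esub> \<in> generated_submodule R M S"
    unfolding generated_submodule_def
    using subgroup.one_closed[OF submodule.axioms(1)] by fastforce
qed (auto simp: generated_submodule_def submoduleE)

section \<open>Derivations and Kaehler differentials\<close>

locale kaehler_differentials = cring B for A :: "('a, 'j) ring_scheme" and \<phi> :: "'a \<Rightarrow> 'b" and B :: "('b, 'k) ring_scheme" (structure) +
  assumes \<phi>_closed: "\<And>a. a \<in> carrier A \<Longrightarrow> \<phi> a \<in> carrier B"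
begin

abbreviation F where "F \<equiv> free_on_carrier B"
abbreviation sym where "sym \<equiv> free_symbol B"

lemma free_carrier:
  "u \<in> carrier F \<longleftrightarrow> (\<forall>b. u b \<in> carrier B) \<and> finite {b. u b \<noteq> \<zero>\<^bsub>B\<^esub>} \<and> {b. u b \<noteq> \<zero>\<^bsub>B\<^esub>} \<subseteq> carrier B"
  by (simp add: free_on_carrier_def)

lemma free_ops:
  "u \<oplus>\<^bsub>F\<^esub> v = (\<lambda>b. u b \<oplus>\<^bsub>B\<^esub> v b)" "\<zero>\<^bsub>F\<^esub> = (\<lambda>b. \<zero>\<^bsub>B\<^esub>)" "r \<odot>\<^bsub>F\<^esub> u = (\<lambda>b. r \<otimes>\<^bsub>B\<^esub> u b)"
  by (simp_all add: free_on_carrier_def)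

lemma free_add_closed:
  assumes "u \<in> carrier F" "v \<in> carrier F"
  shows "u \<oplus>\<^bsub>F\<^esub> v \<in> carrier F"
proof -
  have "{b. u b \<oplus>\<^bsub>B\<^esub> v b \<noteq> \<zero>\<^bsub>B\<^esub>} \<subseteq> {b. u b \<noteq> \<zero>\<^bsub>B\<^esub>} \<union> {b. v b \<noteq> \<zero>\<^bsub>B\<^esub>}"
    by auto
  then show ?thesis
    using assms unfolding free_carrier free_ops
    by (auto intro: finite_subset[of _ "{b. u b \<noteq> \<zero>\<^bsub>B\<^esub>} \<union> {b. v b \<noteq> \<zero>\<^bsub>B\<^esub>}"])
qed

lemma free_smult_closed:
  assumes "r \<in> carrier B" "u \<in> carrier F"
  shows "r \<odot>\<^bsub>F\<^esub> u \<in> carrier F"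
proof -
  have "{b. r \<otimes>\<^bsub>B\<^esub> u b \<noteq> \<zero>\<^bsub>B\<^esub>} \<subseteq> {b. u b \<noteq> \<zero>\<^bsub>B\<^esub>}"
    using assms by auto
  then show ?thesis
    using assms unfolding free_carrier free_ops
    by (auto intro: finite_subset[of _ "{b. u b \<noteq> \<zero>\<^bsub>B\<^esub>}"])
qed

lemma sym_closed [simp]: "b \<in> carrier B \<Longrightarrow> sym b \<in> carrier F"
  unfolding free_carrier by (auto simp: free_symbol_def)

lemma module_F: "module B F"
proof (rule moduleI)
  show "cring B" ..
  show "abelian_group F"
  proof (rule abelian_groupI)
    show "\<exists>y\<in>carrier F. y \<oplus>\<^bsub>F\<^esub> x = \<zero>\<^bsub>F\<^esub>" if "x \<in> carrier F" for x
      using that free_smult_closed[of "\<ominus>\<^bsub>B\<^esub> \<one>\<^bsub>B\<^esub>" x]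
      by (intro bexI[of _ "(\<ominus>\<^bsub>B\<^esub> \<one>\<^bsub>B\<^esub>) \<odot>\<^bsub>F\<^esub> x"])
         (auto simp: free_ops free_carrier fun_eq_iff l_minus l_neg)
  qed (auto simp: free_add_closed, auto simp: free_ops free_carrier a_ac)
qed (auto simp: free_add_closed free_smult_closed,
     auto simp: free_ops free_carrier l_distr r_distr m_assoc)

sublocale F: module B F by (rule module_F)

text \<open>Induction on the support: deleting one coefficient splits off a multiple of one
  symbol.\<close>

lemma free_induct [consumes 1, case_names zero add sym]:
  assumes "u \<in> carrier F"
    and zero: "P \<zero>\<^bsub>F\<^esub>"
    and add: "\<And>u v. u \<in> carrier F \<Longrightarrow> v \<in> carrier F \<Longrightarrow> P u \<Longrightarrow> P v \<Longrightarrow> P (u \<oplus>\<^bsub>F\<^esub> v)"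
    and sym: "\<And>r b. r \<in> carrier B \<Longrightarrow> b \<in> carrier B \<Longrightarrow> P (r \<odot>\<^bsub>F\<^esub> sym b)"
  shows "P u"
proof -
  have *: "\<forall>u \<in> carrier F. {b. u b \<noteq> \<zero>\<^bsub>B\<^esub>} = S \<longrightarrow> P u" if "finite S" for S
    using that
  proof (induction S rule: finite_induct)
    case empty
    then show ?case
      using zero by (auto simp: free_ops fun_eq_iff)
  next
    case (insert c S)
    show ?case
    proof (intro ballI impI)
      fix u assume u: "u \<in> carrier F" and supp: "{b. u b \<noteq> \<zero>\<^bsub>B\<^esub>} = insert c S"
      define v where "v = u(c := \<zero>\<^bsub>B\<^esub>)"
      have supp_v: "{b. v b \<noteq> \<zero>\<^bsub>B\<^esub>} = S"
        using supp insert.hyps by (auto simp: v_def)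
      then have v: "v \<in> carrier F"
        using u supp insert.hyps unfolding free_carrier by (auto simp: v_def)
      have c: "c \<in> carrier B" "u c \<in> carrier B"
        using u supp unfolding free_carrier by auto
      have "u = v \<oplus>\<^bsub>F\<^esub> u c \<odot>\<^bsub>F\<^esub> sym c"
        using u c by (auto simp: free_ops v_def free_symbol_def fun_eq_iff free_carrier)
      moreover have "P (v \<oplus>\<^bsub>F\<^esub> u c \<odot>\<^bsub>F\<^esub> sym c)"
        using add sym v c insert.IH supp_v by auto
      ultimately show "P u" by simp
    qed
  qed
  have "finite {b. u b \<noteq> \<zero>\<^bsub>B\<^esub>}"
    using assms(1) by (simp add: free_carrier)
  from *[OF this] show ?thesis
    using assms(1) by simp
qed

lemma relations_closed: "kaehler_relations A \<phi> B \<subseteq> carrier F"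
  unfolding kaehler_relations_def Let_def
  by (intro Un_least subsetI; elim CollectE exE conjE; simp add: \<phi>_closed)

lemma null_submodule: "submodule (kaehler_null A \<phi> B) B F"
  unfolding kaehler_null_def
  by (rule F.generated_submodule_is_submodule) (rule relations_closed)

sublocale module_quotient B F "kaehler_null A \<phi> B"
  by (intro module_quotient.intro module_quotient_axioms.intro null_submodule module_F)

abbreviation \<Omega> where "\<Omega> \<equiv> kaehler A \<phi> B"
abbreviation d where "d \<equiv> kaehler_d A \<phi> B"

lemma \<Omega>_eq_Q: "\<Omega> = Q"
  by (simp add: kaehler_def)

lemma module_\<Omega>: "module B \<Omega>"
  unfolding \<Omega>_eq_Q by (rule module_Q)

sublocale \<Omega>: module B \<Omega> by (rule module_\<Omega>)

lemma d_closed [simp]: "b \<in> carrier B \<Longrightarrow> d b \<in> carrier \<Omega>"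
  by (simp add: kaehler_d_def \<Omega>_eq_Q)

lemma relation_null: "u \<in> kaehler_relations A \<phi> B \<Longrightarrow> u \<in> kaehler_null A \<phi> B"
  by (auto simp: kaehler_null_def generated_submodule_def)

lemma d_add:
  assumes "b \<in> carrier B" "c \<in> carrier B"
  shows "d (b \<oplus>\<^bsub>B\<^esub> c) = d b \<oplus>\<^bsub>\<Omega>\<^esub> d c"
proof -
  have "sym (b \<oplus>\<^bsub>B\<^esub> c) \<ominus>\<^bsub>F\<^esub> (sym b \<oplus>\<^bsub>F\<^esub> sym c) \<in> kaehler_null A \<phi> B"
    using assms by (intro relation_null) (auto simp: kaehler_relations_def Let_def)
  then show ?thesis
    using assms by (simp add: kaehler_d_def \<Omega>_eq_Q add_Q proj_eq_iff)
qed

lemma d_mult: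
  assumes "b \<in> carrier B" "c \<in> carrier B"
  shows "d (b \<otimes>\<^bsub>B\<^esub> c) = b \<odot>\<^bsub>\<Omega>\<^esub> d c \<oplus>\<^bsub>\<Omega>\<^esub> c \<odot>\<^bsub>\<Omega>\<^esub> d b"
proof -
  have "sym (b \<otimes>\<^bsub>B\<^esub> c) \<ominus>\<^bsub>F\<^esub> (b \<odot>\<^bsub>F\<^esub> sym c \<oplus>\<^bsub>F\<^esub> c \<odot>\<^bsub>F\<^esub> sym b) \<in> kaehler_null A \<phi> B"
    using assms by (intro relation_null) (auto simp: kaehler_relations_def Let_def)
  then show ?thesis
    using assms by (simp add: kaehler_d_def \<Omega>_eq_Q add_Q smult_Q proj_eq_iff)
qed

lemma d_scalar:
  assumes "a \<in> carrier A"
  shows "d (\<phi> a) = \<zero>\<^bsub>\<Omega>\<^esub>"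
proof -
  have "sym (\<phi> a) \<in> kaehler_null A \<phi> B"
    using assms by (intro relation_null) (auto simp: kaehler_relations_def Let_def)
  then show ?thesis
    using assms \<phi>_closed by (simp add: kaehler_d_def \<Omega>_eq_Q zero_Q_iff)
qed

lemma \<Omega>_induct [consumes 1, case_names zero add d]:
  assumes "\<omega> \<in> carrier \<Omega>"
    and zero: "P \<zero>\<^bsub>\<Omega>\<^esub>"
    and add: "\<And>u v. u \<in> carrier \<Omega> \<Longrightarrow> v \<in> carrier \<Omega> \<Longrightarrow> P u \<Longrightarrow> P v \<Longrightarrow> P (u \<oplus>\<^bsub>\<Omega>\<^esub> v)"
    and d: "\<And>r b. r \<in> carrier B \<Longrightarrow> b \<in> carrier B \<Longrightarrow> P (r \<odot>\<^bsub>\<Omega>\<^esub> d b)"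
  shows "P \<omega>"
proof -
  obtain u where u: "u \<in> carrier F" "\<omega> = proj u"
    using assms(1) by (auto simp: \<Omega>_eq_Q carrier_Q)
  have "P (proj u)"
    using u(1)
  proof (induction u rule: free_induct)
    case zero
    then show ?case using assms(2) by (simp add: \<Omega>_eq_Q zero_Q)
  next
    case (add u v)
    then show ?case using assms(3)[of "proj u" "proj v"] by (simp add: \<Omega>_eq_Q add_Q)
  next
    case (sym r b)
    then show ?case using assms(4)[of r b] by (simp add: \<Omega>_eq_Q smult_Q kaehler_d_def)
  qed
  with u show ?thesis by simp
qed

end

text \<open>
  The universal property, for a derivation \<open>\<delta>\<close> with values in a module over another ring; the
  map on the coset is written as in \<open>kaehler_map\<close>.
\<close>

locale kaehler_derivation = kaehler_differentials A \<phi> B + T: module C T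
    for A :: "('a, 'j) ring_scheme" and \<phi> :: "'a \<Rightarrow> 'b" and B :: "('b, 'k) ring_scheme" (structure)
      and C (structure) and T (structure) +
  fixes \<rho> \<delta>
  assumes \<rho>_hom: "\<rho> \<in> ring_hom B C"
    and \<delta>_closed: "\<And>b. b \<in> carrier B \<Longrightarrow> \<delta> b \<in> carrier T"
    and \<delta>_add: "\<And>b c. b \<in> carrier B \<Longrightarrow> c \<in> carrier B \<Longrightarrow> \<delta> (b \<oplus>\<^bsub>B\<^esub> c) = \<delta> b \<oplus>\<^bsub>T\<^esub> \<delta> c"
    and \<delta>_mult: "\<And>b c. b \<in> carrier B \<Longrightarrow> c \<in> carrier B \<Longrightarrow>
      \<delta> (b \<otimes>\<^bsub>B\<^esub> c) = \<rho> b \<odot>\<^bsub>T\<^esub> \<delta> c \<oplus>\<^bsub>T\<^esub> \<rho> c \<odot>\<^bsub>T\<^esub> \<delta> b"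
    and \<delta>_scalar: "\<And>a. a \<in> carrier A \<Longrightarrow> \<delta> (\<phi> a) = \<zero>\<^bsub>T\<^esub>"
begin

definition lin where "lin u = (\<Oplus>\<^bsub>T\<^esub>b\<in>{b. u b \<noteq> \<zero>\<^bsub>B\<^esub>}. \<rho> (u b) \<odot>\<^bsub>T\<^esub> \<delta> b)"
definition induced where "induced \<omega> = the_elem (lin ` \<omega>)"

lemma \<rho>_closed [simp]: "b \<in> carrier B \<Longrightarrow> \<rho> b \<in> carrier C"
  using \<rho>_hom by (rule ring_hom_closed)

lemma \<rho>_zero: "\<rho> \<zero>\<^bsub>B\<^esub> = \<zero>\<^bsub>C\<^esub>"
  by (rule ring_hom_zero[OF \<rho>_hom]) unfold_locales

text \<open>The supports of \<open>u\<close>, \<open>v\<close> and their sum differ; summing over a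
  common finite set makes the three sums comparable.\<close>

lemma lin_superset:
  assumes "u \<in> carrier F" "finite S" "{b. u b \<noteq> \<zero>\<^bsub>B\<^esub>} \<subseteq> S" "S \<subseteq> carrier B"
  shows "lin u = (\<Oplus>\<^bsub>T\<^esub>b\<in>S. \<rho> (u b) \<odot>\<^bsub>T\<^esub> \<delta> b)"
  unfolding lin_def
  using assms by (intro T.add.finprod_mono_neutral_cong_left)
    (auto simp: \<rho>_zero free_carrier \<delta>_closed subset_iff)

lemma lin_closed: "u \<in> carrier F \<Longrightarrow> lin u \<in> carrier T"
  unfolding lin_def by (intro T.finsum_closed) (auto simp: free_carrier \<delta>_closed)

lemma lin_add:
  assumes "u \<in> carrier F" "v \<in> carrier F"
  shows "lin (u \<oplus>\<^bsub>F\<^esub> v) = lin u \<oplus>\<^bsub>T\<^esub> lin v"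
proof -
  let ?S = "{b. u b \<noteq> \<zero>\<^bsub>B\<^esub>} \<union> {b. v b \<noteq> \<zero>\<^bsub>B\<^esub>}"
  have S: "finite ?S" "?S \<subseteq> carrier B"
    using assms by (auto simp: free_carrier)
  have uv: "u \<oplus>\<^bsub>F\<^esub> v \<in> carrier F"
    using assms by (rule free_add_closed)
  have "lin (u \<oplus>\<^bsub>F\<^esub> v) = (\<Oplus>\<^bsub>T\<^esub>b\<in>?S. \<rho> ((u \<oplus>\<^bsub>F\<^esub> v) b) \<odot>\<^bsub>T\<^esub> \<delta> b)"
    using S uv by (intro lin_superset) (auto simp: free_ops)
  also have "\<dots> = (\<Oplus>\<^bsub>T\<^esub>b\<in>?S. \<rho> (u b) \<odot>\<^bsub>T\<^esub> \<delta> b \<oplus>\<^bsub>T\<^esub> \<rho> (v b) \<odot>\<^bsub>T\<^esub> \<delta> b)"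
    using S assms
    by (intro T.finsum_cong')
       (auto simp: free_ops free_carrier ring_hom_add[OF \<rho>_hom] T.smult_l_distr \<delta>_closed subset_iff)
  also have "\<dots> = (\<Oplus>\<^bsub>T\<^esub>b\<in>?S. \<rho> (u b) \<odot>\<^bsub>T\<^esub> \<delta> b) \<oplus>\<^bsub>T\<^esub> (\<Oplus>\<^bsub>T\<^esub>b\<in>?S. \<rho> (v b) \<odot>\<^bsub>T\<^esub> \<delta> b)"
    using S assms by (intro T.finsum_addf) (auto simp: free_carrier \<delta>_closed)
  also have "\<dots> = lin u \<oplus>\<^bsub>T\<^esub> lin v"
    using S assms lin_superset[of u ?S] lin_superset[of v ?S] by simp
  finally show ?thesis .
qed

lemma lin_smult:
  assumes "r \<in> carrier B" "u \<in> carrier F"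
  shows "lin (r \<odot>\<^bsub>F\<^esub> u) = \<rho> r \<odot>\<^bsub>T\<^esub> lin u"
proof -
  let ?S = "{b. u b \<noteq> \<zero>\<^bsub>B\<^esub>}"
  have S: "finite ?S" "?S \<subseteq> carrier B"
    using assms by (auto simp: free_carrier)
  have "lin (r \<odot>\<^bsub>F\<^esub> u) = (\<Oplus>\<^bsub>T\<^esub>b\<in>?S. \<rho> ((r \<odot>\<^bsub>F\<^esub> u) b) \<odot>\<^bsub>T\<^esub> \<delta> b)"
    using S assms free_smult_closed by (intro lin_superset) (auto simp: free_ops)
  also have "\<dots> = (\<Oplus>\<^bsub>T\<^esub>b\<in>?S. \<rho> r \<odot>\<^bsub>T\<^esub> (\<rho> (u b) \<odot>\<^bsub>T\<^esub> \<delta> b))"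
    using S assms
    by (intro T.finsum_cong')
       (auto simp: free_ops free_carrier ring_hom_mult[OF \<rho>_hom] T.smult_assoc1 \<delta>_closed subset_iff)
  also have "\<dots> = \<rho> r \<odot>\<^bsub>T\<^esub> lin u"
    unfolding lin_def using S assms
    by (intro T.finsum_smult_ldistr[symmetric]) (auto simp: free_carrier \<delta>_closed)
  finally show ?thesis .
qed

lemma lin_sym:
  assumes "b \<in> carrier B"
  shows "lin (sym b) = \<delta> b"
proof -
  have "lin (sym b) = (\<Oplus>\<^bsub>T\<^esub>c\<in>{b}. \<rho> (sym b c) \<odot>\<^bsub>T\<^esub> \<delta> c)"
    using assms by (intro lin_superset sym_closed) (auto simp: free_symbol_def)
  then show ?thesis
    using assms by (simp add: free_symbol_def ring_hom_one[OF \<rho>_hom] \<delta>_closed)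
qed

lemma lin_minus:
  assumes "u \<in> carrier F" "v \<in> carrier F"
  shows "lin (u \<ominus>\<^bsub>F\<^esub> v) = lin u \<ominus>\<^bsub>T\<^esub> lin v"
proof -
  have "lin (u \<ominus>\<^bsub>F\<^esub> v) \<oplus>\<^bsub>T\<^esub> lin v = lin u"
    using assms lin_add[of "u \<ominus>\<^bsub>F\<^esub> v" v] by (simp add: F.M.minus_eq F.M.a_assoc F.M.l_neg)
  then show ?thesis
    using assms lin_closed by (metis F.M.minus_closed T.M.add.inv_solve_right' T.M.minus_eq)
qed

text \<open>The kernel of \<open>lin\<close> is a submodule that contains the defining relations,
  hence contains the submodule they generate.\<close>

lemma lin_null:
  assumes "u \<in> kaehler_null A \<phi> B"
  shows "lin u = \<zero>\<^bsub>T\<^esub>"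
proof -
  have lin_zero: "lin \<zero>\<^bsub>F\<^esub> = \<zero>\<^bsub>T\<^esub>"
    by (simp add: lin_def free_ops)
  let ?K = "{u \<in> carrier F. lin u = \<zero>\<^bsub>T\<^esub>}"
  have "submodule ?K B F"
  proof (rule F.submoduleI)
    fix u assume "u \<in> ?K"
    then have "lin (\<zero>\<^bsub>F\<^esub> \<ominus>\<^bsub>F\<^esub> u) = \<zero>\<^bsub>T\<^esub>"
      using lin_minus[of "\<zero>\<^bsub>F\<^esub>" u] lin_zero by (simp add: T.M.minus_eq)
    with \<open>u \<in> ?K\<close> show "\<ominus>\<^bsub>F\<^esub> u \<in> ?K"
      by (simp add: F.M.minus_eq)
  qed (auto simp: lin_add lin_smult lin_zero)
  moreover have "kaehler_relations A \<phi> B \<subseteq> ?K"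
    using relations_closed \<phi>_closed
    by (auto simp: kaehler_relations_def Let_def lin_add lin_smult lin_sym lin_minus
        \<delta>_add \<delta>_mult \<delta>_scalar \<delta>_closed T.M.r_neg T.M.minus_eq)
  ultimately show ?thesis
    using assms unfolding kaehler_null_def generated_submodule_def by blast
qed

text \<open>By \<open>lin_null\<close>, \<open>lin\<close> is constant on a coset, so the image in
  the definition of \<open>induced\<close> is a singleton and \<open>the_elem\<close> picks its
  value.\<close>

lemma induced_proj:
  assumes "u \<in> carrier F"
  shows "induced (proj u) = lin u"
proof -
  have "lin v = lin u" if v: "v \<in> proj u" for v
  proof -
    have vc: "v \<in> carrier F"
      using assms v by (rule mem_proj)
    have "lin (v \<ominus>\<^bsub>F\<^esub> u) = \<zero>\<^bsub>T\<^esub>"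
      using a_rcos_module[OF assms vc] v by (intro lin_null) (simp add: F.M.minus_eq)
    then show ?thesis
      unfolding lin_minus[OF vc assms]
      by (subst (asm) T.M.minus_eq_zero_iff) (use vc assms in \<open>auto intro: lin_closed\<close>)
  qed
  moreover have "u \<in> proj u"
    using assms by (simp add: proj_self)
  ultimately have "lin ` proj u = {lin u}"
    by blast
  then show ?thesis
    by (simp add: induced_def)
qed

lemma induced_add:
  "\<omega> \<in> carrier \<Omega> \<Longrightarrow> \<eta> \<in> carrier \<Omega> \<Longrightarrow> induced (\<omega> \<oplus>\<^bsub>\<Omega>\<^esub> \<eta>) = induced \<omega> \<oplus>\<^bsub>T\<^esub> induced \<eta>"
  by (auto simp: \<Omega>_eq_Q carrier_Q induced_proj add_Q lin_add)

lemma induced_smult: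
  "r \<in> carrier B \<Longrightarrow> \<omega> \<in> carrier \<Omega> \<Longrightarrow> induced (r \<odot>\<^bsub>\<Omega>\<^esub> \<omega>) = \<rho> r \<odot>\<^bsub>T\<^esub> induced \<omega>"
  by (auto simp: \<Omega>_eq_Q carrier_Q induced_proj smult_Q lin_smult)

lemma induced_d: "b \<in> carrier B \<Longrightarrow> induced (d b) = \<delta> b"
  by (simp add: kaehler_d_def induced_proj lin_sym)

end

section \<open>Quotients of subrings of a type-class ring\<close>

text \<open>The regular module, which serves as the target of a derivation from a ring to
  itself.\<close>

definition self_module :: "('b, 'k) ring_scheme \<Rightarrow> ('b, 'b) module" where
  "self_module B = \<lparr>carrier = carrier B, monoid.mult = monoid.mult B, one = one B, zero = zero B, add = add B,
     module.smult = monoid.mult B\<rparr>"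

lemma (in cring) module_self_module: "module R (self_module R)"
proof (rule moduleI)
  show "abelian_group (self_module R)"
  proof (rule abelian_groupI)
    show "\<exists>y\<in>carrier (self_module R). y \<oplus>\<^bsub>self_module R\<^esub> x = \<zero>\<^bsub>self_module R\<^esub>"
      if "x \<in> carrier (self_module R)" for x
      using that by (intro bexI[of _ "\<ominus> x"]) (auto simp: self_module_def l_neg)
  qed (auto simp: self_module_def a_ac)
qed (auto simp: self_module_def l_distr r_distr m_assoc is_cring)

lemma type_algebra_simps:
  "carrier ring_of_type_algebra = UNIV"
  "x \<otimes>\<^bsub>ring_of_type_algebra\<^esub> y = x * y" "x \<oplus>\<^bsub>ring_of_type_algebra\<^esub> y = x + y"
  "\<one>\<^bsub>ring_of_type_algebra\<^esub> = 1" "\<zero>\<^bsub>ring_of_type_algebra\<^esub> = 0"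
  by (simp_all add: ring_of_type_algebra_def)

text \<open>Calculations take place in the surrounding type-class ring. The set \<open>I\<close> is
  an ideal of \<open>S\<close> only, so its absorption property is restricted to factors from
  \<open>S\<close>.\<close>

locale subring_ideal =
  fixes S I :: "'b::comm_ring_1 set"
  assumes S_one: "1 \<in> S"
    and S_add: "\<And>p q. p \<in> S \<Longrightarrow> q \<in> S \<Longrightarrow> p + q \<in> S"
    and S_mult: "\<And>p q. p \<in> S \<Longrightarrow> q \<in> S \<Longrightarrow> p * q \<in> S"
    and S_uminus: "\<And>p. p \<in> S \<Longrightarrow> - p \<in> S"
    and I_subset: "I \<subseteq> S"
    and I_zero: "0 \<in> I"
    and I_add: "\<And>p q. p \<in> I \<Longrightarrow> q \<in> I \<Longrightarrow> p + q \<in> I"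
    and I_mult: "\<And>p q. p \<in> S \<Longrightarrow> q \<in> I \<Longrightarrow> p * q \<in> I"
begin

abbreviation R where "R \<equiv> ring_of_type_algebra\<lparr>carrier := S\<rparr>"
abbreviation B where "B \<equiv> R Quot I"
abbreviation cls where "cls p \<equiv> I +>\<^bsub>R\<^esub> p"

lemma S_zero: "0 \<in> S"
  using I_subset I_zero by blast

lemma S_diff: "p \<in> S \<Longrightarrow> q \<in> S \<Longrightarrow> p - q \<in> S"
  using S_add[of p "- q"] S_uminus by simp

lemma S_power: "p \<in> S \<Longrightarrow> p ^ n \<in> S"
  by (induction n) (auto intro: S_one S_mult)

lemma S_of_nat: "of_nat n \<in> S"
  by (induction n) (auto intro: S_one S_add S_zero)

lemmas S_closed = S_one S_zero S_add S_mult S_uminus S_diff S_power S_of_nat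

lemma I_uminus: "p \<in> I \<Longrightarrow> - p \<in> I"
  using I_mult[of "- 1" p] by (simp add: S_closed)

lemma I_diff: "p \<in> I \<Longrightarrow> q \<in> I \<Longrightarrow> p - q \<in> I"
  using I_add[of p "- q"] I_uminus by simp

lemma R_simps0:
  "carrier R = S" "x \<otimes>\<^bsub>R\<^esub> y = x * y" "x \<oplus>\<^bsub>R\<^esub> y = x + y" "\<one>\<^bsub>R\<^esub> = 1" "\<zero>\<^bsub>R\<^esub> = 0"
  by (simp_all add: type_algebra_simps)

lemmas R_simps = R_simps0 type_algebra_simps

lemma cring_R: "cring R"
proof (rule cringI)
  show "abelian_group R"
  proof (rule abelian_groupI)
    show "\<exists>y\<in>carrier R. y \<oplus>\<^bsub>R\<^esub> x = \<zero>\<^bsub>R\<^esub>" if "x \<in> carrier R" for x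
      using that by (intro bexI[of _ "- x"]) (auto simp: R_simps S_closed)
  qed (auto simp: R_simps S_closed)
  show "comm_monoid R"
    by (rule comm_monoidI) (auto simp: R_simps S_closed mult.assoc mult.commute)
qed (auto simp: R_simps algebra_simps)

sublocale R: cring R by (rule cring_R)

lemma R_uminus: "p \<in> S \<Longrightarrow> \<ominus>\<^bsub>R\<^esub> p = - p"
  using R.minus_equality[of "- p" p] by (simp add: R_simps S_uminus)

lemma R_minus: "p \<in> S \<Longrightarrow> q \<in> S \<Longrightarrow> p \<ominus>\<^bsub>R\<^esub> q = p - q"
  unfolding a_minus_def by (simp add: R_uminus) (simp add: R_simps)

sublocale ideal I R
proof (rule idealI)
  show "ring R" ..
  show "subgroup I (add_monoid R)"
    using I_subset I_zero I_add I_uminus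
    by (intro R.add.subgroupI) (auto simp: R_simps R_uminus subset_iff)
qed (auto simp: R_simps I_mult, metis I_mult mult.commute)

lemma cring_B: "cring B"
  by (rule quotient_is_cring[OF cring_R])

sublocale B: cring B by (rule cring_B)

lemma cls_eq_iff: "p \<in> S \<Longrightarrow> q \<in> S \<Longrightarrow> cls p = cls q \<longleftrightarrow> p - q \<in> I"
  using R.quotient_eq_iff_same_a_r_cos[OF is_ideal, of p q] by (simp add: R_simps R_minus)

lemma cls_set: "cls p = (\<lambda>h. h + p) ` I"
  by (auto simp: a_r_coset_def' ring_of_type_algebra_def)

lemma carrier_B: "carrier B = cls ` S"
  by (auto simp: FactRing_def A_RCOSETS_def' ring_of_type_algebra_def)

lemma cls_closed [simp]: "p \<in> S \<Longrightarrow> cls p \<in> carrier B"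
  by (auto simp: carrier_B)

lemma cls_add: "p \<in> S \<Longrightarrow> q \<in> S \<Longrightarrow> cls p \<oplus>\<^bsub>B\<^esub> cls q = cls (p + q)"
  using a_rcos_sum[of p q] by (simp add: FactRing_def ring_of_type_algebra_def)

lemma cls_mult: "p \<in> S \<Longrightarrow> q \<in> S \<Longrightarrow> cls p \<otimes>\<^bsub>B\<^esub> cls q = cls (p * q)"
  using rcoset_mult_add[of p q] by (simp add: FactRing_def ring_of_type_algebra_def)

lemma one_B: "\<one>\<^bsub>B\<^esub> = cls 1"
  by (simp add: FactRing_def ring_of_type_algebra_def)

lemma zero_B: "\<zero>\<^bsub>B\<^esub> = cls 0"
  by (simp add: FactRing_def cls_set)

lemma cls_uminus: "p \<in> S \<Longrightarrow> \<ominus>\<^bsub>B\<^esub> cls p = cls (- p)"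
  by (rule B.minus_equality) (auto simp: cls_add zero_B S_closed)

lemma cls_minus: "p \<in> S \<Longrightarrow> q \<in> S \<Longrightarrow> cls p \<ominus>\<^bsub>B\<^esub> cls q = cls (p - q)"
  by (simp add: B.minus_eq cls_uminus cls_add S_closed)

end

section \<open>Affine charts with a free module of differentials\<close>

text \<open>
  The ring \<open>S / I\<close> is generated by \<open>u\<close>, \<open>v\<close> subject to
  $e u^N v^M - u^N - v^M + e' = 0$, and \<open>D\<close> is the Hamiltonian vector field of this equation.
  As the partial derivatives of the equation generate the unit ideal, the form dual to \<open>D\<close>
  generates the differentials.
\<close>

locale affine_chart = subring_ideal S I for S I :: "'b::comm_ring_1 set" +
  fixes \<iota> :: "'a::comm_ring_1 \<Rightarrow> 'b" and D :: "'b \<Rightarrow> 'b" and u v \<alpha> \<beta> e e' :: 'b and N M :: nat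
  assumes \<iota>_closed: "\<iota> a \<in> S"
    and D_closed: "p \<in> S \<Longrightarrow> D p \<in> S"
    and D_I: "p \<in> I \<Longrightarrow> D p \<in> I"
    and D_add: "D (p + q) = D p + D q"
    and D_mult: "D (p * q) = p * D q + q * D p"
    and D_\<iota>: "D (\<iota> a) = 0"
    and u_closed: "u \<in> S" and v_closed: "v \<in> S" and \<alpha>_closed: "\<alpha> \<in> S" and \<beta>_closed: "\<beta> \<in> S"
    and e_scalar: "e \<in> range \<iota>" and e'_scalar: "e' \<in> range \<iota>"
    and equation: "e * u ^ N * v ^ M - u ^ N - v ^ M + e' \<in> I"
    and D_u: "D u = of_nat M * v ^ (M - 1) * (1 - e * u ^ N)"
    and D_v: "D v = - of_nat N * u ^ (N - 1) * (1 - e * v ^ M)"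
    and unimodular: "\<alpha> * D u + \<beta> * D v - 1 \<in> I"
    and generated: "range \<iota> \<subseteq> Z \<Longrightarrow> u \<in> Z \<Longrightarrow> v \<in> Z \<Longrightarrow>
      (\<And>p q. p \<in> Z \<Longrightarrow> q \<in> Z \<Longrightarrow> p + q \<in> Z) \<Longrightarrow> (\<And>p q. p \<in> Z \<Longrightarrow> q \<in> Z \<Longrightarrow> p * q \<in> Z) \<Longrightarrow>
      (\<And>p q. p \<in> Z \<Longrightarrow> q \<in> S \<Longrightarrow> p * q = 1 \<Longrightarrow> q \<in> Z) \<Longrightarrow> S \<subseteq> Z"
begin

abbreviation \<phi> where "\<phi> a \<equiv> cls (\<iota> a)"

sublocale K: kaehler_differentials ring_of_type_algebra \<phi> B
  by unfold_locales (simp add: \<iota>_closed)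

abbreviation \<Omega> where "\<Omega> \<equiv> kaehler ring_of_type_algebra \<phi> B"
abbreviation d where "d p \<equiv> kaehler_d ring_of_type_algebra \<phi> B (cls p)"

lemma e_closed: "e \<in> S" and e'_closed: "e' \<in> S"
  using e_scalar e'_scalar \<iota>_closed by auto

lemmas closed = S_closed \<iota>_closed D_closed u_closed v_closed \<alpha>_closed \<beta>_closed e_closed e'_closed

lemma d_closed [simp]: "p \<in> S \<Longrightarrow> d p \<in> carrier \<Omega>"
  by simp

lemma d_add: "p \<in> S \<Longrightarrow> q \<in> S \<Longrightarrow> d (p + q) = d p \<oplus>\<^bsub>\<Omega>\<^esub> d q"
  using K.d_add[of "cls p" "cls q"] by (simp add: cls_add)

lemma d_mult: "p \<in> S \<Longrightarrow> q \<in> S \<Longrightarrow> d (p * q) = cls p \<odot>\<^bsub>\<Omega>\<^esub> d q \<oplus>\<^bsub>\<Omega>\<^esub> cls q \<odot>\<^bsub>\<Omega>\<^esub> d p"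
  using K.d_mult[of "cls p" "cls q"] by (simp add: cls_mult)

lemma d_\<iota>: "d (\<iota> a) = \<zero>\<^bsub>\<Omega>\<^esub>"
  by (rule K.d_scalar) (simp add: ring_of_type_algebra_def)

lemma smult_assoc: "p \<in> S \<Longrightarrow> q \<in> S \<Longrightarrow> \<omega> \<in> carrier \<Omega> \<Longrightarrow>
    cls p \<odot>\<^bsub>\<Omega>\<^esub> (cls q \<odot>\<^bsub>\<Omega>\<^esub> \<omega>) = cls (p * q) \<odot>\<^bsub>\<Omega>\<^esub> \<omega>"
  using K.\<Omega>.smult_assoc1[of "cls p" "cls q" \<omega>] by (simp add: cls_mult)

lemma smult_add: "p \<in> S \<Longrightarrow> q \<in> S \<Longrightarrow> \<omega> \<in> carrier \<Omega> \<Longrightarrow>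
    cls p \<odot>\<^bsub>\<Omega>\<^esub> \<omega> \<oplus>\<^bsub>\<Omega>\<^esub> cls q \<odot>\<^bsub>\<Omega>\<^esub> \<omega> = cls (p + q) \<odot>\<^bsub>\<Omega>\<^esub> \<omega>"
  using K.\<Omega>.smult_l_distr[of "cls p" "cls q" \<omega>] by (simp add: cls_add)

lemma smult_one: "\<omega> \<in> carrier \<Omega> \<Longrightarrow> cls 1 \<odot>\<^bsub>\<Omega>\<^esub> \<omega> = \<omega>"
  using K.\<Omega>.smult_one[of \<omega>] by (simp add: one_B)

lemma smult_zero: "\<omega> \<in> carrier \<Omega> \<Longrightarrow> cls 0 \<odot>\<^bsub>\<Omega>\<^esub> \<omega> = \<zero>\<^bsub>\<Omega>\<^esub>"
  using K.\<Omega>.smult_l_null[of \<omega>] by (simp add: zero_B)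

lemma smult_closed [simp]: "p \<in> S \<Longrightarrow> \<omega> \<in> carrier \<Omega> \<Longrightarrow> cls p \<odot>\<^bsub>\<Omega>\<^esub> \<omega> \<in> carrier \<Omega>"
  by (simp add: K.\<Omega>.smult_closed)

lemma smult_uminus: "p \<in> S \<Longrightarrow> \<omega> \<in> carrier \<Omega> \<Longrightarrow> \<ominus>\<^bsub>\<Omega>\<^esub> (cls p \<odot>\<^bsub>\<Omega>\<^esub> \<omega>) = cls (- p) \<odot>\<^bsub>\<Omega>\<^esub> \<omega>"
  by (simp add: K.\<Omega>.smult_l_minus[symmetric] cls_uminus)

lemma d_one: "d 1 = \<zero>\<^bsub>\<Omega>\<^esub>"
proof -
  have "d 1 \<oplus>\<^bsub>\<Omega>\<^esub> d 1 = d 1"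
    using d_mult[of 1 1] by (simp add: closed smult_one)
  then show ?thesis
    by (metis K.\<Omega>.M.add.r_cancel_one' S_one d_closed)
qed

lemma D_one: "D 1 = 0"
  using D_mult[of 1 1] by simp

lemma d_power:
  assumes "p \<in> S"
  shows "d (p ^ n) = cls (of_nat n * p ^ (n - 1)) \<odot>\<^bsub>\<Omega>\<^esub> d p"
proof (induction n)
  case 0
  then show ?case using assms by (simp add: d_one smult_zero)
next
  case (Suc n)
  have "d (p ^ Suc n) = cls (p * (of_nat n * p ^ (n - 1))) \<odot>\<^bsub>\<Omega>\<^esub> d p \<oplus>\<^bsub>\<Omega>\<^esub> cls (p ^ n) \<odot>\<^bsub>\<Omega>\<^esub> d p"
    using assms by (simp add: d_mult closed Suc.IH smult_assoc)
  also have "\<dots> = cls (p * (of_nat n * p ^ (n - 1)) + p ^ n) \<odot>\<^bsub>\<Omega>\<^esub> d p"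
    using assms by (simp add: smult_add closed)
  also have "p * (of_nat n * p ^ (n - 1)) + p ^ n = of_nat (Suc n) * p ^ (Suc n - 1)"
    by (cases n) (auto simp: algebra_simps)
  finally show ?case .
qed

lemma d_uminus:
  assumes "p \<in> S"
  shows "d (- p) = cls (- 1) \<odot>\<^bsub>\<Omega>\<^esub> d p"
proof -
  have "d (- p) \<oplus>\<^bsub>\<Omega>\<^esub> d p = \<zero>\<^bsub>\<Omega>\<^esub>"
    using assms d_add[of "- p" p] d_\<iota>[of 0] d_add[of 0 0]
    by (simp add: closed)
  moreover have "cls (- 1) \<odot>\<^bsub>\<Omega>\<^esub> d p \<oplus>\<^bsub>\<Omega>\<^esub> d p = \<zero>\<^bsub>\<Omega>\<^esub>"
    using smult_add[of "- 1" 1 "d p"] assms by (simp add: closed smult_one smult_zero)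
  ultimately show ?thesis
    using assms by (metis K.\<Omega>.M.minus_equality d_closed closed smult_closed)
qed

text \<open>Obtained by applying \<open>d\<close> to the equation.\<close>

lemma relation: "cls (D v) \<odot>\<^bsub>\<Omega>\<^esub> d u = cls (D u) \<odot>\<^bsub>\<Omega>\<^esub> d v"
proof -
  let ?a = "of_nat N * u ^ (N - 1)" and ?b = "of_nat M * v ^ (M - 1)"
  have d_e: "d e = \<zero>\<^bsub>\<Omega>\<^esub>" "d e' = \<zero>\<^bsub>\<Omega>\<^esub>"
    using e_scalar e'_scalar d_\<iota> by auto
  have 1: "d (e * u ^ N * v ^ M)
      = cls (e * u ^ N * ?b) \<odot>\<^bsub>\<Omega>\<^esub> d v \<oplus>\<^bsub>\<Omega>\<^esub> cls (v ^ M * (e * ?a)) \<odot>\<^bsub>\<Omega>\<^esub> d u"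
    by (simp add: d_mult d_power d_e closed smult_assoc)
  have "e * u ^ N * v ^ M - u ^ N - v ^ M + e'
      = e * u ^ N * v ^ M + (- (u ^ N)) + (- (v ^ M)) + e'"
    by simp
  then have "d (e * u ^ N * v ^ M - u ^ N - v ^ M + e')
      = d (e * u ^ N * v ^ M) \<oplus>\<^bsub>\<Omega>\<^esub> d (- (u ^ N)) \<oplus>\<^bsub>\<Omega>\<^esub> d (- (v ^ M)) \<oplus>\<^bsub>\<Omega>\<^esub> d e'"
    by (simp only: d_add closed)
  also have "\<dots> = cls (e * u ^ N * ?b) \<odot>\<^bsub>\<Omega>\<^esub> d v \<oplus>\<^bsub>\<Omega>\<^esub> cls (v ^ M * (e * ?a)) \<odot>\<^bsub>\<Omega>\<^esub> d u
      \<oplus>\<^bsub>\<Omega>\<^esub> cls (- 1 * ?a) \<odot>\<^bsub>\<Omega>\<^esub> d u \<oplus>\<^bsub>\<Omega>\<^esub> cls (- 1 * ?b) \<odot>\<^bsub>\<Omega>\<^esub> d v"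
    by (simp only: 1 d_uminus d_power d_e smult_assoc closed d_closed)
       (simp add: closed)
  also have "\<dots> = (cls (e * u ^ N * ?b) \<odot>\<^bsub>\<Omega>\<^esub> d v \<oplus>\<^bsub>\<Omega>\<^esub> cls (- 1 * ?b) \<odot>\<^bsub>\<Omega>\<^esub> d v)
      \<oplus>\<^bsub>\<Omega>\<^esub> (cls (v ^ M * (e * ?a)) \<odot>\<^bsub>\<Omega>\<^esub> d u \<oplus>\<^bsub>\<Omega>\<^esub> cls (- 1 * ?a) \<odot>\<^bsub>\<Omega>\<^esub> d u)"
    by (simp add: K.\<Omega>.M.a_ac closed)
  also have "\<dots> = cls (- D u) \<odot>\<^bsub>\<Omega>\<^esub> d v \<oplus>\<^bsub>\<Omega>\<^esub> cls (D v) \<odot>\<^bsub>\<Omega>\<^esub> d u"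
    by (simp only: smult_add closed d_closed) (simp add: D_u D_v algebra_simps)
  finally have "cls (- D u) \<odot>\<^bsub>\<Omega>\<^esub> d v \<oplus>\<^bsub>\<Omega>\<^esub> cls (D v) \<odot>\<^bsub>\<Omega>\<^esub> d u
      = d (e * u ^ N * v ^ M - u ^ N - v ^ M + e')" ..
  also have "cls (e * u ^ N * v ^ M - u ^ N - v ^ M + e') = cls 0"
    using equation by (subst cls_eq_iff) (simp_all add: closed)
  also have "d 0 = \<zero>\<^bsub>\<Omega>\<^esub>"
    using d_uminus[of 1] d_add[of 1 "- 1"] by (simp add: closed d_one)
  finally have "\<ominus>\<^bsub>\<Omega>\<^esub> (cls (D u) \<odot>\<^bsub>\<Omega>\<^esub> d v) \<oplus>\<^bsub>\<Omega>\<^esub> cls (D v) \<odot>\<^bsub>\<Omega>\<^esub> d u = \<zero>\<^bsub>\<Omega>\<^esub>"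
    by (simp add: smult_uminus closed)
  then show ?thesis
    by (metis K.\<Omega>.M.add.inv_closed K.\<Omega>.M.minus_equality K.\<Omega>.M.minus_minus K.\<Omega>.M.a_comm
        D_closed d_closed smult_closed u_closed v_closed)
qed

text \<open>\<open>D\<close> contracts this form to \<open>\<alpha> * D u + \<beta> * D v\<close>,
  which is 1 modulo \<open>I\<close>. Up to sign it is the Poincare residue of du dv divided by the
  equation.\<close>

definition \<theta> where "\<theta> = cls \<alpha> \<odot>\<^bsub>\<Omega>\<^esub> d u \<oplus>\<^bsub>\<Omega>\<^esub> cls \<beta> \<odot>\<^bsub>\<Omega>\<^esub> d v"
definition form where "form p = cls p \<odot>\<^bsub>\<Omega>\<^esub> \<theta>"

lemma \<theta>_closed [simp]: "\<theta> \<in> carrier \<Omega>"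
  by (simp add: \<theta>_def closed)

lemma form_closed [simp]: "p \<in> S \<Longrightarrow> form p \<in> carrier \<Omega>"
  by (simp add: form_def)

lemma form_add: "p \<in> S \<Longrightarrow> q \<in> S \<Longrightarrow> form p \<oplus>\<^bsub>\<Omega>\<^esub> form q = form (p + q)"
  by (simp add: form_def smult_add)

lemma form_smult: "p \<in> S \<Longrightarrow> q \<in> S \<Longrightarrow> cls p \<odot>\<^bsub>\<Omega>\<^esub> form q = form (p * q)"
  by (simp add: form_def smult_assoc)

lemma form_uminus: "p \<in> S \<Longrightarrow> \<ominus>\<^bsub>\<Omega>\<^esub> form p = form (- p)"
  by (simp add: form_def smult_uminus)

lemma form_minus: "p \<in> S \<Longrightarrow> q \<in> S \<Longrightarrow> form p \<ominus>\<^bsub>\<Omega>\<^esub> form q = form (p - q)"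
  by (simp add: K.\<Omega>.M.minus_eq form_uminus form_add closed)

lemma form_zero: "form 0 = \<zero>\<^bsub>\<Omega>\<^esub>"
  by (simp add: form_def smult_zero)

lemma form_cong: "p \<in> S \<Longrightarrow> q \<in> S \<Longrightarrow> p - q \<in> I \<Longrightarrow> form p = form q"
  by (simp add: form_def cls_eq_iff[symmetric])

lemma cls_unimodular: "cls (D u * \<alpha> + D v * \<beta>) = cls 1"
  using unimodular by (subst cls_eq_iff) (simp_all add: closed algebra_simps)

text \<open>By \<open>relation\<close>, the second summand of \<open>D u\<close> times
  \<open>\<theta>\<close> becomes a multiple of \<open>d u\<close> with coefficient
  \<open>\<beta> * D v\<close>; the two coefficients then add up to 1.\<close>

lemma d_u: "d u = form (D u)"
proof -
  have "form (D u) = cls (D u * \<alpha>) \<odot>\<^bsub>\<Omega>\<^esub> d u \<oplus>\<^bsub>\<Omega>\<^esub> cls \<beta> \<odot>\<^bsub>\<Omega>\<^esub> (cls (D u) \<odot>\<^bsub>\<Omega>\<^esub> d v)"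
    by (simp add: form_def \<theta>_def K.\<Omega>.smult_r_distr smult_assoc closed mult.commute)
  also have "\<dots> = cls (D u * \<alpha> + D v * \<beta>) \<odot>\<^bsub>\<Omega>\<^esub> d u"
    by (simp add: relation[symmetric] smult_assoc smult_add closed mult.commute)
  finally show ?thesis
    by (simp add: cls_unimodular smult_one closed)
qed

lemma d_v: "d v = form (D v)"
proof -
  have "form (D v) = cls \<alpha> \<odot>\<^bsub>\<Omega>\<^esub> (cls (D v) \<odot>\<^bsub>\<Omega>\<^esub> d u) \<oplus>\<^bsub>\<Omega>\<^esub> cls (D v * \<beta>) \<odot>\<^bsub>\<Omega>\<^esub> d v"
    by (simp add: form_def \<theta>_def K.\<Omega>.smult_r_distr smult_assoc closed mult.commute)
  also have "\<dots> = cls (D u * \<alpha> + D v * \<beta>) \<odot>\<^bsub>\<Omega>\<^esub> d v"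
    by (simp add: relation smult_assoc smult_add closed mult.commute)
  finally show ?thesis
    by (simp add: cls_unimodular smult_one closed)
qed

text \<open>Both sides are derivations that kill scalars and agree on \<open>u\<close> and
  \<open>v\<close>, so they agree on everything generated from these by sums, products and
  inverses.\<close>

lemma d_form: "p \<in> S \<Longrightarrow> d p = form (D p)"
proof -
  let ?Z = "{p \<in> S. d p = form (D p)}"
  have "S \<subseteq> ?Z"
  proof (rule generated)
    show "range \<iota> \<subseteq> ?Z"
      by (auto simp: closed d_\<iota> D_\<iota> form_zero)
    show "u \<in> ?Z" "v \<in> ?Z"
      by (auto simp: closed d_u d_v)
    show "p + q \<in> ?Z" if "p \<in> ?Z" "q \<in> ?Z" for p q
      using that by (auto simp: closed d_add D_add form_add)
    show "p * q \<in> ?Z" if "p \<in> ?Z" "q \<in> ?Z" for p q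
      using that by (auto simp: closed d_mult D_mult form_smult form_add)
    \<comment> \<open>From p q = 1 both derivations satisfy p (d q) + q (d p) = 0. Multiplication by
      q isolates d q and expresses it through the already known d p.\<close>
    show "q \<in> ?Z" if p: "p \<in> ?Z" and q: "q \<in> S" "p * q = 1" for p q
    proof -
      have pq: "q * p = 1" "q * (p * x) = x" for x
        using q by (simp_all add: mult.commute flip: mult.assoc)
      have "\<zero>\<^bsub>\<Omega>\<^esub> = cls p \<odot>\<^bsub>\<Omega>\<^esub> d q \<oplus>\<^bsub>\<Omega>\<^esub> cls q \<odot>\<^bsub>\<Omega>\<^esub> form (D p)"
        using p q d_mult[of p q] by (simp add: d_one)
      then have "\<zero>\<^bsub>\<Omega>\<^esub> = cls q \<odot>\<^bsub>\<Omega>\<^esub> (cls p \<odot>\<^bsub>\<Omega>\<^esub> d q \<oplus>\<^bsub>\<Omega>\<^esub> cls q \<odot>\<^bsub>\<Omega>\<^esub> form (D p))"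
        using q by (metis K.\<Omega>.smult_r_null cls_closed)
      also have "\<dots> = d q \<oplus>\<^bsub>\<Omega>\<^esub> form (q * (q * D p))"
        using p q pq by (simp add: K.\<Omega>.smult_r_distr smult_assoc form_smult smult_one closed)
      finally have 1: "d q \<oplus>\<^bsub>\<Omega>\<^esub> form (q * (q * D p)) = \<zero>\<^bsub>\<Omega>\<^esub>" ..
      have "q * (p * D q + q * D p) = 0"
        using q D_mult[of p q] D_one by simp
      then have "D q + q * (q * D p) = 0"
        using pq by (simp add: distrib_left)
      then have 2: "form (D q) \<oplus>\<^bsub>\<Omega>\<^esub> form (q * (q * D p)) = \<zero>\<^bsub>\<Omega>\<^esub>"
        using p q by (simp add: form_add closed form_zero)
      have "form (q * (q * D p)) \<in> carrier \<Omega>"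
        using p q by (simp add: closed)
      with 1 2 q have "d q = form (D q)"
        by (metis K.\<Omega>.M.minus_equality d_closed D_closed form_closed)
      with q show ?thesis by simp
    qed
  qed
  then show "p \<in> S \<Longrightarrow> d p = form (D p)" by blast
qed

lemma carrier_\<Omega>: "carrier \<Omega> = form ` S"
proof -
  have "\<omega> \<in> form ` S" if "\<omega> \<in> carrier \<Omega>" for \<omega>
    using that
  proof (induction \<omega> rule: K.\<Omega>_induct)
    case zero
    then show ?case by (auto simp: form_zero[symmetric] S_closed)
  next
    case (add x y)
    then show ?case by (auto simp: form_add intro: S_add)
  next
    case (d r b)
    then show ?case by (auto simp: carrier_B d_form form_smult closed)
  qed
  then show ?thesis by auto
qed

text \<open>The derivation that \<open>D\<close> induces on the quotient, computed on a chosen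
  representative; \<open>\<delta>_cls\<close> derives independence of the choice from
  \<open>D_I\<close>.\<close>

definition \<delta> where "\<delta> c = cls (D (SOME p. p \<in> S \<and> c = cls p))"

lemma \<delta>_cls:
  assumes "p \<in> S"
  shows "\<delta> (cls p) = cls (D p)"
proof -
  define q where "q = (SOME q. q \<in> S \<and> cls p = cls q)"
  have q: "q \<in> S \<and> cls p = cls q"
    unfolding q_def by (rule someI[of _ p]) (use assms in simp)
  then have "D (q - p) \<in> I"
    using assms by (intro D_I) (metis cls_eq_iff)
  moreover have "D (q - p) + D p = D q"
    by (simp flip: D_add)
  ultimately have "D q - D p \<in> I"
    by (metis add_diff_cancel_right')
  then show ?thesis
    unfolding \<delta>_def q_def[symmetric] using q assms by (simp add: cls_eq_iff closed)
qed

sublocale T: kaehler_derivation ring_of_type_algebra \<phi> B B "self_module B" "\<lambda>x. x" \<delta>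
proof (intro kaehler_derivation.intro kaehler_derivation_axioms.intro)
  show "kaehler_differentials ring_of_type_algebra \<phi> B" ..
  show "module B (self_module B)" by (rule B.module_self_module)
qed (auto simp: ring_hom_def carrier_B self_module_def \<delta>_cls cls_add cls_mult closed
      D_add D_mult D_\<iota> zero_B)

text \<open>The universal property applied to \<open>\<delta>\<close> yields contraction with the
  vector field, a linear map from the differentials to the ring that sends \<open>\<theta>\<close>
  to 1. So \<open>\<theta>\<close> has zero annihilator, and with \<open>carrier_\<Omega>\<close>
  the differentials are free of rank one.\<close>

lemma form_eq_iff:
  assumes "p \<in> S" "q \<in> S"
  shows "form p = form q \<longleftrightarrow> p - q \<in> I"
proof -
  have *: "T.induced (form p) = cls p" if "p \<in> S" for p
  proof -
    have "T.induced (form p) = cls p \<otimes>\<^bsub>B\<^esub> (cls \<alpha> \<otimes>\<^bsub>B\<^esub> \<delta> (cls u) \<oplus>\<^bsub>B\<^esub> cls \<beta> \<otimes>\<^bsub>B\<^esub> \<delta> (cls v))"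
      using that unfolding form_def \<theta>_def
      by (simp add: T.induced_smult T.induced_add T.induced_d closed) (simp add: self_module_def)
    also have "\<dots> = cls p \<otimes>\<^bsub>B\<^esub> cls (D u * \<alpha> + D v * \<beta>)"
      by (simp add: \<delta>_cls cls_mult cls_add closed mult.commute)
    also have "\<dots> = cls p"
      using that by (simp only: cls_unimodular) (simp add: cls_mult closed)
    finally show ?thesis .
  qed
  have "form p = form q \<Longrightarrow> cls p = cls q"
    using *[OF assms(1)] *[OF assms(2)] by simp
  then show ?thesis
    using assms by (metis cls_eq_iff form_cong)
qed

end

text \<open>
  Restriction from a chart to a smaller open set; \<open>c\<close> is the factor by which the generating
  forms differ.
\<close>

locale chart_restriction = X: affine_chart S I \<iota> D u v \<alpha> \<beta> e e' N M
    + Y: affine_chart S' I' \<iota> D' u' v' \<alpha>' \<beta>' f f' N' M'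
  for S I S' I' :: "'b::comm_ring_1 set" and \<iota> :: "'a::comm_ring_1 \<Rightarrow> 'b" and D u v \<alpha> \<beta> e e' N M
    D' u' v' \<alpha>' \<beta>' f f' N' M' +
  fixes c
  assumes S_subset: "S \<subseteq> S'" and I_subset': "I \<subseteq> I'" and c_closed: "c \<in> S'"
    and D'_u: "D' u - c * D u \<in> I'" and D'_v: "D' v - c * D v \<in> I'"
begin

abbreviation \<rho> where "\<rho> C \<equiv> C <+>\<^bsub>Y.R\<^esub> I'"

lemma \<rho>_cls:
  assumes "p \<in> S"
  shows "\<rho> (X.cls p) = Y.cls p"
proof -
  have "\<rho> (X.cls p) = (\<Union>h\<in>I. \<Union>k\<in>I'. {h + p + k})"
    unfolding X.cls_set by (auto simp: set_add_def' type_algebra_simps)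
  also have "\<dots> = Y.cls p"
  proof (intro equalityI subsetI)
    fix x assume "x \<in> (\<Union>h\<in>I. \<Union>k\<in>I'. {h + p + k})"
    then obtain h k where "h \<in> I" "k \<in> I'" "x = (h + k) + p"
      by (auto simp: algebra_simps)
    then show "x \<in> Y.cls p"
      using I_subset' Y.I_add unfolding Y.cls_set by blast
  next
    fix x assume "x \<in> Y.cls p"
    then show "x \<in> (\<Union>h\<in>I. \<Union>k\<in>I'. {h + p + k})"
      using X.I_zero by (force simp: Y.cls_set add.commute)
  qed
  finally show ?thesis .
qed

text \<open>Restriction followed by the universal derivation of the smaller open set. Its
  \<open>induced\<close> map unfolds to \<open>kaehler_map\<close>, which is thereby well defined
  and semilinear over \<open>\<rho>\<close>.\<close>

sublocale T: kaehler_derivation ring_of_type_algebra X.\<phi> X.B Y.B Y.\<Omega> \<rho>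
  "\<lambda>b. kaehler_d ring_of_type_algebra Y.\<phi> Y.B (\<rho> b)"
proof (intro kaehler_derivation.intro kaehler_derivation_axioms.intro)
  have "p \<in> S \<Longrightarrow> p \<in> S'" for p
    using S_subset by blast
  note S = this
  show "kaehler_differentials ring_of_type_algebra X.\<phi> X.B" ..
  show "module Y.B Y.\<Omega>" by (rule Y.K.module_\<Omega>)
  show "\<rho> \<in> ring_hom X.B Y.B"
    by (auto simp: ring_hom_def X.carrier_B \<rho>_cls Y.cls_add Y.cls_mult X.cls_add X.cls_mult
        X.closed X.one_B Y.one_B S)
qed (use S_subset in \<open>auto simp: X.carrier_B \<rho>_cls X.cls_add X.cls_mult X.closed
      Y.d_\<iota> Y.d_add Y.d_mult subset_iff\<close>)

text \<open>The restriction of \<open>X.\<theta>\<close> is a combination of d u and d v, whose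
  coefficients on the smaller open set are c (D u) and c (D v). Unimodularity of the larger chart
  collapses the combination to c times \<open>Y.\<theta>\<close>.\<close>

lemma kaehler_map_form:
  assumes "p \<in> S"
  shows "kaehler_map ring_of_type_algebra X.B Y.\<phi> Y.B \<rho> (X.form p) = Y.form (c * p)"
proof -
  note S = subsetD[OF S_subset]
  have uv: "Y.d u = Y.form (c * D u)" "Y.d v = Y.form (c * D v)"
    using D'_u D'_v by (auto simp: Y.d_form Y.form_eq_iff S X.closed Y.closed c_closed)
  have "T.induced (X.form p) = Y.cls p \<odot>\<^bsub>Y.\<Omega>\<^esub> (Y.cls \<alpha> \<odot>\<^bsub>Y.\<Omega>\<^esub> Y.d u \<oplus>\<^bsub>Y.\<Omega>\<^esub> Y.cls \<beta> \<odot>\<^bsub>Y.\<Omega>\<^esub> Y.d v)"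
    using assms unfolding X.form_def X.\<theta>_def
    by (simp add: T.induced_smult T.induced_add T.induced_d X.closed \<rho>_cls)
  also have "\<dots> = Y.form (p * (\<alpha> * (c * D u) + \<beta> * (c * D v)))"
    using assms unfolding uv by (simp add: Y.form_smult Y.form_add Y.closed X.closed S c_closed)
  also have "\<dots> = Y.form (c * p)"
  proof -
    have "(c * p) * (\<alpha> * D u + \<beta> * D v - 1) \<in> I'"
      using X.unimodular I_subset' assms by (intro Y.I_mult) (auto simp: Y.closed S c_closed)
    also have "(c * p) * (\<alpha> * D u + \<beta> * D v - 1) = p * (\<alpha> * (c * D u) + \<beta> * (c * D v)) - c * p"
      by (simp add: algebra_simps)
    finally show ?thesis
      using assms by (subst Y.form_eq_iff) (auto simp: Y.closed X.closed S c_closed)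
  qed
  finally show ?thesis
    by (simp add: kaehler_map_def T.induced_def T.lin_def[abs_def])
qed

text \<open>Restriction commutes with d, so the congruence assumed for the two generators extends to
  all functions; \<open>Y.form_eq_iff\<close> reads it off from the forms.\<close>

lemma D'_eq:
  assumes "p \<in> S"
  shows "D' p - c * D p \<in> I'"
proof -
  note S = subsetD[OF S_subset]
  have "T.induced (X.d p) = Y.d p"
    using assms by (simp add: T.induced_d \<rho>_cls)
  then have "Y.form (c * D p) = Y.form (D' p)"
    using assms kaehler_map_form[of "D p"]
    by (simp add: X.d_form Y.d_form X.closed S kaehler_map_def T.induced_def T.lin_def[abs_def])
  then have "Y.form (D' p) = Y.form (c * D p)" ..
  then show ?thesis
    using assms by (subst (asm) Y.form_eq_iff) (auto simp: Y.closed X.closed S c_closed)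
qed

end

section \<open>Laurent polynomials in two variables\<close>

lemma poly_mapping_support_induct [consumes 1, case_names zero add monomial]:
  assumes "Poly_Mapping.keys p \<subseteq> A"
    and "P 0" "\<And>p q. P p \<Longrightarrow> P q \<Longrightarrow> P (p + q)" "\<And>k c. k \<in> A \<Longrightarrow> P (Poly_Mapping.single k c)"
  shows "P p"
  using assms(1)
proof (induction p rule: update_induct)
  case const
  then show ?case using assms by simp
next
  case (update p k c)
  have "Poly_Mapping.update k c p = p + Poly_Mapping.single k c"
    using update.hyps by (intro poly_mapping_eqI)
      (auto simp: lookup_update lookup_add lookup_single when_def in_keys_iff)
  moreover have "P p" "k \<in> A"
    using update by (auto simp: keys_update)
  ultimately show ?case
    using assms(3,4) by simp
qed

lemma lookup_single_mult:
  fixes q :: "'k::ab_group_add \<Rightarrow>\<^sub>0 'a::comm_ring_1"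
  shows "Poly_Mapping.lookup (Poly_Mapping.single k c * q) l = c * Poly_Mapping.lookup q (l - k)"
  using subset_UNIV
proof (induction q rule: poly_mapping_support_induct)
  case (monomial k' c')
  then show ?case
    by (auto simp: mult_single lookup_single when_def algebra_simps)
qed (auto simp: distrib_left lookup_add)

text \<open>With an additive weight this is a derivation; with a 0/1 weight it is a truncation of
  the support. Euler operators, \<open>restr\<close> and the projection to bidegree zero are all
  instances.\<close>

definition weigh :: "('k \<Rightarrow> 'a) \<Rightarrow> ('k \<Rightarrow>\<^sub>0 'a) \<Rightarrow> 'k \<Rightarrow>\<^sub>0 'a::comm_ring_1" where
  "weigh w p = Poly_Mapping.mapp (\<lambda>k c. w k * c) p"

lemma lookup_weigh [simp]: "Poly_Mapping.lookup (weigh w p) k = w k * Poly_Mapping.lookup p k"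
  by (auto simp: weigh_def lookup_mapp when_def in_keys_iff)

lemma weigh_add [simp]: "weigh w (p + q) = weigh w p + weigh w q"
  by (rule poly_mapping_eqI) (simp add: lookup_add algebra_simps)

lemma weigh_diff [simp]: "weigh w (p - q) = weigh w p - weigh w q"
  by (rule poly_mapping_eqI) (simp add: lookup_minus algebra_simps)

lemma weigh_zero [simp]: "weigh w 0 = 0"
  by (rule poly_mapping_eqI) simp

lemma weigh_single [simp]:
  "weigh w (Poly_Mapping.single k c) = Poly_Mapping.single k (w k * c)"
  by (rule poly_mapping_eqI) (simp add: lookup_single when_def)

lemma weigh_derivation:
  fixes p q :: "'k::comm_monoid_add \<Rightarrow>\<^sub>0 'a::comm_ring_1"
  assumes "\<And>k l. w (k + l) = w k + w l"
  shows "weigh w (p * q) = p * weigh w q + q * weigh w p"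
  using subset_UNIV
proof (induction p rule: poly_mapping_support_induct)
  case (monomial k c)
  show ?case
    using subset_UNIV
  proof (induction q rule: poly_mapping_support_induct)
    case (monomial k' c')
    then show ?case
      by (simp add: mult_single assms algebra_simps flip: single_add)
  qed (simp_all add: algebra_simps)
qed (simp_all add: algebra_simps)

text \<open>\<open>mm a b\<close> is $x^a y^b$.\<close>

definition mm :: "int \<Rightarrow> int \<Rightarrow> 'a::comm_ring_1 laurent" where
  "mm a b = mon (- a) a (- b) b"

definition coef :: "'a::comm_ring_1 laurent \<Rightarrow> int \<Rightarrow> int \<Rightarrow> 'a" where
  "coef p a b = Poly_Mapping.lookup p (- a, a, - b, b)"

definition lau :: "(int \<Rightarrow> int \<Rightarrow> bool) \<Rightarrow> 'a::comm_ring_1 laurent set" where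
  "lau W = {p. Poly_Mapping.keys p \<subseteq> {(- a, a, - b, b) | a b. W a b}}"

lemma mm_mult [simp]: "mm a b * mm c d = mm (a + c) (b + d)"
  by (simp add: mm_def mult_single add.commute)

lemma mm_mult_assoc [simp]: "mm a b * (mm c d * p) = mm (a + c) (b + d) * p"
  by (simp flip: mult.assoc)

lemma mm_0 [simp]: "mm 0 0 = 1"
  by (simp add: mm_def flip: zero_prod_def)

lemma mm_power: "mm a b ^ n = mm (int n * a) (int n * b)"
  by (induction n) (simp_all add: algebra_simps)

lemma const_mult: "const a * const b = const (a * b)"
  by (simp add: mult_single)

lemma const_mm: "const c * mm a b = Poly_Mapping.single (- a, a, - b, b) c"
  by (simp add: mm_def mult_single)

lemma lau_monomial: "W a b \<Longrightarrow> const c * mm a b \<in> lau W"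
  by (auto simp: lau_def const_mm)

lemma lau_mm: "W a b \<Longrightarrow> mm a b \<in> lau W"
  using lau_monomial[of W a b 1] by simp

lemma lau_const: "W 0 0 \<Longrightarrow> const c \<in> lau W"
  using lau_monomial[of W 0 0 c] by simp

lemma lau_zero [simp]: "0 \<in> lau W"
  by (simp add: lau_def)

lemma lau_add: "p \<in> lau W \<Longrightarrow> q \<in> lau W \<Longrightarrow> p + q \<in> lau W"
  using keys_add[of p q] unfolding lau_def by blast

lemma lau_uminus: "p \<in> lau W \<Longrightarrow> - p \<in> lau W"
  by (auto simp: lau_def in_keys_iff)

lemma lau_diff: "p \<in> lau W \<Longrightarrow> q \<in> lau W \<Longrightarrow> p - q \<in> lau W"
  using lau_add[of p W "- q"] lau_uminus[of q W] by simp

lemma lau_mult: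
  assumes "p \<in> lau V" "q \<in> lau W" "\<And>a b c d. V a b \<Longrightarrow> W c d \<Longrightarrow> Z (a + c) (b + d)"
  shows "p * q \<in> lau Z"
proof -
  have "k \<in> {(- a, a, - b, b) | a b. Z a b}" if k: "k \<in> Poly_Mapping.keys (p * q)" for k
  proof -
    obtain k1 k2 where "k = k1 + k2" "k1 \<in> Poly_Mapping.keys p" "k2 \<in> Poly_Mapping.keys q"
      using k keys_mult[of p q] by blast
    then obtain a b c d where "k = (- a, a, - b, b) + (- c, c, - d, d)" "V a b" "W c d"
      using assms(1,2) unfolding lau_def by blast
    then have "k = (- (a + c), a + c, - (b + d), b + d)" "Z (a + c) (b + d)"
      using assms(3) by auto
    then show ?thesis
      by blast
  qed
  then show ?thesis
    by (auto simp: lau_def)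
qed

lemma lau_mono: "p \<in> lau W \<Longrightarrow> (\<And>a b. W a b \<Longrightarrow> V a b) \<Longrightarrow> p \<in> lau V"
  unfolding lau_def by blast

lemma lau_induct [consumes 1, case_names zero add monomial]:
  assumes "p \<in> lau W"
    and "P 0" "\<And>p q. P p \<Longrightarrow> P q \<Longrightarrow> P (p + q)" "\<And>a b c. W a b \<Longrightarrow> P (const c * mm a b)"
  shows "P p"
proof -
  have "Poly_Mapping.keys p \<subseteq> {(- a, a, - b, b) | a b. W a b}"
    using assms(1) by (simp add: lau_def)
  then show ?thesis
    by (induction p rule: poly_mapping_support_induct) (use assms in \<open>auto simp: const_mm\<close>)
qed

lemma coef_mm_mult [simp]: "coef (mm a b * p) c d = coef p (c - a) (d - b)"
  unfolding coef_def mm_def lookup_single_mult by simp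

lemma coef_const_mult [simp]: "coef (const r * p) c d = r * coef p c d"
  by (simp add: coef_def lookup_single_mult flip: zero_prod_def)

lemma coef_add [simp]: "coef (p + q) a b = coef p a b + coef q a b"
  by (simp add: coef_def lookup_add)

lemma coef_diff [simp]: "coef (p - q) a b = coef p a b - coef q a b"
  by (simp add: coef_def lookup_minus)

lemma coef_zero [simp]: "coef 0 a b = 0"
  by (simp add: coef_def)

lemma coef_mm: "coef (mm a b) c d = (if a = c \<and> b = d then 1 else 0)"
  by (auto simp: coef_def mm_def lookup_single when_def)

text \<open>\<open>coef\<close> sees only exponents of bidegree zero, so membership in some
  \<open>lau\<close> is what makes it determine the polynomial.\<close>

lemma coef_eqI:
  assumes "p \<in> lau V" "q \<in> lau W" "\<And>a b. coef p a b = coef q a b"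
  shows "p = q"
proof (rule poly_mapping_eqI)
  fix k
  show "Poly_Mapping.lookup p k = Poly_Mapping.lookup q k"
  proof (cases "\<exists>a b. k = (- a, a, - b, b)")
    case True
    then show ?thesis using assms(3) by (auto simp: coef_def)
  next
    case False
    then have "k \<notin> Poly_Mapping.keys p" "k \<notin> Poly_Mapping.keys q"
      using assms unfolding lau_def by blast+
    then show ?thesis by (simp add: in_keys_iff)
  qed
qed

lemma lau_iff_coef: "p \<in> lau W \<longleftrightarrow> p \<in> lau (\<lambda>_ _. True) \<and> (\<forall>a b. coef p a b \<noteq> 0 \<longrightarrow> W a b)"
proof
  assume p: "p \<in> lau W"
  then show "p \<in> lau (\<lambda>_ _. True) \<and> (\<forall>a b. coef p a b \<noteq> 0 \<longrightarrow> W a b)"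
    by (auto simp: coef_def lau_def in_keys_iff subset_iff)
qed (fastforce simp: coef_def lau_def in_keys_iff subset_iff)

lemma lau_coefD: "p \<in> lau W \<Longrightarrow> coef p a b \<noteq> 0 \<Longrightarrow> W a b"
  using lau_iff_coef[of p W] by simp

lemma lau_coefI: "p \<in> lau V \<Longrightarrow> (\<And>a b. coef p a b \<noteq> 0 \<Longrightarrow> W a b) \<Longrightarrow> p \<in> lau W"
  using lau_iff_coef[of p W] lau_iff_coef[of p V] by simp

lemma finite_coef: "finite {(a, b). coef p a b \<noteq> 0}"
proof -
  have "(\<lambda>(a, b). (- a, a, - b, b)) ` {(a, b). coef p a b \<noteq> 0} \<subseteq> Poly_Mapping.keys p"
    by (auto simp: coef_def in_keys_iff)
  then have "finite ((\<lambda>(a, b). (- a, a, - b, b)) ` {(a, b). coef p a b \<noteq> 0})"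
    by (rule finite_subset) simp
  then show ?thesis
    by (rule finite_imageD) (auto simp: inj_on_def)
qed

abbreviation everywhere :: "int \<Rightarrow> int \<Rightarrow> bool" where "everywhere \<equiv> \<lambda>_ _. True"

lemma coef_sum: "coef (sum f K) a b = (\<Sum>k\<in>K. coef (f k) a b)"
  by (simp add: coef_def lookup_sum)

lemma lau_sum: "(\<And>k. k \<in> K \<Longrightarrow> f k \<in> lau W) \<Longrightarrow> sum f K \<in> lau W"
  by (induction K rule: infinite_finite_induct) (auto intro: lau_add)

text \<open>The reindexing \<open>f\<close> lets the pairs (i, j) that label the basis serve as
  summation indices for the monomials.\<close>

lemma lau_expansion:
  assumes "finite K" "inj_on f K" "r \<in> lau W" "\<And>a b. W a b \<Longrightarrow> (a, b) \<in> f ` K"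
  shows "r = (\<Sum>k\<in>K. const (case_prod (coef r) (f k)) * case_prod mm (f k))"
proof (rule coef_eqI[OF assms(3)])
  show "(\<Sum>k\<in>K. const (case_prod (coef r) (f k)) * case_prod mm (f k)) \<in> lau everywhere"
    by (intro lau_sum) (auto intro: lau_monomial split: prod.split)
  fix a b
  have *: "coef (\<Sum>k\<in>K. const (case_prod (coef r) (f k)) * case_prod mm (f k)) a b
      = (\<Sum>k\<in>K. if f k = (a, b) then coef r a b else 0)"
    unfolding coef_sum by (rule sum.cong) (auto simp: coef_mm split: prod.split)
  show "coef r a b = coef (\<Sum>k\<in>K. const (case_prod (coef r) (f k)) * case_prod mm (f k)) a b"
  proof (cases "(a, b) \<in> f ` K")
    case True
    then obtain k0 where k0: "k0 \<in> K" "f k0 = (a, b)"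
      by auto
    have "(\<Sum>k\<in>K. if f k = (a, b) then coef r a b else 0) = (\<Sum>k\<in>K. if k = k0 then coef r a b else 0)"
      using assms(2) k0 by (intro sum.cong) (auto simp: inj_on_def)
    then show ?thesis
      unfolding * using assms(1) k0 by simp
  next
    case False
    then have "coef r a b = 0"
      using assms(4) lau_coefD[OF assms(3)] by blast
    then show ?thesis
      unfolding * by (simp cong: if_cong)
  qed
qed

section \<open>Truncations and Euler operators\<close>

definition restr :: "(int \<Rightarrow> int \<Rightarrow> bool) \<Rightarrow> 'a::comm_ring_1 laurent \<Rightarrow> 'a laurent" where
  "restr W p = weigh (\<lambda>(a0, a, b0, b). if W a b then 1 else 0) p"

lemma coef_restr [simp]: "coef (restr W p) a b = (if W a b then coef p a b else 0)"
  by (simp add: restr_def coef_def)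

lemma lau_restr: "p \<in> lau V \<Longrightarrow> restr W p \<in> lau (\<lambda>a b. V a b \<and> W a b)"
  unfolding lau_def restr_def by (fastforce simp: in_keys_iff subset_iff split: if_splits)

text \<open>The Euler operators x d/dx and y d/dy, which keep exponents fixed and so are given by
  weights.\<close>

definition x_deriv :: "'a::comm_ring_1 laurent \<Rightarrow> 'a laurent" where
  "x_deriv p = weigh (\<lambda>(a0, a, b0, b). of_int a) p"

definition y_deriv :: "'a::comm_ring_1 laurent \<Rightarrow> 'a laurent" where
  "y_deriv p = weigh (\<lambda>(a0, a, b0, b). of_int b) p"

lemma deriv_add [simp]: "x_deriv (p + q) = x_deriv p + x_deriv q" "y_deriv (p + q) = y_deriv p + y_deriv q"
  and deriv_diff [simp]: "x_deriv (p - q) = x_deriv p - x_deriv q" "y_deriv (p - q) = y_deriv p - y_deriv q"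
  by (simp_all add: x_deriv_def y_deriv_def)

lemma deriv_mult:
  "x_deriv (p * q) = p * x_deriv q + q * x_deriv p" "y_deriv (p * q) = p * y_deriv q + q * y_deriv p"
  unfolding x_deriv_def y_deriv_def by (rule weigh_derivation; auto)+

lemma deriv_const [simp]: "x_deriv (const c) = 0" "y_deriv (const c) = 0"
  by (simp_all add: x_deriv_def y_deriv_def zero_prod_def)

lemma of_int_mm: "of_int n * mm a b = Poly_Mapping.single (- a, a, - b, b) (of_int n)"
  by (metis const_mm single_of_int)

lemma deriv_mm [simp]: "x_deriv (mm a b) = of_int a * mm a b" "y_deriv (mm a b) = of_int b * mm a b"
  by (simp_all only: of_int_mm) (simp_all add: x_deriv_def y_deriv_def mm_def)

section \<open>The charts of the curve\<close>

text \<open>The sign \<open>\<sigma>\<close> lets one formula serve both for the coordinates x, y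
  and for their inverses z, w.\<close>

definition chart_form :: "nat \<Rightarrow> nat \<Rightarrow> int \<Rightarrow> 'a \<Rightarrow> 'a \<Rightarrow> 'a::comm_ring_1 laurent" where
  "chart_form N M \<sigma> e e' = const e * mm (int N * \<sigma>) (int M * \<sigma>) - mm (int N * \<sigma>) 0 - mm 0 (int M * \<sigma>) + const e'"

text \<open>\<open>W\<close> is the set of exponents on the chart. \<open>W_lower\<close> keeps it
  stable under the partial derivatives, which lower an exponent only where it is nonzero.
  \<open>W_generated\<close> separates the two kinds of chart: monomials are products of powers of
  the coordinates, or the inverses of both coordinates are available.\<close>

locale monomial_chart =
  fixes N M :: nat and t t' n' m' e e' r :: "'a::comm_ring_1" and \<sigma> :: int and W :: "int \<Rightarrow> int \<Rightarrow> bool"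
  assumes N_pos: "0 < N" and M_pos: "0 < M"
    and units: "t * t' = 1" "of_nat N * n' = 1" "of_nat M * m' = 1" "e' * r = 1"
    and e_e': "e * e' = 1 - t"
    and \<sigma>: "\<sigma> = 1 \<or> \<sigma> = - 1"
    and W_zero: "W 0 0" and W_\<sigma>: "W \<sigma> 0" "W 0 \<sigma>"
    and W_add: "\<And>a b c d. W a b \<Longrightarrow> W c d \<Longrightarrow> W (a + c) (b + d)"
    and W_lower: "\<And>a b. W a b \<Longrightarrow> a \<noteq> 0 \<Longrightarrow> W (a - \<sigma>) b" "\<And>a b. W a b \<Longrightarrow> b \<noteq> 0 \<Longrightarrow> W a (b - \<sigma>)"
    and W_generated: "\<And>a b. W a b \<Longrightarrow> 0 \<le> \<sigma> * a \<and> 0 \<le> \<sigma> * b \<or> W (- \<sigma>) 0 \<and> W 0 (- \<sigma>)"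
begin

definition F where "F = chart_form N M \<sigma> e e'"
text \<open>Since \<open>x_deriv\<close> and \<open>y_deriv\<close> are Euler operators, the
  prefactor (u v)^-1 is what turns this into the Hamiltonian field F_u d/dv - F_v d/du; the signs
  \<open>\<sigma>\<close> occur squared.\<close>

definition D where "D p = mm (- \<sigma>) (- \<sigma>) * (x_deriv F * y_deriv p - y_deriv F * x_deriv p)"
definition I where "I = {F * q | q. q \<in> lau W}"
definition u :: "'a laurent" where "u = mm \<sigma> 0"
definition v :: "'a laurent" where "v = mm 0 \<sigma>"
definition \<alpha> where "\<alpha> = const (r * t' * m') * (v * (1 - const e * v ^ M))"
definition \<beta> where "\<beta> = - const (r * n') * u"

lemma F_eq: "F = const e * u ^ N * v ^ M - u ^ N - v ^ M + const e'"
  by (simp add: F_def chart_form_def u_def v_def mm_power mult.assoc)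

sublocale subring_ideal "lau W" I
proof
  show lau1: "1 \<in> lau W"
    using lau_mm[of W 0 0] W_zero by simp
  show lm: "p * q \<in> lau W" if "p \<in> lau W" "q \<in> lau W" for p q :: "'a laurent"
    using that W_add by (rule lau_mult)
  have lp: "p ^ n \<in> lau W" if "p \<in> lau W" for p :: "'a laurent" and n
    using that lau1 lm by (induction n) auto
  have "F \<in> lau W"
    unfolding F_eq u_def v_def by (intro lau_add lp lau_diff lm lau_const W_zero lau_mm W_\<sigma>)
  then show "I \<subseteq> lau W"
    by (auto simp: I_def intro: lm)
  show "0 \<in> I"
    unfolding I_def by (auto intro!: exI[of _ 0])
  show "p + q \<in> I" if pq: "p \<in> I" "q \<in> I" for p q
  proof -
    obtain p' q' where "p = F * p'" "p' \<in> lau W" "q = F * q'" "q' \<in> lau W"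
      using pq by (auto simp: I_def)
    then show ?thesis
      unfolding I_def by (auto intro!: exI[of _ "p' + q'"] lau_add simp: algebra_simps)
  qed
  show "p * q \<in> I" if pq: "p \<in> lau W" "q \<in> I" for p q
  proof -
    obtain q' where "q = F * q'" "q' \<in> lau W"
      using pq by (auto simp: I_def)
    then show ?thesis
      using pq unfolding I_def by (auto intro!: exI[of _ "p * q'"] lm simp: algebra_simps)
  qed
qed (auto intro: lau_add lau_uminus)

lemma uv_closed: "u \<in> lau W" "v \<in> lau W"
  using W_\<sigma> by (auto simp: u_def v_def intro: lau_mm)

lemma const_closed: "const c \<in> lau W"
  using W_zero by (rule lau_const)

lemma S_of_int: "of_int n \<in> lau W"
  using const_closed[of "of_int n"] by simp

lemma F_closed: "F \<in> lau W"
  unfolding F_eq by (auto intro!: S_closed uv_closed const_closed)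

lemma F_I: "F \<in> I"
  using S_one by (force simp: I_def)

lemma D_add: "D (p + q) = D p + D q"
  by (simp add: D_def algebra_simps)

lemma D_mult: "D (p * q) = p * D q + q * D p"
  unfolding D_def deriv_mult by (simp add: algebra_simps del: mm_mult mm_mult_assoc)

lemma D_const: "D (const c) = 0"
  by (simp add: D_def)

lemma x_deriv_F: "x_deriv F = of_int \<sigma> * of_nat N * u ^ N * (const e * v ^ M - 1)"
  and y_deriv_F: "y_deriv F = of_int \<sigma> * of_nat M * v ^ M * (const e * u ^ N - 1)"
  by (simp_all add: F_def chart_form_def u_def v_def mm_power deriv_mult algebra_simps)

lemma \<sigma>_square: "of_int \<sigma> * (of_int \<sigma> * p) = (p :: 'a laurent)"
  using \<sigma> by auto

lemma D_u: "D u = of_nat M * v ^ (M - 1) * (1 - const e * u ^ N)"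
proof -
  have "mm (- \<sigma>) (- \<sigma>) * (v ^ M * u) = (v ^ (M - 1) :: 'a laurent)"
    using M_pos by (simp add: u_def v_def mm_power of_nat_diff algebra_simps)
  moreover have "D u = mm (- \<sigma>) (- \<sigma>) * (v ^ M * u) * (of_nat M * (1 - const e * u ^ N))"
    using \<sigma>_square[of "mm (- \<sigma>) (- \<sigma>) * (v ^ M * u) * (of_nat M * (1 - const e * u ^ N))"]
    unfolding D_def y_deriv_F by (simp add: u_def algebra_simps del: mm_mult mm_mult_assoc)
  ultimately show ?thesis
    by (simp add: mult_ac)
qed

lemma D_v: "D v = - of_nat N * u ^ (N - 1) * (1 - const e * v ^ M)"
proof -
  have "mm (- \<sigma>) (- \<sigma>) * (u ^ N * v) = (u ^ (N - 1) :: 'a laurent)"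
    using N_pos by (simp add: u_def v_def mm_power of_nat_diff algebra_simps)
  moreover have "D v = mm (- \<sigma>) (- \<sigma>) * (u ^ N * v) * (- of_nat N * (1 - const e * v ^ M))"
    using \<sigma>_square[of "mm (- \<sigma>) (- \<sigma>) * (u ^ N * v) * (of_nat N * (1 - const e * v ^ M))"]
    unfolding D_def x_deriv_F by (simp add: v_def algebra_simps del: mm_mult mm_mult_assoc)
  ultimately show ?thesis
    by (simp add: mult_ac)
qed

lemma D_F: "D (F * q) = F * D q"
  by (simp add: D_mult) (simp add: D_def)

lemma D_closed:
  assumes "p \<in> lau W"
  shows "D p \<in> lau W"
  using assms
proof (induction p rule: lau_induct)
  case zero
  then show ?case using D_const[of 0] by simp
next
  case (add p q)
  then show ?case by (auto simp: D_add intro: lau_add)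
next
  case (monomial a b c)
  \<comment> \<open>If lowering an exponent would leave \<open>W\<close>, that exponent is 0 and so
    is the factor in front.\<close>
  have *: "of_int a * (mm (a - \<sigma>) b :: 'a laurent) \<in> lau W" "of_int b * (mm a (b - \<sigma>) :: 'a laurent) \<in> lau W"
    using W_lower[OF monomial] lau_mm[of W] const_closed[of "of_int a"] const_closed[of "of_int b"]
    by (cases "a = 0"; cases "b = 0"; auto intro: S_mult)+
  have uv: "mm (- \<sigma>) 0 * u ^ N = (u ^ (N - 1) :: 'a laurent)" "mm 0 (- \<sigma>) * v ^ M = (v ^ (M - 1) :: 'a laurent)"
    using N_pos M_pos by (simp_all add: u_def v_def mm_power of_nat_diff algebra_simps)
  \<comment> \<open>Of the two inverse coordinates in the prefactor, one lowers the monomial and the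
    other is absorbed by the power of \<open>u\<close> or \<open>v\<close> in the derivative of
    \<open>F\<close>.\<close>
  have "D (mm a b) = of_int b * mm a (b - \<sigma>) * (of_int \<sigma> * of_nat N * (mm (- \<sigma>) 0 * u ^ N) * (const e * v ^ M - 1))
      - of_int a * mm (a - \<sigma>) b * (of_int \<sigma> * of_nat M * (mm 0 (- \<sigma>) * v ^ M) * (const e * u ^ N - 1))"
  proof -
    have "mm (- \<sigma>) (- \<sigma>) * (mm a b * p) = mm a (b - \<sigma>) * (mm (- \<sigma>) 0 * p :: 'a laurent)"
      "mm (- \<sigma>) (- \<sigma>) * (mm a b * p) = mm (a - \<sigma>) b * (mm 0 (- \<sigma>) * p :: 'a laurent)" for p
      by (simp_all add: algebra_simps)
    note 1 = this(1)[of "of_int b * x_deriv F"] and 2 = this(2)[of "of_int a * y_deriv F"]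
    have "D (mm a b) = mm (- \<sigma>) (- \<sigma>) * (mm a b * (of_int b * x_deriv F))
        - mm (- \<sigma>) (- \<sigma>) * (mm a b * (of_int a * y_deriv F))"
      by (simp add: D_def algebra_simps del: mm_mult mm_mult_assoc)
    then show ?thesis
      unfolding 1 2 unfolding x_deriv_F y_deriv_F by (simp add: mult_ac del: mm_mult mm_mult_assoc)
  qed
  moreover have "of_int \<sigma> \<in> lau W"
    using const_closed[of "of_int \<sigma>"] by simp
  ultimately have "D (mm a b) \<in> lau W"
    unfolding uv using * by (auto intro!: S_closed uv_closed const_closed)
  then show ?case
    by (simp add: D_mult D_const) (intro S_closed const_closed)
qed

text \<open>Modulo \<open>F\<close> the product (1 - e u^N)(1 - e v^M) is t. The constants in
  \<open>\<alpha>\<close> and \<open>\<beta>\<close> are chosen so that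
  \<open>\<alpha> * D u\<close> becomes r v^M and \<open>\<beta> * D v\<close> becomes r u^N (1 - e
  v^M); their sum is r (u^N + v^M - e u^N v^M) = r e' = 1.\<close>

lemma unimodular: "\<alpha> * D u + \<beta> * D v - 1 = F * (const (r * t' * e) * v ^ M - const r)"
proof -
  have vM: "v * v ^ (M - 1) = v ^ M" and uN: "u * u ^ (N - 1) = u ^ N"
    using N_pos M_pos by (simp_all add: power_eq_if)
  have cm: "const m' * of_nat M = (1 :: 'a laurent)" and cn: "const n' * of_nat N = (1 :: 'a laurent)"
    using units by (simp_all flip: single_of_nat add: const_mult mult.commute)
  have prod: "(1 - const e * v ^ M) * (1 - const e * u ^ N) = const t + const e * F"
  proof -
    have "const t = 1 - const e * const e'"
      using e_e' by (simp add: const_mult single_diff)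
    then show ?thesis
      by (simp add: F_eq algebra_simps)
  qed
  have e'r: "const r * const e' = 1" and tt': "const t' * const t = 1"
    using const_mult[of e' r] const_mult[of t t'] units by (simp_all add: mult.commute)
  have "\<alpha> * D u = const (r * t') * (const m' * of_nat M) * (v * v ^ (M - 1))
      * ((1 - const e * v ^ M) * (1 - const e * u ^ N))"
    by (simp add: \<alpha>_def D_u mult_ac flip: const_mult)
  also have "\<dots> = const r * v ^ M * (const t' * const t) + const (r * t' * e) * v ^ M * F"
    unfolding cm vM prod by (simp add: algebra_simps flip: const_mult)
  finally have 1: "\<alpha> * D u = const r * v ^ M + const (r * t' * e) * v ^ M * F"
    by (simp add: tt')
  have "\<beta> * D v = const r * (const n' * of_nat N) * (u * u ^ (N - 1)) * (1 - const e * v ^ M)"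
    by (simp add: \<beta>_def D_v mult_ac flip: const_mult)
  also have "\<dots> = const r * u ^ N * (1 - const e * v ^ M)"
    unfolding cn uN by simp
  finally have 2: "\<beta> * D v = const r * u ^ N * (1 - const e * v ^ M)" .
  have 3: "const r * F = const r * (const e * u ^ N * v ^ M - u ^ N - v ^ M) + 1"
    unfolding F_eq using e'r by (simp add: algebra_simps)
  have "\<alpha> * D u + \<beta> * D v - 1 = F * (const (r * t' * e) * v ^ M) - const r * F"
    unfolding 1 2 3 by (simp add: algebra_simps)
  then show ?thesis
    by (simp add: algebra_simps)
qed

sublocale affine_chart "lau W" I const D u v \<alpha> \<beta> "const e" "const e'" N M
proof
  show "const a \<in> lau W" for a by (rule const_closed)
  show "D p \<in> lau W" if "p \<in> lau W" for p using that by (rule D_closed)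
  show "D p \<in> I" if "p \<in> I" for p
    using that D_closed by (auto simp: I_def D_F)
  show "u \<in> lau W" "v \<in> lau W" by (rule uv_closed)+
  show "\<alpha> \<in> lau W" "\<beta> \<in> lau W"
    unfolding \<alpha>_def \<beta>_def by (auto intro!: S_closed uv_closed const_closed)
  show "const e * u ^ N * v ^ M - u ^ N - v ^ M + const e' \<in> I"
    using F_I by (simp add: F_eq)
  show "\<alpha> * D u + \<beta> * D v - 1 \<in> I"
    unfolding unimodular I_def by (auto intro!: S_closed uv_closed const_closed)
  fix Z :: "'a laurent set"
  assume Z: "range const \<subseteq> Z" "u \<in> Z" "v \<in> Z"
    "\<And>p q. p \<in> Z \<Longrightarrow> q \<in> Z \<Longrightarrow> p + q \<in> Z" "\<And>p q. p \<in> Z \<Longrightarrow> q \<in> Z \<Longrightarrow> p * q \<in> Z"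
    "\<And>p q. p \<in> Z \<Longrightarrow> q \<in> lau W \<Longrightarrow> p * q = 1 \<Longrightarrow> q \<in> Z"
  have c: "const c \<in> Z" for c
    using Z(1) by auto
  have Z_power: "p ^ n \<in> Z" if "p \<in> Z" for p n
    using that c[of 1] by (induction n) (auto intro: Z(5))
  have "mm a b \<in> Z" if "W a b" for a b
  proof (cases "0 \<le> \<sigma> * a \<and> 0 \<le> \<sigma> * b")
    case True
    then have "mm a b = u ^ nat (\<sigma> * a) * v ^ nat (\<sigma> * b)"
      using \<sigma> by (auto simp: u_def v_def mm_power)
    then show ?thesis
      using Z Z_power by auto
  next
    case False
    then have "W (- \<sigma>) 0" "W 0 (- \<sigma>)"
      using W_generated[OF that] by auto
    then have inv: "mm (- \<sigma>) 0 \<in> Z" "mm 0 (- \<sigma>) \<in> Z"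
      using Z(6)[OF Z(2), of "mm (- \<sigma>) 0"] Z(6)[OF Z(3), of "mm 0 (- \<sigma>)"]
      by (auto simp: u_def v_def lau_mm)
    \<comment> \<open>For each coordinate at least one of the two truncated exponents is 0, so no
      case split is needed in the formula itself.\<close>
    have "mm a b = u ^ nat (\<sigma> * a) * mm (- \<sigma>) 0 ^ nat (- \<sigma> * a) * (v ^ nat (\<sigma> * b) * mm 0 (- \<sigma>) ^ nat (- \<sigma> * b))"
      using \<sigma> by (cases "0 \<le> a"; cases "0 \<le> b") (auto simp: u_def v_def mm_power)
    then show ?thesis
      using Z(2,3,5) Z_power inv by auto
  qed
  then show "lau W \<subseteq> Z"
    using Z(5)[OF c] by (auto elim!: lau_induct intro: Z(4) c[of 0, simplified])
qed (auto simp: D_add D_mult D_const D_u D_v)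

end

section \<open>Supports of multiples of the equation\<close>

text \<open>Breaking ties by \<open>g\<close> makes the maximal exponent a vertex of the Newton
  polygon rather than a point on an edge.\<close>

lemma lexicographic_max:
  fixes f g :: "'k \<Rightarrow> int"
  assumes "finite K" "K \<noteq> {}"
  obtains k where "k \<in> K" "\<And>l. l \<in> K \<Longrightarrow> f l \<le> f k" "\<And>l. l \<in> K \<Longrightarrow> f l = f k \<Longrightarrow> g l \<le> g k"
proof -
  have "Max (f ` K) \<in> f ` K"
    using assms by simp
  then obtain k0 where k0: "k0 \<in> K" "Max (f ` K) = f k0"
    by blast
  have k0_max: "f l \<le> f k0" if "l \<in> K" for l
    using assms that by (simp flip: k0(2))
  let ?K = "{l \<in> K. f l = f k0}"
  have "Max (g ` ?K) \<in> g ` ?K"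
    using assms k0 by (intro Max_in) auto
  then obtain k where k: "k \<in> ?K" "Max (g ` ?K) = g k"
    by blast
  have "g l \<le> g k" if "l \<in> ?K" for l
    using assms that by (simp flip: k(2))
  then show thesis
    using k0_max k(1) that by auto
qed

lemma coef_nonzero:
  assumes "q \<in> lau W" "q \<noteq> 0"
  shows "{(a, b). coef q a b \<noteq> 0} \<noteq> {}"
  using coef_eqI[OF assms(1) lau_zero[of W]] assms(2) by auto

locale corner =
  fixes N M :: nat and s :: "'a::comm_ring_1"
  assumes N_pos: "0 < N" and M_pos: "0 < M"
begin

abbreviation G where "G \<equiv> chart_form N M 1 1 s"

lemma coef_G_mult:
  "coef (G * q) a b = coef q (a - int N) (b - int M) - coef q (a - int N) b - coef q a (b - int M) + s * coef q a b"
proof -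
  have "G * q = mm (int N) (int M) * q - mm (int N) 0 * q - mm 0 (int M) * q + const s * q"
    by (simp add: chart_form_def algebra_simps)
  then show ?thesis
    by simp
qed

text \<open>
  The extremal points of the support of \<open>q\<close> at its lower right and upper left corners are moved by
  the corners $-x^N$ and $-y^M$ of the equation to points of the support of \<open>G * q\<close>.
\<close>

lemma right_bottom:
  assumes "q \<in> lau W" "q \<noteq> 0"
  obtains a b where "coef q a b \<noteq> 0" "\<And>c d. coef q c d \<noteq> 0 \<Longrightarrow> c \<le> a"
    "\<And>d. coef q a d \<noteq> 0 \<Longrightarrow> b \<le> d" "coef (G * q) (a + int N) b \<noteq> 0"
proof -
  obtain k where k: "k \<in> {(a, b). coef q a b \<noteq> 0}"
    "\<And>l. l \<in> {(a, b). coef q a b \<noteq> 0} \<Longrightarrow> fst l \<le> fst k"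
    "\<And>l. l \<in> {(a, b). coef q a b \<noteq> 0} \<Longrightarrow> fst l = fst k \<Longrightarrow> - snd l \<le> - snd k"
    using lexicographic_max[OF finite_coef coef_nonzero[OF assms], of fst "\<lambda>l. - snd l"] by blast
  obtain a b where ab: "k = (a, b)" by fastforce
  have 1: "coef q a b \<noteq> 0" "\<And>c d. coef q c d \<noteq> 0 \<Longrightarrow> c \<le> a" "\<And>d. coef q a d \<noteq> 0 \<Longrightarrow> b \<le> d"
    using k unfolding ab by fastforce+
  \<comment> \<open>These are the other three terms of \<open>coef_G_mult\<close> at the target
    point; they lie beyond the extremal one. The remaining term has coefficient -1, so zero divisors
    cannot kill it.\<close>
  have "coef q a (b - int M) = 0" "coef q (a + int N) (b - int M) = 0" "coef q (a + int N) b = 0"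
    using 1(2)[of "a + int N"] 1(3)[of "b - int M"] N_pos M_pos by force+
  then have "coef (G * q) (a + int N) b = - coef q a b"
    unfolding coef_G_mult by simp
  then show thesis
    using that 1 by auto
qed

text \<open>The same corner as in \<open>right_bottom\<close> with the opposite priority: here the
  lowest row decides first. The two points may differ, and each bounds the support in another
  direction.\<close>

lemma bottom_right:
  assumes "q \<in> lau W" "q \<noteq> 0"
  obtains a b where "coef q a b \<noteq> 0" "\<And>c d. coef q c d \<noteq> 0 \<Longrightarrow> b \<le> d"
    "\<And>c. coef q c b \<noteq> 0 \<Longrightarrow> c \<le> a" "coef (G * q) (a + int N) b \<noteq> 0"
proof -
  obtain k where k: "k \<in> {(a, b). coef q a b \<noteq> 0}"
    "\<And>l. l \<in> {(a, b). coef q a b \<noteq> 0} \<Longrightarrow> - snd l \<le> - snd k"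
    "\<And>l. l \<in> {(a, b). coef q a b \<noteq> 0} \<Longrightarrow> - snd l = - snd k \<Longrightarrow> fst l \<le> fst k"
    using lexicographic_max[OF finite_coef coef_nonzero[OF assms], of "\<lambda>l. - snd l" fst] by blast
  obtain a b where ab: "k = (a, b)" by fastforce
  have 1: "coef q a b \<noteq> 0" "\<And>c d. coef q c d \<noteq> 0 \<Longrightarrow> b \<le> d" "\<And>c. coef q c b \<noteq> 0 \<Longrightarrow> c \<le> a"
    using k unfolding ab by fastforce+
  have "coef q a (b - int M) = 0" "coef q (a + int N) (b - int M) = 0" "coef q (a + int N) b = 0"
    using 1(2)[of _ "b - int M"] 1(3)[of "a + int N"] N_pos M_pos by force+
  then have "coef (G * q) (a + int N) b = - coef q a b"
    unfolding coef_G_mult by simp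
  then show thesis
    using that 1 by auto
qed

lemma left_top:
  assumes "q \<in> lau W" "q \<noteq> 0"
  obtains a b where "coef q a b \<noteq> 0" "\<And>c d. coef q c d \<noteq> 0 \<Longrightarrow> a \<le> c"
    "\<And>d. coef q a d \<noteq> 0 \<Longrightarrow> d \<le> b" "coef (G * q) a (b + int M) \<noteq> 0"
proof -
  obtain k where k: "k \<in> {(a, b). coef q a b \<noteq> 0}"
    "\<And>l. l \<in> {(a, b). coef q a b \<noteq> 0} \<Longrightarrow> - fst l \<le> - fst k"
    "\<And>l. l \<in> {(a, b). coef q a b \<noteq> 0} \<Longrightarrow> - fst l = - fst k \<Longrightarrow> snd l \<le> snd k"
    using lexicographic_max[OF finite_coef coef_nonzero[OF assms], of "\<lambda>l. - fst l" snd] by blast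
  obtain a b where ab: "k = (a, b)" by fastforce
  have 1: "coef q a b \<noteq> 0" "\<And>c d. coef q c d \<noteq> 0 \<Longrightarrow> a \<le> c" "\<And>d. coef q a d \<noteq> 0 \<Longrightarrow> d \<le> b"
    using k unfolding ab by fastforce+
  have "coef q a (b + int M) = 0" "coef q (a - int N) (b + int M) = 0" "coef q (a - int N) b = 0"
    using 1(2)[of "a - int N"] 1(3)[of "b + int M"] N_pos M_pos by force+
  then have "coef (G * q) a (b + int M) = - coef q a b"
    unfolding coef_G_mult by simp
  then show thesis
    using that 1 by auto
qed

lemma top_left:
  assumes "q \<in> lau W" "q \<noteq> 0"
  obtains a b where "coef q a b \<noteq> 0" "\<And>c d. coef q c d \<noteq> 0 \<Longrightarrow> d \<le> b"
    "\<And>c. coef q c b \<noteq> 0 \<Longrightarrow> a \<le> c" "coef (G * q) a (b + int M) \<noteq> 0"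
proof -
  obtain k where k: "k \<in> {(a, b). coef q a b \<noteq> 0}"
    "\<And>l. l \<in> {(a, b). coef q a b \<noteq> 0} \<Longrightarrow> snd l \<le> snd k"
    "\<And>l. l \<in> {(a, b). coef q a b \<noteq> 0} \<Longrightarrow> snd l = snd k \<Longrightarrow> - fst l \<le> - fst k"
    using lexicographic_max[OF finite_coef coef_nonzero[OF assms], of snd "\<lambda>l. - fst l"] by blast
  obtain a b where ab: "k = (a, b)" by fastforce
  have 1: "coef q a b \<noteq> 0" "\<And>c d. coef q c d \<noteq> 0 \<Longrightarrow> d \<le> b" "\<And>c. coef q c b \<noteq> 0 \<Longrightarrow> a \<le> c"
    using k unfolding ab by fastforce+
  have "coef q a (b + int M) = 0" "coef q (a - int N) (b + int M) = 0" "coef q (a - int N) b = 0"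
    using 1(2)[of _ "b + int M"] 1(3)[of "a - int N"] N_pos M_pos by force+
  then have "coef (G * q) a (b + int M) = - coef q a b"
    unfolding coef_G_mult by simp
  then show thesis
    using that 1 by auto
qed

section \<open>Multiples of the equation with prescribed support\<close>

lemma G_mult_lau:
  assumes "q \<in> lau W"
    and "\<And>a b. W a b \<Longrightarrow> V a b" "\<And>a b. W a b \<Longrightarrow> V (a + int N) b"
    "\<And>a b. W a b \<Longrightarrow> V a (b + int M)" "\<And>a b. W a b \<Longrightarrow> V (a + int N) (b + int M)"
  shows "G * q \<in> lau V"
proof -
  have "G \<in> lau (\<lambda>a b. (a = 0 \<or> a = int N) \<and> (b = 0 \<or> b = int M))"
    unfolding chart_form_def by (intro lau_add lau_diff lau_monomial lau_mm lau_const) auto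
  then show ?thesis
    using assms(1) by (rule lau_mult) (use assms(2-) in \<open>auto simp: add.commute\<close>)
qed

text \<open>The corner -y^M keeps the leftmost column and the corner -x^N keeps the lowest row, so
  both stay visible in the product and must be nonnegative.\<close>

lemma mult_closed_first_quadrant:
  assumes q: "q \<in> lau everywhere" and Gq: "G * q \<in> lau (\<lambda>a b. 0 \<le> a \<and> 0 \<le> b)"
  shows "q \<in> lau (\<lambda>a b. 0 \<le> a \<and> 0 \<le> b)"
proof (cases "q = 0")
  case False
  note supp = lau_coefD[OF Gq]
  obtain a1 b1 where 1: "coef q a1 b1 \<noteq> 0" "\<And>c d. coef q c d \<noteq> 0 \<Longrightarrow> a1 \<le> c"
      "\<And>d. coef q a1 d \<noteq> 0 \<Longrightarrow> d \<le> b1" "coef (G * q) a1 (b1 + int M) \<noteq> 0"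
    by (fact left_top[OF q False])
  obtain a2 b2 where 2: "coef q a2 b2 \<noteq> 0" "\<And>c d. coef q c d \<noteq> 0 \<Longrightarrow> b2 \<le> d"
      "\<And>c. coef q c b2 \<noteq> 0 \<Longrightarrow> c \<le> a2" "coef (G * q) (a2 + int N) b2 \<noteq> 0"
    by (fact bottom_right[OF q False])
  have "0 \<le> c \<and> 0 \<le> d" if "coef q c d \<noteq> 0" for c d
    using 1(2)[OF that] supp[OF 1(4)] 2(2)[OF that] supp[OF 2(4)] by linarith
  then show ?thesis
    by (rule lau_coefI[OF q])
qed simp

text \<open>Now the extremal column and row are shifted by N and M before they are compared with 0,
  whence the sharper bounds on \<open>q\<close>.\<close>

lemma mult_closed_third_quadrant:
  assumes q: "q \<in> lau everywhere" and Gq: "G * q \<in> lau (\<lambda>a b. a \<le> 0 \<and> b \<le> 0)"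
  shows "q \<in> lau (\<lambda>a b. a \<le> - int N \<and> b \<le> - int M)"
proof (cases "q = 0")
  case False
  note supp = lau_coefD[OF Gq]
  obtain a1 b1 where 1: "coef q a1 b1 \<noteq> 0" "\<And>c d. coef q c d \<noteq> 0 \<Longrightarrow> c \<le> a1"
      "\<And>d. coef q a1 d \<noteq> 0 \<Longrightarrow> b1 \<le> d" "coef (G * q) (a1 + int N) b1 \<noteq> 0"
    by (fact right_bottom[OF q False])
  obtain a2 b2 where 2: "coef q a2 b2 \<noteq> 0" "\<And>c d. coef q c d \<noteq> 0 \<Longrightarrow> d \<le> b2"
      "\<And>c. coef q c b2 \<noteq> 0 \<Longrightarrow> a2 \<le> c" "coef (G * q) a2 (b2 + int M) \<noteq> 0"
    by (fact top_left[OF q False])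
  have "c \<le> - int N \<and> d \<le> - int M" if "coef q c d \<noteq> 0" for c d
    using 1(2)[OF that] supp[OF 1(4)] 2(2)[OF that] supp[OF 2(4)] by linarith
  then show ?thesis
    by (rule lau_coefI[OF q])
qed simp

text \<open>Removing from \<open>q\<close> its part in \<open>W\<close> changes the product only
  within the allowed region, and what remains vanishes by \<open>zero\<close>. Exponents common to
  \<open>W0\<close> and \<open>W1\<close> are assigned to the first piece.\<close>

lemma split_outside_zero:
  assumes q: "q \<in> lau everywhere" and Gq: "G * q \<in> lau V"
    and W: "\<And>a b. W a b \<longleftrightarrow> W0 a b \<or> W1 a b"
    and G0: "\<And>q. q \<in> lau W \<Longrightarrow> G * q \<in> lau V"
    and zero: "\<And>q. q \<in> lau (\<lambda>a b. \<not> W a b) \<Longrightarrow> G * q \<in> lau V \<Longrightarrow> q = 0"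
  obtains q0 q1 where "q = q0 + q1" "q0 \<in> lau W0" "q1 \<in> lau W1"
proof -
  have mem: "restr Z q \<in> lau Z" for Z
    using lau_restr[OF q, of Z] by (rule lau_mono) auto
  have "G * (q - restr W q) \<in> lau V"
    using lau_diff[OF Gq G0[OF mem]] by (simp add: algebra_simps)
  moreover have "q - restr W q \<in> lau (\<lambda>a b. \<not> W a b)"
    by (rule lau_coefI[OF lau_diff[OF q lau_mono[OF mem]]]) (auto split: if_splits)
  ultimately have "q - restr W q = 0"
    by (rule zero[rotated])
  moreover have "restr W q = restr W0 q + restr (\<lambda>a b. W1 a b \<and> \<not> W0 a b) q"
    by (rule coef_eqI[of _ everywhere _ everywhere])
       (auto intro!: lau_add lau_mono[OF mem] simp: W)
  ultimately show thesis
    using that[of "restr W0 q" "restr (\<lambda>a b. W1 a b \<and> \<not> W0 a b) q"] mem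
    by (auto intro!: lau_mono[OF mem])
qed

text \<open>The right-bottom point forces all columns to be negative, then the top-left point forces
  all rows to be negative. The left-top point is now carried into the third quadrant, so its row is
  at most -M and hence its column exceeds -N. All columns then exceed -N, so the bottom-right point
  is carried into the rectangle and every row is at least 1 - M, a contradiction.\<close>

lemma functions_split_zero:
  assumes q: "q \<in> lau (\<lambda>a b. \<not> (0 \<le> a \<and> 0 \<le> b \<or> a \<le> - int N \<and> b \<le> - int M))"
    and Gq: "G * q \<in> lau (\<lambda>a b. 0 \<le> a \<and> 0 \<le> b \<or> a \<le> 0 \<and> b \<le> 0 \<or>
      1 \<le> a \<and> a \<le> int N - 1 \<and> 1 - int M \<le> b \<and> b \<le> - 1)" (is "_ \<in> lau ?V")
  shows "q = 0"
proof -
  have supp: "coef q a b \<noteq> 0 \<Longrightarrow> (a < 0 \<or> b < 0) \<and> (- int N < a \<or> - int M < b)" for a b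
    using lau_coefD[OF q, of a b] by auto
  note V = lau_coefD[OF Gq]
  show ?thesis
  proof (rule ccontr)
    assume nz: "q \<noteq> 0"
    obtain a1 b1 where 1: "coef q a1 b1 \<noteq> 0" "\<And>c d. coef q c d \<noteq> 0 \<Longrightarrow> c \<le> a1"
      "\<And>d. coef q a1 d \<noteq> 0 \<Longrightarrow> b1 \<le> d" "coef (G * q) (a1 + int N) b1 \<noteq> 0"
    by (fact right_bottom[OF q nz])
    have a: "c < 0" if "coef q c d \<noteq> 0" for c d
      using 1(2)[OF that] supp[OF 1(1)] V[OF 1(4)] N_pos by linarith
    obtain a2 b2 where 2: "coef q a2 b2 \<noteq> 0" "\<And>c d. coef q c d \<noteq> 0 \<Longrightarrow> d \<le> b2"
      "\<And>c. coef q c b2 \<noteq> 0 \<Longrightarrow> a2 \<le> c" "coef (G * q) a2 (b2 + int M) \<noteq> 0"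
    by (fact top_left[OF q nz])
    have b: "d < 0" if "coef q c d \<noteq> 0" for c d
      using 2(2)[OF that] supp[OF 2(1)] V[OF 2(4)] M_pos a[OF 2(1)] by linarith
    obtain a3 b3 where 3: "coef q a3 b3 \<noteq> 0" "\<And>c d. coef q c d \<noteq> 0 \<Longrightarrow> a3 \<le> c"
      "\<And>d. coef q a3 d \<noteq> 0 \<Longrightarrow> d \<le> b3" "coef (G * q) a3 (b3 + int M) \<noteq> 0"
    by (fact left_top[OF q nz])
    obtain a4 b4 where 4: "coef q a4 b4 \<noteq> 0" "\<And>c d. coef q c d \<noteq> 0 \<Longrightarrow> b4 \<le> d"
      "\<And>c. coef q c b4 \<noteq> 0 \<Longrightarrow> c \<le> a4" "coef (G * q) (a4 + int N) b4 \<noteq> 0"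
    by (fact bottom_right[OF q nz])
    have "b3 \<le> - int M"
      using V[OF 3(4)] a[OF 3(1)] by linarith
    then have "- int N < a3"
      using supp[OF 3(1)] by linarith
    then have "- int N < a4"
      using 3(2)[OF 4(1)] by linarith
    then have "1 - int M \<le> b4"
      using V[OF 4(4)] b[OF 4(1)] by linarith
    then show False
      using 4(2)[OF 3(1)] \<open>b3 \<le> - int M\<close> by linarith
  qed
qed

text \<open>The pieces \<open>q0\<close> and \<open>q1\<close> are cofactors whose multiples of the
  equation can be absorbed by functions on U0 and on U1 respectively.\<close>

lemma functions_split:
  assumes q: "q \<in> lau everywhere" and Gq: "G * q \<in> lau (\<lambda>a b. 0 \<le> a \<and> 0 \<le> b \<or> a \<le> 0 \<and> b \<le> 0 \<or>
      1 \<le> a \<and> a \<le> int N - 1 \<and> 1 - int M \<le> b \<and> b \<le> - 1)" (is "_ \<in> lau ?V")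
  obtains q0 q1 where "q = q0 + q1" "q0 \<in> lau (\<lambda>a b. 0 \<le> a \<and> 0 \<le> b)" "q1 \<in> lau (\<lambda>a b. a \<le> - int N \<and> b \<le> - int M)"
proof -
  have "G * p \<in> lau ?V" if "p \<in> lau (\<lambda>a b. 0 \<le> a \<and> 0 \<le> b \<or> a \<le> - int N \<and> b \<le> - int M)" for p
    using that by (rule G_mult_lau) auto
  from split_outside_zero[where W = "\<lambda>a b. 0 \<le> a \<and> 0 \<le> b \<or> a \<le> - int N \<and> b \<le> - int M"
      and ?W0.0 = "\<lambda>a b. 0 \<le> a \<and> 0 \<le> b" and ?W1.0 = "\<lambda>a b. a \<le> - int N \<and> b \<le> - int M", OF q Gq refl this functions_split_zero]
  show thesis
    using that by blast
qed

text \<open>The right-bottom point makes all columns negative; then the left-top point has row at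
  most -2, which leaves only the column -1. Its lowest point is carried to column N - 1, where the
  allowed region requires a nonnegative row.\<close>

lemma forms_split_zero:
  assumes q: "q \<in> lau (\<lambda>a b. \<not> (0 \<le> a \<and> 0 \<le> b \<or> a \<le> - 2 \<and> b \<le> - 2))"
    and Gq: "G * q \<in> lau (\<lambda>a b. 0 \<le> a \<and> 0 \<le> b \<or> a \<le> int N - 2 \<and> b \<le> int M - 2)" (is "_ \<in> lau ?V")
  shows "q = 0"
proof -
  have supp: "coef q a b \<noteq> 0 \<Longrightarrow> (a < 0 \<or> b < 0) \<and> (- 2 < a \<or> - 2 < b)" for a b
    using lau_coefD[OF q, of a b] by auto
  note V = lau_coefD[OF Gq]
  show ?thesis
  proof (rule ccontr)
    assume nz: "q \<noteq> 0"
    obtain a1 b1 where 1: "coef q a1 b1 \<noteq> 0" "\<And>c d. coef q c d \<noteq> 0 \<Longrightarrow> c \<le> a1"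
      "\<And>d. coef q a1 d \<noteq> 0 \<Longrightarrow> b1 \<le> d" "coef (G * q) (a1 + int N) b1 \<noteq> 0"
    by (fact right_bottom[OF q nz])
    obtain a2 b2 where 2: "coef q a2 b2 \<noteq> 0" "\<And>c d. coef q c d \<noteq> 0 \<Longrightarrow> a2 \<le> c"
      "\<And>d. coef q a2 d \<noteq> 0 \<Longrightarrow> d \<le> b2" "coef (G * q) a2 (b2 + int M) \<noteq> 0"
    by (fact left_top[OF q nz])
    have "a1 < 0"
      using supp[OF 1(1)] V[OF 1(4)] N_pos by linarith
    then have "a2 < 0"
      using 1(2)[OF 2(1)] by linarith
    then have "b2 \<le> - 2"
      using V[OF 2(4)] \<open>a2 < 0\<close> by linarith
    then have "a2 = a1" "a1 = - 1"
      using supp[OF 2(1)] 2(2)[OF 1(1)] \<open>a1 < 0\<close> \<open>a2 < 0\<close> by linarith+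
    then show False
      using V[OF 1(4)] 1(3)[of b2] 2(1) \<open>b2 \<le> - 2\<close> by auto
  qed
qed

lemma forms_split:
  assumes q: "q \<in> lau everywhere" and Gq: "G * q \<in> lau (\<lambda>a b. 0 \<le> a \<and> 0 \<le> b \<or> a \<le> int N - 2 \<and> b \<le> int M - 2)" (is "_ \<in> lau ?V")
  obtains q0 q1 where "q = q0 + q1" "q0 \<in> lau (\<lambda>a b. 0 \<le> a \<and> 0 \<le> b)" "q1 \<in> lau (\<lambda>a b. a \<le> - 2 \<and> b \<le> - 2)"
proof -
  have "G * p \<in> lau ?V" if "p \<in> lau (\<lambda>a b. 0 \<le> a \<and> 0 \<le> b \<or> a \<le> - 2 \<and> b \<le> - 2)" for p
    using that by (rule G_mult_lau) auto
  from split_outside_zero[where W = "\<lambda>a b. 0 \<le> a \<and> 0 \<le> b \<or> a \<le> - 2 \<and> b \<le> - 2"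
      and ?W0.0 = "\<lambda>a b. 0 \<le> a \<and> 0 \<le> b" and ?W1.0 = "\<lambda>a b. a \<le> - 2 \<and> b \<le> - 2", OF q Gq refl this forms_split_zero]
  show thesis
    using that by blast
qed

section \<open>The first cohomology of the structure sheaf\<close>

text \<open>The exponents of x^i y^(j-M) for 0 < i < N and 0 < j < M, the function components of the
  etas.\<close>

definition rectangle :: "int \<Rightarrow> int \<Rightarrow> bool" where
  "rectangle a b \<longleftrightarrow> 1 \<le> a \<and> a \<le> int N - 1 \<and> 1 - int M \<le> b \<and> b \<le> - 1"

definition cech_split :: "'a laurent \<Rightarrow> bool" where
  "cech_split p \<longleftrightarrow> (\<exists>u0 u1 r q. u0 \<in> lau (\<lambda>a b. 0 \<le> a \<and> 0 \<le> b) \<and> u1 \<in> lau (\<lambda>a b. a \<le> 0 \<and> b \<le> 0) \<and>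
    r \<in> lau rectangle \<and> q \<in> lau everywhere \<and> p = u1 - u0 + r + G * q)"

lemma cech_splitI:
  "u0 \<in> lau (\<lambda>a b. 0 \<le> a \<and> 0 \<le> b) \<Longrightarrow> u1 \<in> lau (\<lambda>a b. a \<le> 0 \<and> b \<le> 0) \<Longrightarrow>
    r \<in> lau rectangle \<Longrightarrow> q \<in> lau everywhere \<Longrightarrow> p = u1 - u0 + r + G * q \<Longrightarrow> cech_split p"
  unfolding cech_split_def by blast

lemma cech_split_add:
  assumes "cech_split p" "cech_split p'"
  shows "cech_split (p + p')"
proof -
  obtain u0 u1 r q where 1: "u0 \<in> lau (\<lambda>a b. 0 \<le> a \<and> 0 \<le> b)" "u1 \<in> lau (\<lambda>a b. a \<le> 0 \<and> b \<le> 0)"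
    "r \<in> lau rectangle" "q \<in> lau everywhere" "p = u1 - u0 + r + G * q"
    using assms unfolding cech_split_def by auto
  obtain u0' u1' r' q' where 2: "u0' \<in> lau (\<lambda>a b. 0 \<le> a \<and> 0 \<le> b)" "u1' \<in> lau (\<lambda>a b. a \<le> 0 \<and> b \<le> 0)"
    "r' \<in> lau rectangle" "q' \<in> lau everywhere" "p' = u1' - u0' + r' + G * q'"
    using assms unfolding cech_split_def by auto
  have "p + p' = (u1 + u1') - (u0 + u0') + (r + r') + G * (q + q')"
    unfolding 1(5) 2(5) by (simp add: algebra_simps)
  with 1(1-4) 2(1-4) show ?thesis
    by (intro cech_splitI[of "u0 + u0'" "u1 + u1'" "r + r'" "q + q'"]) (simp_all add: lau_add)
qed

lemma cech_split_const:
  assumes "cech_split p"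
  shows "cech_split (const c * p)"
proof -
  have c: "const c * q \<in> lau W" if "q \<in> lau W" for q W
    by (rule lau_mult[OF lau_const[of "\<lambda>a b. a = 0 \<and> b = 0"] that]) auto
  obtain u0 u1 r q where 1: "u0 \<in> lau (\<lambda>a b. 0 \<le> a \<and> 0 \<le> b)" "u1 \<in> lau (\<lambda>a b. a \<le> 0 \<and> b \<le> 0)"
    "r \<in> lau rectangle" "q \<in> lau everywhere" "p = u1 - u0 + r + G * q"
    using assms unfolding cech_split_def by auto
  have "const c * p = const c * u1 - const c * u0 + const c * r + G * (const c * q)"
    unfolding 1(5) by (simp add: algebra_simps)
  with 1(1-4) show ?thesis
    by (intro cech_splitI[of "const c * u0" "const c * u1" "const c * r" "const c * q"]) (simp_all add: c)
qed

lemma cech_split_base: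
  assumes "0 \<le> a \<and> 0 \<le> b \<or> a \<le> 0 \<and> b \<le> 0 \<or> rectangle a b"
  shows "cech_split (mm a b)"
  using assms
proof (elim disjE)
  assume "0 \<le> a \<and> 0 \<le> b"
  then show ?thesis
    by (intro cech_splitI[of "- mm a b" 0 0 0]) (auto intro: lau_uminus lau_mm)
next
  assume "a \<le> 0 \<and> b \<le> 0"
  then show ?thesis
    by (intro cech_splitI[of 0 "mm a b" 0 0]) (auto intro: lau_uminus lau_mm)
next
  assume "rectangle a b"
  then show ?thesis
    by (intro cech_splitI[of 0 0 "mm a b" 0]) (auto intro: lau_uminus lau_mm)
qed

lemma cech_split_multiple: "q \<in> lau everywhere \<Longrightarrow> cech_split (G * q)"
  by (rule cech_splitI[of 0 0 0 q]) auto

text \<open>Solve the multiple of the equation by x^(a-N) y^b for the term of the corner -x^N, and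
  the one by x^a y^(b-M) for the term of the corner -y^M. No division occurs, as these corners have
  coefficient -1.\<close>

lemma cech_split_reduce:
  "cech_split (mm a (b + int M)) \<Longrightarrow> cech_split (mm (a - int N) (b + int M)) \<Longrightarrow>
    cech_split (mm (a - int N) b) \<Longrightarrow> cech_split (mm a b)"
  "cech_split (mm (a + int N) b) \<Longrightarrow> cech_split (mm (a + int N) (b - int M)) \<Longrightarrow>
    cech_split (mm a (b - int M)) \<Longrightarrow> cech_split (mm a b)"
proof -
  assume 1: "cech_split (mm a (b + int M))" "cech_split (mm (a - int N) (b + int M))"
    "cech_split (mm (a - int N) b)"
  have "mm a b = mm a (b + int M) + const (- 1) * mm (a - int N) (b + int M) + const s * mm (a - int N) b
      + const (- 1) * (G * mm (a - int N) b)"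
    by (simp add: chart_form_def single_uminus algebra_simps)
  then show "cech_split (mm a b)"
    using 1 cech_split_multiple[of "mm (a - int N) b"]
    by (auto intro!: cech_split_add cech_split_const lau_mm)
next
  assume 1: "cech_split (mm (a + int N) b)" "cech_split (mm (a + int N) (b - int M))"
    "cech_split (mm a (b - int M))"
  have "mm a b = mm (a + int N) b + const (- 1) * mm (a + int N) (b - int M) + const s * mm a (b - int M)
      + const (- 1) * (G * mm a (b - int M))"
    by (simp add: chart_form_def single_uminus algebra_simps)
  then show "cech_split (mm a b)"
    using 1 cech_split_multiple[of "mm a (b - int M)"]
    by (auto intro!: cech_split_add cech_split_const lau_mm)
qed

lemma cech_split_fourth_quadrant:
  assumes "0 \<le> a" "b \<le> 0"
  shows "cech_split (mm a b)"
  using assms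
proof (induction "nat (a - b)" arbitrary: a b rule: less_induct)
  case less
  have IH: "0 \<le> c \<Longrightarrow> 0 \<le> d \<Longrightarrow> cech_split (mm c d)" "c \<le> 0 \<Longrightarrow> d \<le> 0 \<Longrightarrow> cech_split (mm c d)"
    "0 \<le> c \<Longrightarrow> d \<le> 0 \<Longrightarrow> c - d < a - b \<Longrightarrow> cech_split (mm c d)" for c d
    using cech_split_base[of c d] less.hyps[of c d] less.prems by auto
  show ?case
  proof (cases "a = 0 \<or> b = 0 \<or> rectangle a b")
    case True
    then show ?thesis using less.prems by (intro cech_split_base) auto
  next
    case False
    then have ab: "int N \<le> a \<or> b \<le> - int M" "0 < a" "b < 0"
      using less.prems unfolding rectangle_def by linarith+
    show ?thesis
    proof (rule cech_split_reduce(1))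
      show "cech_split (mm a (b + int M))"
        using IH(1,3)[of a "b + int M"] ab M_pos by (cases "0 \<le> b + int M") auto
      show "cech_split (mm (a - int N) b)"
        using IH(2,3)[of "a - int N" b] ab N_pos by (cases "0 \<le> a - int N") auto
      \<comment> \<open>Outside the rectangle a is at least N or b is at most -M, so the diagonal
        shift cannot jump into the open second quadrant.\<close>
      show "cech_split (mm (a - int N) (b + int M))"
        using IH[of "a - int N" "b + int M"] ab N_pos M_pos
        by (cases "0 \<le> a - int N"; cases "0 \<le> b + int M") auto
    qed
  qed
qed

text \<open>A diagonal shift may overshoot into the fourth quadrant, which is already settled; hence
  no exponents other than those on the axes need an exception.\<close>

lemma cech_split_second_quadrant:
  assumes "a \<le> 0" "0 \<le> b"
  shows "cech_split (mm a b)"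
  using assms
proof (induction "nat (b - a)" arbitrary: a b rule: less_induct)
  case less
  have IH: "0 \<le> c \<Longrightarrow> 0 \<le> d \<Longrightarrow> cech_split (mm c d)" "c \<le> 0 \<Longrightarrow> d \<le> 0 \<Longrightarrow> cech_split (mm c d)"
    "0 \<le> c \<Longrightarrow> d \<le> 0 \<Longrightarrow> cech_split (mm c d)"
    "c \<le> 0 \<Longrightarrow> 0 \<le> d \<Longrightarrow> d - c < b - a \<Longrightarrow> cech_split (mm c d)" for c d
    using cech_split_base[of c d] cech_split_fourth_quadrant[of c d] less.hyps[of d c] less.prems by auto
  show ?case
  proof (cases "a = 0 \<or> b = 0")
    case True
    then show ?thesis using less.prems by (intro cech_split_base) auto
  next
    case False
    then have ab: "a < 0" "0 < b"
      using less.prems by auto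
    show ?thesis
    proof (rule cech_split_reduce(2))
      show "cech_split (mm (a + int N) b)"
        using IH(1,4)[of "a + int N" b] ab N_pos by (cases "0 \<le> a + int N") auto
      show "cech_split (mm a (b - int M))"
        using IH(2,4)[of a "b - int M"] ab M_pos by (cases "0 \<le> b - int M") auto
      show "cech_split (mm (a + int N) (b - int M))"
        using IH[of "a + int N" "b - int M"] ab N_pos M_pos
        by (cases "0 \<le> a + int N"; cases "0 \<le> b - int M") auto
    qed
  qed
qed

lemma cech_split_all:
  assumes "p \<in> lau everywhere"
  shows "cech_split p"
  using assms
proof (induction p rule: lau_induct)
  case zero
  then show ?case using cech_split_multiple[of 0] by simp
next
  case (monomial a b c)
  have "0 \<le> a \<and> 0 \<le> b \<or> a \<le> 0 \<and> b \<le> 0 \<or> a \<le> 0 \<and> 0 \<le> b \<or> 0 \<le> a \<and> b \<le> 0"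
    by linarith
  then have "cech_split (mm a b)"
    using cech_split_base cech_split_fourth_quadrant cech_split_second_quadrant by blast
  then show ?case by (rule cech_split_const)
qed (rule cech_split_add)

end

section \<open>The rings of functions\<close>

definition first_quadrant :: "int \<Rightarrow> int \<Rightarrow> bool" where "first_quadrant a b \<longleftrightarrow> 0 \<le> a \<and> 0 \<le> b"
definition third_quadrant :: "int \<Rightarrow> int \<Rightarrow> bool" where "third_quadrant a b \<longleftrightarrow> a \<le> 0 \<and> b \<le> 0"

lemma lau_eq_carrier:
  assumes "U \<inter> bidegree0 = {(- a, a, - b, b) | a b. W a b}"
  shows "carrier (ambient U) = (lau W :: 'a::comm_ring_1 laurent set)"
  by (simp add: ambient_def lau_def assms)

lemma ambient_eq:
  assumes "U \<inter> bidegree0 = {(- a, a, - b, b) | a b. W a b}"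
  shows "ambient U = ring_of_type_algebra\<lparr>carrier := (lau W :: 'a::comm_ring_1 laurent set)\<rparr>"
  by (simp add: ambient_def lau_def assms)

lemma bidegree0_pieces:
  "U0 \<inter> bidegree0 = {(- a, a, - b, b) | a b. first_quadrant a b}"
  "U1 \<inter> bidegree0 = {(- a, a, - b, b) | a b. third_quadrant a b}"
  "U01 \<inter> bidegree0 = {(- a, a, - b, b) | a b. everywhere a b}"
  by (auto simp: U0_def U1_def U01_def bidegree0_def first_quadrant_def third_quadrant_def)

definition bidegree0_part :: "'a::comm_ring_1 laurent \<Rightarrow> 'a laurent" where
  "bidegree0_part p = weigh (\<lambda>k. if k \<in> bidegree0 then 1 else 0) p"

text \<open>Multiplication by a polynomial of bidegree zero preserves bidegrees, so it commutes with
  the projection.\<close>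

lemma bidegree0_part_mult:
  assumes "p \<in> lau W"
  shows "bidegree0_part (p * q) = p * bidegree0_part q"
  using assms
proof (induction p rule: lau_induct)
  case (monomial a b c)
  have *: "(a0 - a, a1 + a, b0 - b, b1 + b) \<in> bidegree0 \<longleftrightarrow> (a0, a1, b0, b1) \<in> bidegree0" for a0 a1 b0 b1
    by (auto simp: bidegree0_def)
  show ?case
    using subset_UNIV unfolding const_mm
    by (induction q rule: poly_mapping_support_induct)
       (auto simp: bidegree0_part_def mult_single * algebra_simps)
qed (auto simp: bidegree0_part_def algebra_simps)

text \<open>The cofactor in \<open>curve_ideal\<close> may have any bidegree. The unit monomial with
  exponent \<open>k\<close> relates the homogeneous form to its dehomogenisation \<open>H\<close>;
  once it is moved into the cofactor, projection to bidegree zero leaves the product unchanged.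
  Conversely the cofactor is divided by that monomial, and \<open>shift\<close> says that neither
  operation leaves \<open>U\<close>.\<close>

lemma curve_ideal_eq:
  assumes U: "U \<inter> bidegree0 = {(- a, a, - b, b) | a b. W a b}"
    and form: "curve_form N M t = Poly_Mapping.single k 1 * H" "H \<in> lau V"
    and shift: "\<And>l. l + k \<in> U \<longleftrightarrow> l \<in> U"
    and closed: "\<And>q. q \<in> lau W \<Longrightarrow> H * q \<in> lau W"
  shows "curve_ideal N M t U = {H * q | q. q \<in> lau W}"
proof (intro equalityI subsetI)
  fix p assume "p \<in> curve_ideal N M t U"
  then obtain q where q: "p = curve_form N M t * q" "Poly_Mapping.keys q \<subseteq> U" and p: "p \<in> lau W"
    using lau_eq_carrier[OF U] by (auto simp: curve_ideal_def)
  define r where "r = bidegree0_part (Poly_Mapping.single k 1 * q)"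
  have "Poly_Mapping.keys p \<subseteq> bidegree0"
    using p unfolding lau_def U[symmetric] by simp
  then have "bidegree0_part p = p"
    by (intro poly_mapping_eqI) (auto simp: bidegree0_part_def in_keys_iff subset_iff)
  moreover have "p = H * (Poly_Mapping.single k 1 * q)"
    using q form by (simp add: mult_ac)
  ultimately have "p = H * r"
    using bidegree0_part_mult[OF form(2)] by (simp add: r_def)
  moreover have "Poly_Mapping.keys r \<subseteq> U \<inter> bidegree0"
  proof
    fix l assume "l \<in> Poly_Mapping.keys r"
    then have "l \<in> bidegree0" "l - k \<in> Poly_Mapping.keys q"
      by (auto simp: r_def bidegree0_part_def in_keys_iff lookup_single_mult split: if_splits)
    then show "l \<in> U \<inter> bidegree0"
      using q(2) shift[of "l - k"] by auto
  qed
  ultimately show "p \<in> {H * q | q. q \<in> lau W}"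
    unfolding U by (auto simp: lau_def)
next
  fix p assume "p \<in> {H * q | q. q \<in> lau W}"
  then obtain q where q: "p = H * q" "q \<in> lau W" by blast
  define r where "r = Poly_Mapping.single (- k) 1 * q"
  have "p = curve_form N M t * r"
    by (simp add: form q r_def mult_ac mult_single flip: mult.assoc[of "Poly_Mapping.single k 1"])
  moreover have "Poly_Mapping.keys r \<subseteq> U"
  proof
    fix l assume "l \<in> Poly_Mapping.keys r"
    then have "l + k \<in> Poly_Mapping.keys q"
      by (auto simp: r_def in_keys_iff lookup_single_mult)
    then have "l + k \<in> U"
      using q(2) unfolding lau_def U[symmetric] by auto
    then show "l \<in> U"
      by (simp add: shift)
  qed
  ultimately show "p \<in> curve_ideal N M t U"
    using closed[OF q(2)] q(1) lau_eq_carrier[OF U] by (auto simp: curve_ideal_def)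
qed

lemma mon_power: "(mon a b c d :: 'a::comm_ring_1 laurent) ^ n = mon (int n * a) (int n * b) (int n * c) (int n * d)"
  by (induction n) (auto simp: mult_single algebra_simps simp flip: zero_prod_def)

lemma curve_form_eq:
  "curve_form N M t = mon (int N) 0 (int M) 0 * chart_form N M 1 1 (1 - t)"
  "curve_form N M t = mon 0 (int N) 0 (int M) * chart_form N M (- 1) (1 - t) 1"
  unfolding curve_form_def chart_form_def X0_def X1_def Y0_def Y1_def mm_def
  by (simp_all add: mon_power mult_single algebra_simps single_diff flip: single_add)

section \<open>The de Rham complex of the curve\<close>

type_synonym 'c triple = "'c laurent \<times> 'c laurent \<times> 'c laurent"

locale fermat_curve =
  fixes N M :: nat and t t' s' n' m' :: "'a::comm_ring_1"
  assumes N2: "2 \<le> N" and M2: "2 \<le> M"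
    and t_unit: "t * t' = 1" and s_unit: "(1 - t) * s' = 1"
    and N_unit: "of_nat N * n' = 1" and M_unit: "of_nat M * m' = 1"
begin

sublocale corner N M "1 - t"
  using N2 M2 by unfold_locales auto

sublocale C0: monomial_chart N M t t' n' m' 1 "1 - t" s' 1 first_quadrant
  using N2 M2 t_unit s_unit N_unit M_unit
  by unfold_locales (auto simp: first_quadrant_def)

sublocale C1: monomial_chart N M t t' n' m' "1 - t" 1 1 "- 1" third_quadrant
  using N2 M2 t_unit s_unit N_unit M_unit
  by unfold_locales (auto simp: third_quadrant_def)

sublocale C01: monomial_chart N M t t' n' m' 1 "1 - t" s' 1 everywhere
  using N2 M2 t_unit s_unit N_unit M_unit
  by unfold_locales auto

definition c1 :: "'a laurent" where "c1 = mm (int N - 2) (int M - 2)"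

lemma everywhere_mm [simp]: "mm a b \<in> lau everywhere"
  by (rule lau_mm) simp

lemma to_everywhere: "p \<in> lau W \<Longrightarrow> p \<in> lau everywhere"
  by (rule lau_mono) auto

lemma lau_subset_everywhere: "lau W \<subseteq> lau everywhere"
  using to_everywhere by (rule subsetI)

lemma C0_F: "C0.F = G" and C01_F: "C01.F = G"
  by (simp_all add: C0.F_def C01.F_def)

lemma C1_F: "G = mm (int N) (int M) * C1.F"
  by (simp add: C1.F_def chart_form_def algebra_simps single_diff)

lemma I0_subset: "C0.I \<subseteq> C01.I"
  unfolding C0.I_def C01.I_def C0_F C01_F using to_everywhere by blast

lemma I1_subset: "C1.I \<subseteq> C01.I"
proof
  fix p assume "p \<in> C1.I"
  then obtain q where "p = C1.F * q" "q \<in> lau third_quadrant"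
    by (auto simp: C1.I_def)
  then have "p = C01.F * (mm (- int N) (- int M) * q)" "mm (- int N) (- int M) * q \<in> lau everywhere"
    by (auto simp: C01_F C1_F mult_ac intro: C01.S_mult to_everywhere)
  then show "p \<in> C01.I"
    unfolding C01.I_def by blast
qed

lemma multiple_I01: "q \<in> lau everywhere \<Longrightarrow> G * q \<in> C01.I"
  unfolding C01.I_def C01_F by blast

lemma G_expand: "G = mm (int N) (int M) - mm (int N) 0 - mm 0 (int M) + const (1 - t)"
  by (simp add: chart_form_def)

section \<open>Comparison of the vector fields on the overlap\<close>

lemma D_monomial:
  "C01.D (mm a b) = mm (a - 1) (b - 1) * (of_int b * (of_nat N * (mm (int N) (int M) - mm (int N) 0))
    - of_int a * (of_nat M * (mm (int N) (int M) - mm 0 (int M))))"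
proof -
  have "C01.D (mm a b) = mm (- 1) (- 1) * mm a b * (of_int b * x_deriv C01.F - of_int a * y_deriv C01.F)"
    unfolding C01.D_def by (simp add: algebra_simps del: mm_mult mm_mult_assoc)
  also have "mm (- 1) (- 1) * mm a b = (mm (a - 1) (b - 1) :: 'a laurent)"
    by (simp add: algebra_simps)
  finally have *: "C01.D (mm a b) = mm (a - 1) (b - 1) * (of_int b * x_deriv C01.F - of_int a * y_deriv C01.F)" .
  have "x_deriv C01.F = of_nat N * (mm (int N) (int M) - mm (int N) 0)"
    "y_deriv C01.F = of_nat M * (mm (int N) (int M) - mm 0 (int M))"
    unfolding C01.x_deriv_F C01.y_deriv_F
    by (simp_all add: C01.u_def C01.v_def mm_power algebra_simps)
  with * show ?thesis
    by (simp only:)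
qed

text \<open>The factor \<open>c1\<close> equals x^N y^M up to x^-2 y^-2, so it clears the negative
  exponents of \<open>C1.F\<close> and gives the same prefactor as in
  \<open>D_monomial\<close>.\<close>

lemma C1_D_monomial:
  "c1 * C1.D (mm a b) = mm (a - 1) (b - 1) * (of_int b * (of_nat N * (mm 0 (int M) - const (1 - t)))
    - of_int a * (of_nat M * (mm (int N) 0 - const (1 - t))))"
proof -
  have "c1 * C1.D (mm a b) = c1 * mm 1 1 * mm a b * (of_int b * x_deriv C1.F - of_int a * y_deriv C1.F)"
    unfolding C1.D_def by (simp add: algebra_simps del: mm_mult mm_mult_assoc)
  also have "c1 * mm 1 1 * mm a b = mm (a - 1) (b - 1) * mm (int N) (int M)"
    by (simp add: c1_def algebra_simps)
  also have "mm (a - 1) (b - 1) * mm (int N) (int M) * (of_int b * x_deriv C1.F - of_int a * y_deriv C1.F)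
      = mm (a - 1) (b - 1) * (of_int b * (mm (int N) (int M) * x_deriv C1.F)
        - of_int a * (mm (int N) (int M) * y_deriv C1.F))"
    by (simp add: algebra_simps del: mm_mult mm_mult_assoc)
  finally have *: "c1 * C1.D (mm a b) = mm (a - 1) (b - 1) * (of_int b * (mm (int N) (int M) * x_deriv C1.F)
        - of_int a * (mm (int N) (int M) * y_deriv C1.F))" .
  have uv: "mm (int N) (int M) * C1.u ^ N = mm 0 (int M)" "mm (int N) (int M) * C1.v ^ M = mm (int N) 0"
    "mm (int N) (int M) * (C1.u ^ N * C1.v ^ M) = 1"
    by (simp_all add: C1.u_def C1.v_def mm_power)
  have "mm (int N) (int M) * x_deriv C1.F
      = of_nat N * (mm (int N) (int M) * C1.u ^ N - const (1 - t) * (mm (int N) (int M) * (C1.u ^ N * C1.v ^ M)))"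
    "mm (int N) (int M) * y_deriv C1.F
      = of_nat M * (mm (int N) (int M) * C1.v ^ M - const (1 - t) * (mm (int N) (int M) * (C1.u ^ N * C1.v ^ M)))"
    unfolding C1.x_deriv_F C1.y_deriv_F by (simp_all add: algebra_simps)
  with * show ?thesis
    by (simp only: uv mult_1_right)
qed

sublocale R0: chart_restriction "lau first_quadrant" C0.I "lau everywhere" C01.I const
  C0.D C0.u C0.v C0.\<alpha> C0.\<beta> "const 1" "const (1 - t)" N M
  C01.D C01.u C01.v C01.\<alpha> C01.\<beta> "const 1" "const (1 - t)" N M 1
  by unfold_locales
    (simp_all add: I0_subset C01.I_zero C01.S_one lau_subset_everywhere)

sublocale R1: chart_restriction "lau third_quadrant" C1.I "lau everywhere" C01.I const
  C1.D C1.u C1.v C1.\<alpha> C1.\<beta> "const (1 - t)" "const 1" N M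
  C01.D C01.u C01.v C01.\<alpha> C01.\<beta> "const 1" "const (1 - t)" N M c1
proof (unfold_locales)
  \<comment> \<open>For z = x^-1 only the term with \<open>of_int a\<close> survives in both
    formulas, and the two brackets differ by exactly \<open>G\<close>.\<close>
  have "C01.D C1.u - c1 * C1.D C1.u = G * (of_nat M * mm (- 2) (- 1))"
    unfolding C1.u_def D_monomial C1_D_monomial G_expand by (simp add: algebra_simps single_diff)
  also have "\<dots> \<in> C01.I"
    by (intro multiple_I01 C01.S_closed everywhere_mm)
  finally show "C01.D C1.u - c1 * C1.D C1.u \<in> C01.I" .
  have "C01.D C1.v - c1 * C1.D C1.v = G * - (of_nat N * mm (- 1) (- 2))"
    unfolding C1.v_def D_monomial C1_D_monomial G_expand by (simp add: algebra_simps single_diff)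
  also have "\<dots> \<in> C01.I"
    by (intro multiple_I01 C01.S_closed everywhere_mm)
  finally show "C01.D C1.v - c1 * C1.D C1.v \<in> C01.I" .
qed (simp_all add: c1_def I1_subset lau_subset_everywhere)

lemma C0_mult_closed: "q \<in> lau first_quadrant \<Longrightarrow> G * q \<in> lau first_quadrant"
  by (erule G_mult_lau) (auto simp: first_quadrant_def)

lemma C1_mult_closed: "q \<in> lau third_quadrant \<Longrightarrow> C1.F * q \<in> lau third_quadrant"
  by (intro C1.S_mult C1.F_closed)

section \<open>Translation of the sheaf data to the charts\<close>

lemma ambient_pieces:
  "ambient U0 = C0.R" "ambient U1 = C1.R" "ambient U01 = C01.R"
  by (rule ambient_eq bidegree0_pieces)+

lemma curve_ideal_pieces:
  "curve_ideal N M t U0 = C0.I" "curve_ideal N M t U1 = C1.I" "curve_ideal N M t U01 = C01.I"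
proof -
  show "curve_ideal N M t U0 = C0.I"
    unfolding C0.I_def C0_F
  proof (rule curve_ideal_eq[OF bidegree0_pieces(1) curve_form_eq(1)])
    show "G \<in> lau first_quadrant"
      using C0.F_closed unfolding C0_F .
  qed (auto simp: U0_def intro: C0_mult_closed)
  show "curve_ideal N M t U01 = C01.I"
    unfolding C01.I_def C01_F
  proof (rule curve_ideal_eq[OF bidegree0_pieces(3) curve_form_eq(1)])
    show "G \<in> lau everywhere"
      using C01.F_closed unfolding C01_F .
    then show "G * q \<in> lau everywhere" if "q \<in> lau everywhere" for q
      using that by (rule C01.S_mult)
  qed (auto simp: U01_def)
  show "curve_ideal N M t U1 = C1.I"
    unfolding C1.I_def
  proof (rule curve_ideal_eq[OF bidegree0_pieces(2) curve_form_eq(2)[of N M t, folded C1.F_def]])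
    show "C1.F \<in> lau third_quadrant"
      by (rule C1.F_closed)
  qed (auto simp: U1_def intro: C1_mult_closed)
qed

lemma OX_pieces: "OX N M t U0 = C0.B" "OX N M t U1 = C1.B" "OX N M t U01 = C01.B"
  unfolding OX_def by (simp_all only: ambient_pieces curve_ideal_pieces)

lemma fn_pieces: "fn N M t U0 p = C0.cls p" "fn N M t U1 p = C1.cls p" "fn N M t U01 p = C01.cls p"
  unfolding fn_def by (simp_all only: ambient_pieces curve_ideal_pieces)

lemma scal_pieces:
  "scal N M t U0 = C0.\<phi>" "scal N M t U1 = C1.\<phi>" "scal N M t U01 = C01.\<phi>"
  by (simp_all add: scal_def fn_pieces fun_eq_iff)

lemma Omega_pieces: "Omega N M t U0 = C0.\<Omega>" "Omega N M t U1 = C1.\<Omega>" "Omega N M t U01 = C01.\<Omega>"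
  unfolding Omega_def by (simp_all only: scal_pieces OX_pieces)

lemma dX_pieces:
  "p \<in> lau first_quadrant \<Longrightarrow> dX N M t U0 (C0.cls p) = C0.form (C0.D p)"
  "q \<in> lau third_quadrant \<Longrightarrow> dX N M t U1 (C1.cls q) = C1.form (C1.D q)"
  "r \<in> lau everywhere \<Longrightarrow> dX N M t U01 (C01.cls r) = C01.form (C01.D r)"
  unfolding dX_def scal_pieces OX_pieces by (rule C0.d_form C1.d_form C01.d_form; assumption)+

lemma res_fn_eq: "res_fn N M t C = C <+>\<^bsub>C01.R\<^esub> C01.I"
  unfolding res_fn_def by (simp only: ambient_pieces curve_ideal_pieces)

lemma res_fn_pieces:
  "p \<in> lau first_quadrant \<Longrightarrow> res_fn N M t (C0.cls p) = C01.cls p"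
  "q \<in> lau third_quadrant \<Longrightarrow> res_fn N M t (C1.cls q) = C01.cls q"
  unfolding res_fn_eq by (rule R0.\<rho>_cls R1.\<rho>_cls; assumption)+

lemma res_form_pieces:
  "p \<in> lau first_quadrant \<Longrightarrow> res_form N M t U0 (C0.form p) = C01.form p"
  "q \<in> lau third_quadrant \<Longrightarrow> res_form N M t U1 (C1.form q) = C01.form (c1 * q)"
proof -
  have "res_fn N M t = (\<lambda>C. C <+>\<^bsub>C01.R\<^esub> C01.I)"
    by (rule ext) (rule res_fn_eq)
  then show "p \<in> lau first_quadrant \<Longrightarrow> res_form N M t U0 (C0.form p) = C01.form p"
    "q \<in> lau third_quadrant \<Longrightarrow> res_form N M t U1 (C1.form q) = C01.form (c1 * q)"
    unfolding res_form_def scal_pieces OX_pieces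
    using R0.kaehler_map_form[of p] R1.kaehler_map_form[of q] by simp_all
qed

text \<open>Restriction from U0 to U01 is injective, on functions and, as the generator restricts to
  the generator, on forms. This gives uniqueness of the section in
  \<open>omega_form\<close>.\<close>

lemma I0_iff: "p \<in> lau first_quadrant \<Longrightarrow> p \<in> C01.I \<longleftrightarrow> p \<in> C0.I"
proof
  assume "p \<in> lau first_quadrant" "p \<in> C01.I"
  then obtain q where "p = G * q" "q \<in> lau everywhere"
    by (auto simp: C01.I_def C01_F)
  then show "p \<in> C0.I"
    using mult_closed_first_quadrant[of q] \<open>p \<in> lau first_quadrant\<close>
    unfolding C0.I_def C0_F first_quadrant_def by auto
qed (use I0_subset in auto)

lemma I1I:
  assumes "q \<in> lau (\<lambda>a b. a \<le> - int N \<and> b \<le> - int M)"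
  shows "G * q \<in> C1.I"
proof -
  have "mm (int N) (int M) * q \<in> lau third_quadrant"
    by (rule lau_mult[OF lau_mm[of "\<lambda>a b. a = int N \<and> b = int M"] assms]) (auto simp: third_quadrant_def)
  moreover have "G * q = C1.F * (mm (int N) (int M) * q)"
    by (simp add: C1_F mult_ac)
  ultimately show ?thesis
    unfolding C1.I_def by blast
qed

text \<open>The analogue for forms on U1, whose coefficients are multiplied by the monomial
  \<open>c1\<close> under restriction. Dividing by this unit reduces the claim to a support bound
  for the cofactor.\<close>

lemma I1_iff:
  assumes "p \<in> lau third_quadrant"
  shows "c1 * p \<in> C01.I \<longleftrightarrow> p \<in> C1.I"
proof
  assume "c1 * p \<in> C01.I"
  then obtain q where q: "c1 * p = G * q" "q \<in> lau everywhere"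
    by (auto simp: C01.I_def C01_F)
  have "p = mm (2 - int N) (2 - int M) * (c1 * p)"
    by (simp add: c1_def)
  also have "\<dots> = G * (mm (2 - int N) (2 - int M) * q)"
    unfolding q(1) by (rule mult.left_commute)
  finally have p: "p = G * (mm (2 - int N) (2 - int M) * q)" .
  have "mm (2 - int N) (2 - int M) * q \<in> lau (\<lambda>a b. a \<le> - int N \<and> b \<le> - int M)"
  proof (rule mult_closed_third_quadrant)
    show "mm (2 - int N) (2 - int M) * q \<in> lau everywhere"
      using q(2) by (intro C01.S_mult everywhere_mm)
    show "G * (mm (2 - int N) (2 - int M) * q) \<in> lau (\<lambda>a b. a \<le> 0 \<and> b \<le> 0)"
      using assms p by (simp add: third_quadrant_def[abs_def])
  qed
  then show "p \<in> C1.I"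
    unfolding p by (rule I1I)
next
  assume "p \<in> C1.I"
  then show "c1 * p \<in> C01.I"
    using I1_subset by (intro C01.I_mult) (auto simp: c1_def)
qed

section \<open>The cocycles representing the basis\<close>

lemma xx_eq: "xx = C01.u" "xx = C0.u" and zz_eq: "zz = C1.u" and ww_eq: "ww = C1.v"
  by (simp_all add: xx_def zz_def ww_def C0.u_def C1.u_def C01.u_def C1.v_def mm_def)

text \<open>The factored equation exhibits the inverse of 1 - x^N that occurs in the omegas.\<close>

lemma unit_mod_I01: "(1 - xx ^ N) * (const t' * (1 - mm 0 (int M))) - 1 = G * const t'"
proof -
  have t: "const t' * const t = 1"
    by (simp add: const_mult t_unit mult.commute)
  have "(1 - xx ^ N) * (1 - mm 0 (int M)) = G + const t"
    by (simp add: xx_eq C01.u_def mm_power G_expand algebra_simps single_diff)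
  then have "(1 - xx ^ N) * (const t' * (1 - mm 0 (int M))) = const t' * (G + const t)"
    by (simp only: mult.left_commute[of _ "const t'"])
  then show ?thesis
    by (simp only: distrib_left t) (simp add: mult.commute)
qed

lemma inv_one_minus: "inv\<^bsub>C01.B\<^esub> (C01.cls (1 - xx ^ N)) = C01.cls (const t' * (1 - mm 0 (int M)))"
proof (rule C01.B.comm_inv_char)
  have *: "(1 - xx ^ N :: 'a laurent) \<in> lau everywhere" "const t' * (1 - mm 0 (int M)) \<in> lau everywhere"
    by (auto simp: xx_eq intro!: C01.closed)
  show "C01.cls (1 - xx ^ N) \<otimes>\<^bsub>C01.B\<^esub> C01.cls (const t' * (1 - mm 0 (int M))) = \<one>\<^bsub>C01.B\<^esub>"
    unfolding C01.cls_mult[OF *] C01.one_B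
    by (subst C01.cls_eq_iff)
       (simp_all only: unit_mod_I01 multiple_I01 C01.closed *)
qed (auto simp: xx_eq intro!: C01.closed C01.cls_closed)

text \<open>Since d x is M y^(M-1) (1 - x^N) times the generator on U01, the denominator of omega
  cancels and this is its coefficient there. Dividing by \<open>c1\<close> gives the coefficient
  \<open>w1\<close> on U1.\<close>

definition w0 :: "nat \<Rightarrow> nat \<Rightarrow> 'a laurent" where
  "w0 i j = of_nat (N * M) * mm (int i - 1) (int j - 1)"
definition w1 :: "nat \<Rightarrow> nat \<Rightarrow> 'a laurent" where
  "w1 i j = of_nat (N * M) * mm (int i + 1 - int N) (int j + 1 - int M)"

lemma c1_w1: "c1 * w1 i j = w0 i j"
  unfolding c1_def w0_def w1_def mult.left_commute[of "mm _ _" "of_nat _"] by simp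

lemma w0_closed: "1 \<le> i \<Longrightarrow> 1 \<le> j \<Longrightarrow> w0 i j \<in> lau first_quadrant"
  unfolding w0_def by (intro C0.S_mult C0.S_of_nat lau_mm) (simp add: first_quadrant_def)

lemma w1_closed: "i \<le> N - 1 \<Longrightarrow> j \<le> M - 1 \<Longrightarrow> w1 i j \<in> lau third_quadrant"
  unfolding w1_def using N2 M2
  by (intro C1.S_mult C1.S_of_nat lau_mm) (auto simp: third_quadrant_def)

lemma omega_form01_eq:
  assumes "1 \<le> i"
  shows "omega_form01 N M t i j = C01.form (w0 i j)"
proof -
  let ?a = "of_nat N * xx ^ (i - 1) * ypow (int j - int M) :: 'a laurent"
  let ?b = "const t' * (1 - mm 0 (int M))"
  have a: "?a = of_nat N * mm (int i - 1) (int j - int M)"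
    using assms by (simp add: xx_eq C01.u_def mm_power ypow_def of_nat_diff mult.assoc
        mm_def[of 0 "int j - int M", simplified, symmetric])
  have closed: "?a \<in> lau everywhere" "?b \<in> lau everywhere"
    unfolding a by (auto intro!: C01.closed)
  have D: "C01.D xx = of_nat M * mm 0 (int M - 1) * (1 - xx ^ N)"
    using M2 unfolding xx_eq(1) C01.D_u by (simp add: C01.v_def mm_power of_nat_diff)
  have "omega_form01 N M t i j = C01.form (?a * ?b * C01.D xx)"
    unfolding omega_form01_def OX_pieces fn_pieces Omega_pieces inv_one_minus
    using closed by (simp add: dX_pieces C01.cls_mult C01.form_smult C01.closed xx_eq)
  also have "\<dots> = C01.form (w0 i j)"
  proof (rule C01.form_cong)
    have "?a * ?b * C01.D xx - w0 i j = w0 i j * ((1 - xx ^ N) * ?b - 1)"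
      unfolding D a w0_def by (simp add: algebra_simps)
    also have "\<dots> = G * (const t' * w0 i j)"
      unfolding unit_mod_I01 by (simp add: mult_ac)
    finally show "?a * ?b * C01.D xx - w0 i j \<in> C01.I"
      by (simp only:) (auto simp: w0_def intro!: multiple_I01 C01.closed)
    show "?a * ?b * C01.D xx \<in> lau everywhere" "w0 i j \<in> lau everywhere"
      using closed by (auto simp: w0_def xx_eq intro!: C01.closed)
  qed
  finally show ?thesis .
qed

lemma omega_form_U0:
  assumes "1 \<le> i" "1 \<le> j"
  shows "omega_form N M t U0 i j = C0.form (w0 i j)"
  unfolding omega_form_def Omega_pieces omega_form01_eq[OF assms(1)]
proof (rule the_equality)
  note w = w0_closed[OF assms]
  show "C0.form (w0 i j) \<in> carrier C0.\<Omega> \<and> res_form N M t U0 (C0.form (w0 i j)) = C01.form (w0 i j)"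
    using w by (simp add: res_form_pieces)
  fix \<theta>
  assume \<theta>: "\<theta> \<in> carrier C0.\<Omega> \<and> res_form N M t U0 \<theta> = C01.form (w0 i j)"
  then obtain p where p: "\<theta> = C0.form p" "p \<in> lau first_quadrant"
    by (auto simp: C0.carrier_\<Omega>)
  then have "p - w0 i j \<in> C01.I"
    using \<theta> w by (simp add: res_form_pieces C01.form_eq_iff to_everywhere)
  then show "\<theta> = C0.form (w0 i j)"
    using p w by (simp add: C0.form_eq_iff I0_iff C0.S_diff)
qed

lemma omega_form_U1:
  assumes "1 \<le> i" "i \<le> N - 1" "j \<le> M - 1"
  shows "omega_form N M t U1 i j = C1.form (w1 i j)"
  unfolding omega_form_def Omega_pieces omega_form01_eq[OF assms(1)]
proof (rule the_equality)
  note w = w1_closed[OF assms(2,3)]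
  show "C1.form (w1 i j) \<in> carrier C1.\<Omega> \<and> res_form N M t U1 (C1.form (w1 i j)) = C01.form (w0 i j)"
    using w by (simp add: res_form_pieces c1_w1)
  fix \<theta>
  assume \<theta>: "\<theta> \<in> carrier C1.\<Omega> \<and> res_form N M t U1 \<theta> = C01.form (w0 i j)"
  then obtain p where p: "\<theta> = C1.form p" "p \<in> lau third_quadrant"
    by (auto simp: C1.carrier_\<Omega>)
  have "C01.form (c1 * p) = C01.form (c1 * w1 i j)"
    using \<theta> p by (simp add: res_form_pieces c1_w1)
  then have "c1 * (p - w1 i j) \<in> C01.I"
    using p w by (subst (asm) C01.form_eq_iff)
      (auto simp: c1_def right_diff_distrib intro!: C01.S_mult intro: to_everywhere)
  then show "\<theta> = C1.form (w1 i j)"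
    using p w by (simp add: C1.form_eq_iff I1_iff C1.S_diff)
qed

lemma inv_type_algebra:
  assumes "x * y = (1 :: 'a)"
  shows "inv\<^bsub>ring_of_type_algebra\<^esub> x = y"
proof -
  interpret cring "ring_of_type_algebra :: 'a ring" ..
  show ?thesis
    using assms by (intro comm_inv_char) (simp_all add: type_algebra_simps)
qed

text \<open>The coefficients of the two forms in an eta cocycle with respect to the generators on U0
  and U1.\<close>

definition h0 :: "nat \<Rightarrow> nat \<Rightarrow> 'a laurent" where
  "h0 i j = - ((const (of_int (int j - int M) * t * m') + const (of_nat i * n') * (1 - xx ^ N)) * w0 i j)"
definition h1 :: "nat \<Rightarrow> nat \<Rightarrow> 'a laurent" where
  "h1 i j = - (const (of_int (int j - int M) * (1 - t)) * zz ^ (N - i) * ww ^ (M - j - 1) * C1.D ww)"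

lemma h0_closed: "1 \<le> i \<Longrightarrow> 1 \<le> j \<Longrightarrow> h0 i j \<in> lau first_quadrant"
  unfolding h0_def xx_eq(2) by (intro C0.closed w0_closed) auto

lemma h1_closed: "h1 i j \<in> lau third_quadrant"
  unfolding h1_def zz_eq ww_eq by (intro C1.closed)

lemma eta_form0_eq:
  assumes "1 \<le> i" "1 \<le> j"
  shows "eta_form0 N M t i j = C0.form (h0 i j)"
  unfolding eta_form0_def omega_form_U0[OF assms] Omega_pieces fn_pieces
    inv_type_algebra[OF N_unit] inv_type_algebra[OF M_unit] h0_def
  using w0_closed[OF assms] by (simp only: xx_eq(2) C0.form_smult C0.form_uminus C0.closed)

lemma eta_form1_eq: "eta_form1 N M t i j = C1.form (h1 i j)"
  unfolding eta_form1_def Omega_pieces fn_pieces h1_def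
  by (simp only: zz_eq ww_eq dX_pieces C1.form_smult C1.form_uminus C1.closed)

lemma eta_cocycle:
  assumes "1 \<le> i" "i \<le> N - 1" "1 \<le> j" "j \<le> M - 1"
  shows "C01.D (mm (int i) (int j - int M)) - (c1 * h1 i j - h0 i j) \<in> C01.I"
proof -
  define J where "J = int j - int M"
  let ?A = "mm (int i - 1) (J - 1) :: 'a laurent" and ?A' = "mm (int i - 1 - int N) (J - 1) :: 'a laurent"
    and ?X = "mm (int N) 0 :: 'a laurent" and ?Y = "mm 0 (int M) :: 'a laurent"
  have XY: "mm (int N) (int M) = ?X * ?Y" by simp
  have 1: "C01.D (mm (int i) J) = ?A * (of_int J * (of_nat N * (?X * ?Y - ?X)) - of_nat i * (of_nat M * (?X * ?Y - ?Y)))"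
    unfolding D_monomial XY[symmetric] by simp
  have monomials: "zz ^ (N - i) * ww ^ (M - j - 1) = (mm (int i - int N) (J + 1) :: 'a laurent)"
    using assms by (simp add: zz_eq ww_eq C1.u_def C1.v_def mm_power J_def of_nat_diff algebra_simps)
  have Dw: "c1 * C1.D ww = mm (- 1) (- 2) * - (of_nat N * (?Y - const (1 - t)))"
    unfolding ww_eq C1.v_def C1_D_monomial by simp
  have "c1 * h1 i j = - (const (of_int J * (1 - t)) * (zz ^ (N - i) * ww ^ (M - j - 1)) * (c1 * C1.D ww))"
    by (simp add: h1_def J_def mult_ac)
  also have "\<dots> = of_int J * const (1 - t) * of_nat N * (?A' * (?Y - const (1 - t)))"
    unfolding monomials Dw const_mult[symmetric] by (simp add: algebra_simps)
  finally have 2: "c1 * h1 i j = of_int J * const (1 - t) * of_nat N * (?A' * (?Y - const (1 - t)))" .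
  have nm: "const n' * of_nat N = (1 :: 'a laurent)" "const m' * of_nat M = (1 :: 'a laurent)"
    using N_unit M_unit by (simp_all flip: single_of_nat add: const_mult mult.commute)
  have X: "xx ^ N = ?X"
    by (simp add: xx_eq C01.u_def mm_power)
  have "h0 i j = - ((of_int J * const t * (const m' * of_nat M) * of_nat N
      + of_nat i * (const n' * of_nat N) * of_nat M * (1 - ?X)) * (mm (int i - 1) (int j - 1)))"
    unfolding h0_def w0_def X J_def[symmetric] const_mult[symmetric] by (simp add: algebra_simps)
  also have "mm (int i - 1) (int j - 1) = ?A * ?Y"
    by (simp add: J_def)
  finally have 3: "h0 i j = - (?A * ?Y * (of_int J * const t * of_nat N + of_nat i * of_nat M * (1 - ?X)))"
    unfolding nm by (simp add: mult_ac)
  have AA: "?A = ?A' * ?X" and G: "G = ?X * ?Y - ?X - ?Y + const (1 - t)"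
    by (simp_all add: G_expand)
  have st: "const t = 1 - const (1 - t)"
    by (simp add: single_diff)
  \<comment> \<open>The terms with i cancel identically. With s = 1 - t the terms with J leave X (X
    Y - X) - s (Y - s) - t X Y, which factors as (X + s) times the equation.\<close>
  have "C01.D (mm (int i) J) - (c1 * h1 i j - h0 i j) = G * (of_int J * of_nat N * ?A' * (?X + const (1 - t)))"
    unfolding 1 2 3 AA G st by (simp add: algebra_simps del: mm_mult mm_mult_assoc)
  also have "\<dots> \<in> C01.I"
    by (intro multiple_I01 C01.closed everywhere_mm C01.S_of_int)
  finally show ?thesis
    by (simp add: J_def)
qed

section \<open>The first de Rham cohomology\<close>

definition V :: "'a triple set" where
  "V = lau everywhere \<times> lau first_quadrant \<times> lau third_quadrant"

definition cochain :: "'a triple \<Rightarrow> 'a cochain" where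
  "cochain = (\<lambda>(p, g0, g1). (C01.cls p, C0.form g0, C1.form g1))"

definition scale :: "'a \<Rightarrow> 'a triple \<Rightarrow> 'a triple" where
  "scale a = (\<lambda>(p, g0, g1). (const a * p, const a * g0, const a * g1))"

text \<open>The cocycle condition written in terms of the generator on U01; \<open>c1\<close>
  accounts for the change of generator from U1.\<close>

definition ZV :: "'a triple set" where
  "ZV = {(p, g0, g1) \<in> V. C01.D p - (c1 * g1 - g0) \<in> C01.I}"

definition boundary :: "'a laurent \<Rightarrow> 'a laurent \<Rightarrow> 'a triple" where
  "boundary u0 u1 = (u1 - u0, C0.D u0, C1.D u1)"

definition BV :: "'a triple set" where
  "BV = {boundary u0 u1 | u0 u1. u0 \<in> lau first_quadrant \<and> u1 \<in> lau third_quadrant}"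

abbreviation \<C> where "\<C> \<equiv> cochains1 N M t"
abbreviation \<Z> where "\<Z> \<equiv> \<C>\<lparr>carrier := cocycles1 N M t\<rparr>"

lemma V_add: "v \<in> V \<Longrightarrow> w \<in> V \<Longrightarrow> v + w \<in> V"
  by (auto simp: V_def intro: C01.S_add C0.S_add C1.S_add)

lemma V_zero: "0 \<in> V"
  by (simp add: V_def zero_prod_def)

lemma V_scale: "v \<in> V \<Longrightarrow> scale a v \<in> V"
  by (auto simp: V_def scale_def intro: C01.S_mult C0.S_mult C1.S_mult C01.const_closed C0.const_closed C1.const_closed)

lemma carrier_cochains: "carrier \<C> = cochain ` V"
proof -
  have "carrier \<C> = (C01.cls ` lau everywhere) \<times> (C0.form ` lau first_quadrant) \<times> (C1.form ` lau third_quadrant)"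
    by (simp add: cochains1_def OX_pieces Omega_pieces C01.carrier_B C0.carrier_\<Omega> C1.carrier_\<Omega>)
  then show ?thesis
    by (auto simp: cochain_def V_def image_iff)
qed

lemma cochain_add: "v \<in> V \<Longrightarrow> w \<in> V \<Longrightarrow> cochain v \<oplus>\<^bsub>\<C>\<^esub> cochain w = cochain (v + w)"
  by (auto simp: cochains1_def OX_pieces Omega_pieces cochain_def V_def C01.cls_add C0.form_add C1.form_add)

lemma cochain_zero: "\<zero>\<^bsub>\<C>\<^esub> = cochain 0"
proof -
  have 0: "(0 :: 'a triple) = (0, 0, 0)"
    by (simp add: zero_prod_def)
  show ?thesis
    unfolding 0 by (simp add: cochains1_def OX_pieces Omega_pieces cochain_def C01.zero_B C0.form_zero C1.form_zero)
qed

lemma cochain_smult: "v \<in> V \<Longrightarrow> a \<odot>\<^bsub>\<C>\<^esub> cochain v = cochain (scale a v)"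
  by (auto simp: cochains1_def OX_pieces Omega_pieces scal_pieces cochain_def scale_def V_def
      C01.cls_mult C0.form_smult C1.form_smult C01.const_closed C0.const_closed C1.const_closed)

lemma cochain_eq_iff:
  assumes "(p, g0, g1) \<in> V" "(q, k0, k1) \<in> V"
  shows "cochain (p, g0, g1) = cochain (q, k0, k1) \<longleftrightarrow> p - q \<in> C01.I \<and> g0 - k0 \<in> C0.I \<and> g1 - k1 \<in> C1.I"
  using assms by (auto simp: cochain_def V_def C01.cls_eq_iff C0.form_eq_iff C1.form_eq_iff)

lemma c1_closed: "c1 \<in> lau everywhere"
  by (simp add: c1_def)

lemma cocycle_iff:
  assumes "v \<in> V"
  shows "cochain v \<in> cocycles1 N M t \<longleftrightarrow> v \<in> ZV"
proof -
  obtain p g0 g1 where v: "v = (p, g0, g1)" "p \<in> lau everywhere" "g0 \<in> lau first_quadrant" "g1 \<in> lau third_quadrant"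
    using assms by (auto simp: V_def)
  have g: "g0 \<in> lau everywhere" "g1 \<in> lau everywhere"
    using v by (auto intro: to_everywhere)
  have "cochain v \<in> cocycles1 N M t \<longleftrightarrow>
      dX N M t U01 (C01.cls p) = res_form N M t U1 (C1.form g1) \<ominus>\<^bsub>Omega N M t U01\<^esub> res_form N M t U0 (C0.form g0)"
  proof -
    have "cochain v \<in> carrier \<C>"
      using assms unfolding carrier_cochains by blast
    then have "(C01.cls p, C0.form g0, C1.form g1) \<in> carrier \<C>"
      by (simp only: cochain_def v(1) prod.case)
    then show ?thesis
      by (simp add: cocycles1_def cochain_def v(1))
  qed
  also have "\<dots> \<longleftrightarrow> C01.form (C01.D p) = C01.form (c1 * g1 - g0)"
    using v g by (simp add: dX_pieces res_form_pieces Omega_pieces C01.form_minus C01.S_mult c1_closed)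
  also have "\<dots> \<longleftrightarrow> v \<in> ZV"
    using v g assms by (simp add: ZV_def C01.form_eq_iff C01.closed c1_closed)
  finally show ?thesis .
qed

lemma ZV_V: "v \<in> ZV \<Longrightarrow> v \<in> V"
  by (auto simp: ZV_def)

lemma cocycles_eq: "cocycles1 N M t = cochain ` ZV"
proof (intro equalityI subsetI)
  fix x assume x: "x \<in> cocycles1 N M t"
  then have "x \<in> carrier \<C>"
    unfolding cocycles1_def by blast
  then obtain v where v: "v \<in> V" "x = cochain v"
    unfolding carrier_cochains by blast
  then show "x \<in> cochain ` ZV"
    using x by (simp add: cocycle_iff)
next
  fix x assume "x \<in> cochain ` ZV"
  then obtain v where "v \<in> ZV" "x = cochain v"
    by blast
  then show "x \<in> cocycles1 N M t"
    by (simp add: cocycle_iff ZV_V)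
qed

lemma ZV_add:
  assumes "v \<in> ZV" "w \<in> ZV"
  shows "v + w \<in> ZV"
proof -
  obtain p g0 g1 q k0 k1 where vw: "v = (p, g0, g1)" "w = (q, k0, k1)"
    by (metis surj_pair)
  have "(C01.D p - (c1 * g1 - g0)) + (C01.D q - (c1 * k1 - k0)) \<in> C01.I"
    using assms vw by (intro C01.I_add) (auto simp: ZV_def)
  then show ?thesis
    using assms V_add[of v w] vw by (simp add: ZV_def C01.D_add algebra_simps)
qed

lemma ZV_scale:
  assumes "v \<in> ZV"
  shows "scale a v \<in> ZV"
proof -
  obtain p g0 g1 where v: "v = (p, g0, g1)"
    by (metis surj_pair)
  have "const a * (C01.D p - (c1 * g1 - g0)) \<in> C01.I"
    using assms v by (intro C01.I_mult C01.const_closed) (auto simp: ZV_def)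
  also have "const a * (C01.D p - (c1 * g1 - g0)) = C01.D (const a * p) - (c1 * (const a * g1) - const a * g0)"
    by (simp add: C01.D_mult C01.D_const algebra_simps)
  finally show ?thesis
    using V_scale[OF ZV_V[OF assms], of a] by (simp add: v scale_def ZV_def)
qed

lemma ZV_zero: "0 \<in> ZV"
  using V_zero C01.D_const[of 0] by (simp add: ZV_def zero_prod_def C01.I_zero)

lemma boundary_closed:
  assumes "u0 \<in> lau first_quadrant" "u1 \<in> lau third_quadrant"
  shows "boundary u0 u1 \<in> ZV"
proof -
  have V: "boundary u0 u1 \<in> V"
    using assms by (auto simp: boundary_def V_def intro!: C0.D_closed C1.D_closed C01.S_diff to_everywhere)
  \<comment> \<open>\<open>C0.D\<close> and \<open>C01.D\<close> are the same operator, since its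
    definition does not involve the set of exponents.\<close>
  have "C01.D (u1 - u0) = C01.D u1 - C0.D u0"
    using C01.D_add[of "u1 - u0" u0] by (simp add: algebra_simps)
  then show ?thesis
    using V R1.D'_eq[OF assms(2)] by (simp add: ZV_def boundary_def algebra_simps)
qed

lemma BV_ZV: "v \<in> BV \<Longrightarrow> v \<in> ZV"
  by (auto simp: BV_def boundary_closed)

lemma BV_add:
  assumes "v \<in> BV" "w \<in> BV"
  shows "v + w \<in> BV"
proof -
  obtain u0 u1 u0' u1' where u: "v = boundary u0 u1" "w = boundary u0' u1'"
    "u0 \<in> lau first_quadrant" "u1 \<in> lau third_quadrant" "u0' \<in> lau first_quadrant" "u1' \<in> lau third_quadrant"
    using assms by (auto simp: BV_def)
  then have "v + w = boundary (u0 + u0') (u1 + u1')"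
    by (simp add: boundary_def C0.D_add C1.D_add)
  then show ?thesis
    using u by (auto simp: BV_def intro: C0.S_add C1.S_add)
qed

lemma BV_scale:
  assumes "v \<in> BV"
  shows "scale a v \<in> BV"
proof -
  obtain u0 u1 where u: "v = boundary u0 u1" "u0 \<in> lau first_quadrant" "u1 \<in> lau third_quadrant"
    using assms by (auto simp: BV_def)
  then have "scale a v = boundary (const a * u0) (const a * u1)"
    by (simp add: boundary_def scale_def C0.D_mult C1.D_mult C0.D_const C1.D_const algebra_simps)
  then show ?thesis
    using u unfolding BV_def by (auto intro: C0.S_mult C1.S_mult C0.const_closed C1.const_closed)
qed

lemma BV_zero: "0 \<in> BV"
proof -
  have "0 = boundary 0 0"
    using C0.D_const[of 0] C1.D_const[of 0] by (simp add: boundary_def zero_prod_def)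
  then show ?thesis
    using lau_zero unfolding BV_def by blast
qed

lemma coboundaries_eq: "coboundaries1 N M t = cochain ` BV"
proof -
  have *: "(res_fn N M t (C1.cls u1) \<ominus>\<^bsub>OX N M t U01\<^esub> res_fn N M t (C0.cls u0), dX N M t U0 (C0.cls u0), dX N M t U1 (C1.cls u1))
      = cochain (boundary u0 u1)" if "u0 \<in> lau first_quadrant" "u1 \<in> lau third_quadrant" for u0 u1
    using that by (simp add: res_fn_pieces dX_pieces OX_pieces cochain_def boundary_def C01.cls_minus to_everywhere)
  have "coboundaries1 N M t = (\<lambda>(u0, u1). (res_fn N M t (C1.cls u1) \<ominus>\<^bsub>OX N M t U01\<^esub> res_fn N M t (C0.cls u0),
      dX N M t U0 (C0.cls u0), dX N M t U1 (C1.cls u1))) ` (lau first_quadrant \<times> lau third_quadrant)"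
    unfolding coboundaries1_def OX_pieces(1,2) C0.carrier_B C1.carrier_B by (auto simp only: image_iff)
  also have "\<dots> = (\<lambda>(u0, u1). cochain (boundary u0 u1)) ` (lau first_quadrant \<times> lau third_quadrant)"
    by (intro image_cong refl) (simp only: mem_Sigma_iff split_paired_all prod.case *)
  also have "\<dots> = cochain ` BV"
  proof -
    have "BV = (\<lambda>(u0, u1). boundary u0 u1) ` (lau first_quadrant \<times> lau third_quadrant)"
      unfolding BV_def by force
    then show ?thesis
      by (simp add: image_image split_beta)
  qed
  finally show ?thesis .
qed

section \<open>The module structure on cohomology\<close>

lemma scale_laws:
  "scale (a + b) v = scale a v + scale b v" "scale a (v + w) = scale a v + scale a w"
  "scale (a * b) v = scale a (scale b v)"
  by (cases v; cases w; simp add: scale_def single_add algebra_simps flip: const_mult)+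

lemma scale_one: "scale 1 v = v"
  by (cases v) (simp add: scale_def)

lemma \<Z>_ops:
  "carrier \<Z> = cochain ` ZV" "x \<oplus>\<^bsub>\<Z>\<^esub> y = x \<oplus>\<^bsub>\<C>\<^esub> y" "\<zero>\<^bsub>\<Z>\<^esub> = cochain 0" "a \<odot>\<^bsub>\<Z>\<^esub> x = a \<odot>\<^bsub>\<C>\<^esub> x"
  by (simp_all add: cocycles_eq cochain_zero)

lemma \<Z>_add: "v \<in> ZV \<Longrightarrow> w \<in> ZV \<Longrightarrow> cochain v \<oplus>\<^bsub>\<Z>\<^esub> cochain w = cochain (v + w)"
  by (simp add: cochain_add ZV_V)

lemma \<Z>_smult: "v \<in> ZV \<Longrightarrow> a \<odot>\<^bsub>\<Z>\<^esub> cochain v = cochain (scale a v)"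
  by (simp add: cochain_smult ZV_V)

lemma scale_minus: "scale (- 1) v + v = 0"
proof -
  have "(0 :: 'a triple) = (0, 0, 0)"
    by (simp add: zero_prod_def)
  then show ?thesis
    by (cases v) (simp add: scale_def single_uminus)
qed

lemma module_\<Z>: "module ring_of_type_algebra \<Z>"
proof (rule moduleI)
  note simps = \<Z>_ops(1,3) \<Z>_add \<Z>_smult ZV_add ZV_scale ZV_zero type_algebra_simps
  show "cring (ring_of_type_algebra :: 'a ring)" ..
  show "abelian_group \<Z>"
  proof (rule abelian_groupI)
    show "\<exists>y\<in>carrier \<Z>. y \<oplus>\<^bsub>\<Z>\<^esub> x = \<zero>\<^bsub>\<Z>\<^esub>" if "x \<in> carrier \<Z>" for x
    proof -
      obtain v where "v \<in> ZV" "x = cochain v"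
        using \<open>x \<in> carrier \<Z>\<close> unfolding \<Z>_ops(1) by blast
      then have "cochain (scale (- 1) v) \<in> carrier \<Z>" "cochain (scale (- 1) v) \<oplus>\<^bsub>\<Z>\<^esub> x = \<zero>\<^bsub>\<Z>\<^esub>"
        unfolding \<Z>_ops(1,3) by (simp_all only: \<Z>_add ZV_scale scale_minus imageI)
      then show ?thesis by blast
    qed
  qed (unfold \<Z>_ops(1,3), auto simp only: simps imageI add_ac add_0 elim!: imageE)
  fix a b x y
  assume "x \<in> carrier \<Z>" "y \<in> carrier \<Z>"
  then obtain v w where v: "v \<in> ZV" "x = cochain v" and w: "w \<in> ZV" "y = cochain w"
    unfolding \<Z>_ops(1) by blast
  show "a \<odot>\<^bsub>\<Z>\<^esub> (x \<oplus>\<^bsub>\<Z>\<^esub> y) = a \<odot>\<^bsub>\<Z>\<^esub> x \<oplus>\<^bsub>\<Z>\<^esub> a \<odot>\<^bsub>\<Z>\<^esub> y"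
    unfolding v w by (simp only: simps v(1) w(1) scale_laws)
next
  note simps = \<Z>_ops(1,3) \<Z>_add \<Z>_smult ZV_add ZV_scale ZV_zero type_algebra_simps
  fix a b x
  assume "x \<in> carrier \<Z>"
  then obtain v where v: "v \<in> ZV" "x = cochain v"
    unfolding \<Z>_ops(1) by blast
  show "(a \<oplus>\<^bsub>ring_of_type_algebra\<^esub> b) \<odot>\<^bsub>\<Z>\<^esub> x = a \<odot>\<^bsub>\<Z>\<^esub> x \<oplus>\<^bsub>\<Z>\<^esub> b \<odot>\<^bsub>\<Z>\<^esub> x"
    "(a \<otimes>\<^bsub>ring_of_type_algebra\<^esub> b) \<odot>\<^bsub>\<Z>\<^esub> x = a \<odot>\<^bsub>\<Z>\<^esub> (b \<odot>\<^bsub>\<Z>\<^esub> x)"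
    "\<one>\<^bsub>ring_of_type_algebra\<^esub> \<odot>\<^bsub>\<Z>\<^esub> x = x"
    unfolding v by (simp_all only: simps v(1) scale_laws scale_one)
  show "a \<odot>\<^bsub>\<Z>\<^esub> x \<in> carrier \<Z>"
    unfolding v by (simp only: simps v(1) imageI)
qed

lemma coboundaries_submodule: "submodule (coboundaries1 N M t) ring_of_type_algebra \<Z>"
proof -
  interpret Z: module ring_of_type_algebra \<Z> by (rule module_\<Z>)
  show ?thesis
    unfolding coboundaries_eq
  proof (rule Z.submoduleI)
    show "cochain ` BV \<subseteq> carrier \<Z>"
      using BV_ZV unfolding \<Z>_ops(1) by blast
    show "\<zero>\<^bsub>\<Z>\<^esub> \<in> cochain ` BV"
      unfolding \<Z>_ops(3) using BV_zero by blast
    fix x assume "x \<in> cochain ` BV"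
    then obtain v where v: "v \<in> BV" "x = cochain v" by blast
    show "a \<odot>\<^bsub>\<Z>\<^esub> x \<in> cochain ` BV" for a
      unfolding v using v(1) by (simp only: \<Z>_smult BV_ZV BV_scale imageI)
    have "\<ominus>\<^bsub>\<Z>\<^esub> x = cochain (scale (- 1) v)"
    proof (rule Z.M.minus_equality)
      show "cochain (scale (- 1) v) \<oplus>\<^bsub>\<Z>\<^esub> x = \<zero>\<^bsub>\<Z>\<^esub>"
        unfolding v using v(1) by (simp only: \<Z>_add \<Z>_ops(3) BV_ZV ZV_scale scale_minus)
    qed (use v BV_ZV ZV_scale in \<open>auto simp: \<Z>_ops(1) simp del: partial_object.simps\<close>)
    then show "\<ominus>\<^bsub>\<Z>\<^esub> x \<in> cochain ` BV"
      using v(1) by (simp only: BV_scale imageI)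
    fix y assume "y \<in> cochain ` BV"
    then obtain w where w: "w \<in> BV" "y = cochain w" by blast
    show "x \<oplus>\<^bsub>\<Z>\<^esub> y \<in> cochain ` BV"
      unfolding v w using v(1) w(1) by (simp only: \<Z>_add BV_ZV BV_add imageI)
  qed
qed

sublocale H: module_quotient ring_of_type_algebra \<Z> "coboundaries1 N M t"
  by (intro module_quotient.intro module_quotient_axioms.intro module_\<Z> coboundaries_submodule)

lemma H1dR_eq: "H1dR N M t = H.Q"
  by (simp add: H1dR_def)

definition cl :: "'a triple \<Rightarrow> 'a cochain set" where
  "cl v = H.proj (cochain v)"

lemma H1class_eq: "H1class N M t (cochain v) = cl v"
  by (simp add: H1class_def cl_def)

lemma cochain_carrier: "v \<in> ZV \<Longrightarrow> cochain v \<in> carrier \<Z>"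
  unfolding \<Z>_ops(1) by blast

lemma carrier_H: "carrier (H1dR N M t) = cl ` ZV"
  unfolding H1dR_eq H.carrier_Q \<Z>_ops(1) cl_def by blast

lemma cl_add: "v \<in> ZV \<Longrightarrow> w \<in> ZV \<Longrightarrow> cl v \<oplus>\<^bsub>H1dR N M t\<^esub> cl w = cl (v + w)"
  unfolding H1dR_eq cl_def by (simp only: H.add_Q cochain_carrier \<Z>_add)

lemma cl_smult: "v \<in> ZV \<Longrightarrow> a \<odot>\<^bsub>H1dR N M t\<^esub> cl v = cl (scale a v)"
  unfolding H1dR_eq cl_def
  by (subst H.smult_Q) (simp_all only: cochain_carrier \<Z>_smult type_algebra_simps UNIV_I)

lemma cl_zero: "\<zero>\<^bsub>H1dR N M t\<^esub> = cl 0"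
  unfolding H1dR_eq cl_def H.zero_Q \<Z>_ops(3) ..

lemma cl_eq_zero_iff: "v \<in> ZV \<Longrightarrow> cl v = \<zero>\<^bsub>H1dR N M t\<^esub> \<longleftrightarrow> cochain v \<in> cochain ` BV"
  unfolding H1dR_eq cl_def coboundaries_eq[symmetric] by (rule H.zero_Q_iff) (rule cochain_carrier)

lemma module_H: "module ring_of_type_algebra (H1dR N M t)"
  unfolding H1dR_eq by (rule H.module_Q)

lemma ZV_sum: "finite I \<Longrightarrow> (\<And>i. i \<in> I \<Longrightarrow> f i \<in> ZV) \<Longrightarrow> sum f I \<in> ZV"
  by (induction I rule: finite_induct) (auto simp: ZV_zero ZV_add)

lemma finsum_cl:
  assumes "finite I" "\<And>i. i \<in> I \<Longrightarrow> f i \<in> ZV"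
  shows "(\<Oplus>\<^bsub>H1dR N M t\<^esub>i\<in>I. c i \<odot>\<^bsub>H1dR N M t\<^esub> cl (f i)) = cl (\<Sum>i\<in>I. scale (c i) (f i))"
proof -
  interpret Q: module ring_of_type_algebra "H1dR N M t" by (rule module_H)
  have cl: "v \<in> ZV \<Longrightarrow> cl v \<in> carrier (H1dR N M t)" for v
    unfolding carrier_H by blast
  show ?thesis
    using assms
  proof (induction I rule: finite_induct)
    case empty
    then show ?case by (simp add: cl_zero)
  next
    case (insert i I)
    have "(\<lambda>i. c i \<odot>\<^bsub>H1dR N M t\<^esub> cl (f i)) \<in> I \<rightarrow> carrier (H1dR N M t)"
      "c i \<odot>\<^bsub>H1dR N M t\<^esub> cl (f i) \<in> carrier (H1dR N M t)"
      using insert.prems by (auto simp: cl_smult ZV_scale cl)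
    then have "(\<Oplus>\<^bsub>H1dR N M t\<^esub>i\<in>insert i I. c i \<odot>\<^bsub>H1dR N M t\<^esub> cl (f i))
      = c i \<odot>\<^bsub>H1dR N M t\<^esub> cl (f i) \<oplus>\<^bsub>H1dR N M t\<^esub> cl (\<Sum>i\<in>I. scale (c i) (f i))"
      using Q.M.finsum_insert[OF insert.hyps] insert.IH insert.prems by simp
    also have "\<dots> = cl (scale (c i) (f i) + (\<Sum>i\<in>I. scale (c i) (f i)))"
      using insert.prems insert.hyps by (simp add: cl_smult cl_add ZV_scale ZV_sum)
    finally show ?case
      using insert.hyps by simp
  qed
qed

section \<open>The basis classes as triples\<close>

definition omega_triple :: "nat \<times> nat \<Rightarrow> 'a triple" where
  "omega_triple = (\<lambda>(i, j). (0, w0 i j, w1 i j))"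

definition eta_triple :: "nat \<times> nat \<Rightarrow> 'a triple" where
  "eta_triple = (\<lambda>(i, j). (mm (int i) (int j - int M), h0 i j, h1 i j))"

definition indices :: "(nat \<times> nat) set" where
  "indices = {1..N - 1} \<times> {1..M - 1}"

lemma finite_indices: "finite indices"
  by (simp add: indices_def)

lemma omega_triple_ZV:
  assumes "k \<in> indices"
  shows "omega_triple k \<in> ZV"
proof -
  obtain i j where k: "k = (i, j)" "1 \<le> i" "i \<le> N - 1" "1 \<le> j" "j \<le> M - 1"
    using assms by (auto simp: indices_def)
  then show ?thesis
    using C01.D_const[of 0] w0_closed[of i j] w1_closed[of i j]
    by (simp add: omega_triple_def ZV_def V_def c1_w1 C01.I_zero)
qed

lemma eta_triple_ZV:
  assumes "k \<in> indices"
  shows "eta_triple k \<in> ZV"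
proof -
  obtain i j where k: "k = (i, j)" "1 \<le> i" "i \<le> N - 1" "1 \<le> j" "j \<le> M - 1"
    using assms by (auto simp: indices_def)
  then show ?thesis
    using eta_cocycle[of i j] h0_closed[of i j] h1_closed[of i j]
    by (simp add: eta_triple_def ZV_def V_def)
qed

lemma omega_cl:
  assumes "(i, j) \<in> indices"
  shows "omega N M t i j = cl (omega_triple (i, j))"
  using assms unfolding omega_def H1class_eq[symmetric]
  by (simp add: omega_triple_def cochain_def OX_pieces C01.zero_B omega_form_U0 omega_form_U1 indices_def)

lemma eta_cl:
  assumes "(i, j) \<in> indices"
  shows "eta N M t i j = cl (eta_triple (i, j))"
proof -
  have "xx ^ i * ypow (int j - int M) = (mm (int i) (int j - int M) :: 'a laurent)"
  proof -
    have "xx ^ i = (mm (int i) 0 :: 'a laurent)" "ypow (int j - int M) = (mm 0 (int j - int M) :: 'a laurent)"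
      by (simp_all add: xx_eq C01.u_def mm_power) (simp add: ypow_def mm_def)
    then show ?thesis
      by simp
  qed
  then show ?thesis
    using assms unfolding eta_def H1class_eq[symmetric]
    by (simp add: eta_triple_def cochain_def fn_pieces eta_form0_eq eta_form1_eq indices_def)
qed

lemma triple_sum:
  "(\<Sum>k\<in>K. scale (c k) (omega_triple k))
    = (0, \<Sum>k\<in>K. const (c k) * case_prod w0 k, \<Sum>k\<in>K. const (c k) * case_prod w1 k)"
  "(\<Sum>k\<in>K. scale (c k) (eta_triple k))
    = (\<Sum>k\<in>K. const (c k) * (case k of (i, j) \<Rightarrow> mm (int i) (int j - int M)),
       \<Sum>k\<in>K. const (c k) * case_prod h0 k, \<Sum>k\<in>K. const (c k) * case_prod h1 k)"
  by (auto simp: prod_eq_iff fst_sum snd_sum scale_def omega_triple_def eta_triple_def case_prod_beta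
      intro!: sum.cong)

section \<open>Generation and linear independence\<close>

lemma D_G_mult: "q \<in> lau everywhere \<Longrightarrow> C01.D (G * q) \<in> C01.I"
  using C01.D_F[of q] unfolding C01_F by (simp add: multiple_I01 C01.D_closed)

lemma cl_cong: "cochain v = cochain w \<Longrightarrow> cl v = cl w"
  by (simp only: cl_def)

lemma nm_unit: "const (a * (n' * m')) * of_nat (N * M) = (const a :: 'a laurent)"
proof -
  have "a * (n' * m') * of_nat (N * M) = a * (of_nat N * n') * (of_nat M * m')"
    by (simp add: mult_ac)
  then show ?thesis
    by (simp add: N_unit M_unit const_mult flip: single_of_nat)
qed

text \<open>A cocycle with vanishing function is a global form. Its coefficients on U0 and U1 differ
  by a multiple of the equation, which \<open>forms_split\<close> distributes over both sides. The
  resulting common polynomial \<open>r\<close> is bounded below by the first chart and above by the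
  second, which leaves exactly the monomials of the \<open>w0\<close>.\<close>

lemma no_obstruction:
  assumes v: "(G * q, a0, a1) \<in> ZV" and q: "q \<in> lau everywhere"
  obtains c where "cochain (G * q, a0, a1) = cochain (\<Sum>k\<in>indices. scale (c k) (omega_triple k))"
proof -
  have a: "a0 \<in> lau first_quadrant" "a1 \<in> lau third_quadrant"
    using v by (auto simp: ZV_def V_def)
  have "C01.D (G * q) - (C01.D (G * q) - (c1 * a1 - a0)) \<in> C01.I"
    by (rule C01.I_diff[OF D_G_mult[OF q]]) (use v in \<open>simp add: ZV_def\<close>)
  then have "c1 * a1 - a0 \<in> C01.I"
    by simp
  then obtain q2 where q2: "c1 * a1 - a0 = G * q2" "q2 \<in> lau everywhere"
    by (auto simp: C01.I_def C01_F)
  have c1a1: "c1 * a1 \<in> lau (\<lambda>a b. a \<le> int N - 2 \<and> b \<le> int M - 2)"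
    unfolding c1_def
    by (rule lau_mult[OF lau_mm[of "\<lambda>a b. a = int N - 2 \<and> b = int M - 2"] a(2)])
       (auto simp: third_quadrant_def)
  have "c1 * a1 - a0 \<in> lau (\<lambda>a b. 0 \<le> a \<and> 0 \<le> b \<or> a \<le> int N - 2 \<and> b \<le> int M - 2)"
    by (intro lau_diff lau_mono[OF c1a1] lau_mono[OF a(1)]) (auto simp: first_quadrant_def)
  then obtain q0 q1 where q01: "q2 = q0 + q1" "q0 \<in> lau (\<lambda>a b. 0 \<le> a \<and> 0 \<le> b)"
    "q1 \<in> lau (\<lambda>a b. a \<le> - 2 \<and> b \<le> - 2)"
    unfolding q2(1) using forms_split[OF q2(2)] by blast
  define r where "r = a0 + G * q0"
  have q0: "q0 \<in> lau first_quadrant"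
    using q01(2) by (simp add: first_quadrant_def[abs_def])
  have r_eq: "r = c1 * a1 - G * q1"
    using q2(1) unfolding r_def q01(1) by (simp add: algebra_simps)
  have r0: "r \<in> lau first_quadrant"
    unfolding r_def by (intro lau_add a(1) C0_mult_closed q0)
  have r1: "r \<in> lau (\<lambda>a b. a \<le> int N - 2 \<and> b \<le> int M - 2)"
    unfolding r_eq by (intro lau_diff c1a1 G_mult_lau[OF q01(3)]) auto
  have r: "r \<in> lau (\<lambda>a b. 0 \<le> a \<and> 0 \<le> b \<and> a \<le> int N - 2 \<and> b \<le> int M - 2)"
    using lau_coefD[OF r0] lau_coefD[OF r1] by (intro lau_coefI[OF r0]) (simp add: first_quadrant_def)
  define f :: "nat \<times> nat \<Rightarrow> int \<times> int" where "f = (\<lambda>(i, j). (int i - 1, int j - 1))"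
  have r_sum: "r = (\<Sum>k\<in>indices. const (case_prod (coef r) (f k)) * case_prod mm (f k))"
  proof (rule lau_expansion[OF finite_indices _ r])
    show "inj_on f indices"
      by (auto simp: f_def inj_on_def)
    fix a b assume "0 \<le> a \<and> 0 \<le> b \<and> a \<le> int N - 2 \<and> b \<le> int M - 2"
    then show "(a, b) \<in> f ` indices"
      by (intro image_eqI[of _ _ "(nat (a + 1), nat (b + 1))"]) (auto simp: f_def indices_def)
  qed
  \<comment> \<open>The factor \<open>n' * m'\<close> undoes the N M in \<open>w0\<close>.\<close>
  define c where "c k = case_prod (coef r) (f k) * (n' * m')" for k
  define S where "S = (\<Sum>k\<in>indices. const (c k) * case_prod w1 k)"
  have "const (c k) * case_prod w0 k = const (case_prod (coef r) (f k)) * case_prod mm (f k)" for k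
    using nm_unit[of "case_prod (coef r) (f k)"]
    by (cases k) (simp add: c_def w0_def f_def flip: mult.assoc)
  then have w0_sum: "(\<Sum>k\<in>indices. const (c k) * case_prod w0 k) = r"
    by (subst r_sum) simp
  have "c1 * S = (\<Sum>k\<in>indices. const (c k) * case_prod w0 k)"
    unfolding S_def sum_distrib_left by (intro sum.cong refl) (auto simp: mult.left_commute[of c1] c1_w1)
  then have c1S: "c1 * S = r"
    by (simp only: w0_sum)
  have S: "S \<in> lau third_quadrant"
    unfolding S_def
    by (intro lau_sum) (auto intro!: C1.S_mult C1.const_closed w1_closed simp: indices_def)
  have sum: "(\<Sum>k\<in>indices. scale (c k) (omega_triple k)) = (0, r, S)"
    unfolding triple_sum w0_sum S_def ..
  have "c1 * (a1 - S) = G * q1"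
    using r_eq c1S by (simp add: right_diff_distrib)
  then have "c1 * (a1 - S) \<in> C01.I"
    using multiple_I01[OF to_everywhere[OF q01(3)]] by simp
  then have "a1 - S \<in> C1.I"
    using I1_iff[of "a1 - S"] a S by (simp add: C1.S_diff)
  moreover have "a0 - r \<in> C0.I"
  proof -
    have "a0 - r = C0.F * (- q0)"
      by (simp add: r_def C0_F)
    then show ?thesis
      using C0.S_uminus[OF q0] unfolding C0.I_def by blast
  qed
  moreover have "(0, r, S) \<in> V"
    using r0 S by (simp add: V_def)
  ultimately have "cochain (G * q, a0, a1) = cochain (0, r, S)"
    using ZV_V[OF v] multiple_I01[OF q] by (subst cochain_eq_iff) simp_all
  then show thesis
    using that[of c] by (simp only: sum)
qed

lemma spanning:
  assumes v: "v \<in> ZV"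
  obtains c e where "cl v = cl ((\<Sum>k\<in>indices. scale (c k) (omega_triple k)) + (\<Sum>k\<in>indices. scale (e k) (eta_triple k)))"
proof -
  obtain p g0 g1 where pg: "v = (p, g0, g1)"
    by (metis surj_pair)
  have p: "p \<in> lau everywhere"
    using v by (simp add: pg ZV_def V_def)
  obtain u0 u1 r q where d: "u0 \<in> lau first_quadrant" "u1 \<in> lau third_quadrant"
    "r \<in> lau rectangle" "q \<in> lau everywhere" "p = u1 - u0 + r + G * q"
    using cech_split_all[OF p] unfolding cech_split_def first_quadrant_def[abs_def] third_quadrant_def[abs_def]
    by blast
  define f :: "nat \<times> nat \<Rightarrow> int \<times> int" where "f = (\<lambda>(i, j). (int i, int j - int M))"
  have r_sum: "r = (\<Sum>k\<in>indices. const (case_prod (coef r) (f k)) * case_prod mm (f k))"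
  proof (rule lau_expansion[OF finite_indices _ d(3)])
    show "inj_on f indices"
      by (auto simp: f_def inj_on_def)
    fix a b assume "rectangle a b"
    then show "(a, b) \<in> f ` indices"
      by (intro image_eqI[of _ _ "(nat a, nat (b + int M))"]) (auto simp: f_def indices_def rectangle_def)
  qed
  define e where "e k = case_prod (coef r) (f k)" for k
  define E where "E = (\<Sum>k\<in>indices. scale (e k) (eta_triple k))"
  have E: "E \<in> ZV"
    unfolding E_def by (intro ZV_sum finite_indices ZV_scale eta_triple_ZV)
  \<comment> \<open>The coefficients \<open>e\<close> were read off from \<open>r\<close>, so the
    function component of this eta combination is \<open>r\<close> itself, not only congruent to
    it.\<close>
  have "fst E = (\<Sum>k\<in>indices. const (case_prod (coef r) (f k)) * case_prod mm (f k))"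
    unfolding E_def triple_sum e_def by (auto simp: f_def case_prod_beta)
  then have fst_E: "fst E = r"
    using r_sum by simp
  define b where "b = boundary u0 u1"
  have b: "b \<in> ZV" "b \<in> BV"
    unfolding b_def using d(1,2) boundary_closed by (auto simp: BV_def)
  define v' where "v' = v + scale (- 1) (E + b)"
  have v': "v' \<in> ZV"
    unfolding v'_def by (intro ZV_add v ZV_scale E b)
  have "fst v' = G * q"
    using fst_E unfolding v'_def
    by (simp add: pg d(5) b_def boundary_def scale_def case_prod_beta single_uminus)
  then obtain a0 a1 where a: "v' = (G * q, a0, a1)"
    by (metis prod.collapse)
  obtain c where c: "cochain v' = cochain (\<Sum>k\<in>indices. scale (c k) (omega_triple k))"
    using no_obstruction[OF v'[unfolded a] d(4)] unfolding a by blast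
  define W where "W = (\<Sum>k\<in>indices. scale (c k) (omega_triple k))"
  have W: "W \<in> ZV"
    unfolding W_def by (intro ZV_sum finite_indices ZV_scale omega_triple_ZV)
  have "v = v' + (E + b)"
    using scale_minus[of "E + b"] unfolding v'_def by (simp add: add.assoc)
  then have "cl v = cl v' \<oplus>\<^bsub>H1dR N M t\<^esub> (cl E \<oplus>\<^bsub>H1dR N M t\<^esub> cl b)"
    using v' E b by (simp add: cl_add ZV_add)
  also have "cl v' = cl W"
    using c unfolding W_def by (rule cl_cong)
  also have "cl b = cl 0"
    using cl_eq_zero_iff[OF b(1)] b(2) cl_zero by blast
  also have "cl W \<oplus>\<^bsub>H1dR N M t\<^esub> (cl E \<oplus>\<^bsub>H1dR N M t\<^esub> cl 0) = cl (W + E)"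
    using W E ZV_zero by (simp add: cl_add ZV_add)
  finally show thesis
    using that[of c e] unfolding W_def E_def by blast
qed

text \<open>The function component is treated first and gives \<open>e = 0\<close>. The bounding
  cochain then consists of constants modulo the equation, so the remaining form on U0 is zero modulo
  the equation. Its coefficient is too small in the x-direction to be a nonzero multiple.\<close>

lemma independent:
  assumes "cl ((\<Sum>k\<in>indices. scale (c k) (omega_triple k)) + (\<Sum>k\<in>indices. scale (e k) (eta_triple k)))
      = \<zero>\<^bsub>H1dR N M t\<^esub>"
  shows "\<forall>k\<in>indices. c k = 0 \<and> e k = 0"
proof -
  define W where "W = (\<Sum>k\<in>indices. scale (c k) (omega_triple k))"
  define E where "E = (\<Sum>k\<in>indices. scale (e k) (eta_triple k))"
  have WE: "W \<in> ZV" "E \<in> ZV"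
    unfolding W_def E_def by (intro ZV_sum finite_indices ZV_scale omega_triple_ZV eta_triple_ZV; assumption)+
  obtain p g0 g1 where pg: "W + E = (p, g0, g1)"
    by (metis surj_pair)
  have pgV: "(p, g0, g1) \<in> V"
    using ZV_V[OF ZV_add[OF WE]] by (simp only: pg)
  have "cochain (W + E) \<in> cochain ` BV"
    using assms cl_eq_zero_iff[OF ZV_add[OF WE]] unfolding W_def E_def by blast
  then obtain u0 u1 where u: "u0 \<in> lau first_quadrant" "u1 \<in> lau third_quadrant"
    and eq: "cochain (p, g0, g1) = cochain (boundary u0 u1)"
    unfolding pg BV_def by blast
  have bV: "boundary u0 u1 \<in> V"
    using boundary_closed[OF u] by (rule ZV_V)
  have eqs: "p - (u1 - u0) \<in> C01.I" "g0 - C0.D u0 \<in> C0.I"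
    using eq cochain_eq_iff[OF pgV bV[unfolded boundary_def]] by (simp_all add: boundary_def)
  have p_sum: "p = (\<Sum>k\<in>indices. const (e k) * (case k of (i, j) \<Rightarrow> mm (int i) (int j - int M)))"
    using arg_cong[OF pg, of fst] unfolding W_def E_def triple_sum by simp
  have coef_p: "coef p (int i) (int j - int M) = e (i, j)" if "(i, j) \<in> indices" for i j
  proof -
    have "coef p (int i) (int j - int M) = (\<Sum>k\<in>indices. if k = (i, j) then e k else 0)"
      unfolding p_sum coef_sum by (intro sum.cong) (auto simp: coef_mm split: if_splits)
    then show ?thesis
      using that finite_indices by simp
  qed
  have p: "p \<in> lau rectangle"
    unfolding p_sum
    by (intro lau_sum) (auto intro!: lau_monomial simp: rectangle_def indices_def)
  obtain q where q: "p - (u1 - u0) = G * q" "q \<in> lau everywhere"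
    using eqs(1) by (auto simp: C01.I_def C01_F)
  have "p - (u1 - u0) \<in> lau (\<lambda>a b. 0 \<le> a \<and> 0 \<le> b \<or> a \<le> 0 \<and> b \<le> 0 \<or>
      1 \<le> a \<and> a \<le> int N - 1 \<and> 1 - int M \<le> b \<and> b \<le> - 1)"
    by (intro lau_diff lau_mono[OF p] lau_mono[OF u(1)] lau_mono[OF u(2)])
       (auto simp: rectangle_def first_quadrant_def third_quadrant_def)
  then obtain q0 q1 where q01: "q = q0 + q1" "q0 \<in> lau (\<lambda>a b. 0 \<le> a \<and> 0 \<le> b)"
    "q1 \<in> lau (\<lambda>a b. a \<le> - int N \<and> b \<le> - int M)"
    unfolding q(1) using functions_split[OF q(2)] by blast
  have q0: "q0 \<in> lau first_quadrant"
    using q01(2) by (simp add: first_quadrant_def[abs_def])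
  \<comment> \<open>Absorbing the two pieces of the cofactor turns a congruence into the exact
    identity \<open>p + y0 = y1\<close> of Laurent polynomials, so coefficients can be
    compared.\<close>
  define y0 where "y0 = u0 - G * q0"
  define y1 where "y1 = u1 + G * q1"
  have y0: "y0 \<in> lau first_quadrant"
    unfolding y0_def by (intro lau_diff u C0_mult_closed q0)
  have y1: "y1 \<in> lau third_quadrant"
    unfolding y1_def by (intro lau_add u G_mult_lau[OF q01(3)]) (auto simp: third_quadrant_def)
  have y: "p + y0 = y1"
    using q(1) unfolding y0_def y1_def q01(1) by (simp add: algebra_simps)
  have coef_y: "coef p a b + coef y0 a b = coef y1 a b" for a b
    using arg_cong[OF y, of "\<lambda>z. coef z a b"] by simp
  have e0: "e (i, j) = 0" if ij: "(i, j) \<in> indices" for i j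
  proof -
    \<comment> \<open>In the rectangle the exponent of x is positive and that of y negative, so it
      meets neither quadrant.\<close>
    have "coef y0 (int i) (int j - int M) = 0" "coef y1 (int i) (int j - int M) = 0"
      using lau_coefD[OF y0] lau_coefD[OF y1] ij N2 M2
      by (fastforce simp: first_quadrant_def third_quadrant_def indices_def)+
    then show ?thesis
      using coef_y[of "int i" "int j - int M"] coef_p[OF ij] by simp
  qed
  have e0': "e k = 0" if "k \<in> indices" for k
    using that e0[of "fst k" "snd k"] by simp
  have "p = 0"
    unfolding p_sum by (rule sum.neutral) (simp add: e0')
  have E0: "E = 0"
    unfolding E_def triple_sum by (simp add: e0' zero_prod_def)
  \<comment> \<open>With \<open>p = 0\<close> the polynomials \<open>y0\<close> and
    \<open>y1\<close> coincide, and their quadrants share only the origin.\<close>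
  have "y0 = const (coef y0 0 0)"
  proof (rule coef_eqI[OF y0])
    show "const (coef y0 0 0) \<in> lau everywhere"
      by (rule C01.const_closed)
    fix a b
    have "coef y0 a b = 0" if "a \<noteq> 0 \<or> b \<noteq> 0"
    proof (rule ccontr)
      assume nz: "coef y0 a b \<noteq> 0"
      then have "coef y1 a b \<noteq> 0"
        using y \<open>p = 0\<close> by simp
      then show False
        using lau_coefD[OF y0 nz] lau_coefD[OF y1, of a b] that
        by (auto simp: first_quadrant_def third_quadrant_def)
    qed
    then show "coef y0 a b = coef (const (coef y0 0 0)) a b"
      using coef_const_mult[of "coef y0 0 0" "mm 0 0" a b] coef_mm[of 0 0 a b, where 'a = 'a]
      by (cases "a = 0 \<and> b = 0") auto
  qed
  then have "C0.D y0 = 0"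
    by (metis C0.D_const)
  then have "C0.D u0 = C0.D (C0.F * q0)"
    using C0.D_add[of y0 "G * q0"] by (simp add: y0_def C0_F)
  then have "C0.D u0 \<in> C0.I"
    unfolding C0.D_F C0.I_def using C0.D_closed[OF q0] by blast
  from C0.I_add[OF eqs(2) this] have "g0 \<in> C0.I"
    by simp
  then obtain z where z: "g0 = G * z" "z \<in> lau first_quadrant"
    by (auto simp: C0.I_def C0_F)
  have g0_sum: "g0 = (\<Sum>k\<in>indices. const (c k) * case_prod w0 k)"
    using arg_cong[OF pg, of "\<lambda>z. fst (snd z)"] E0 unfolding W_def triple_sum by simp
  have g0: "g0 \<in> lau (\<lambda>a b. a \<le> int N - 2 \<and> b \<le> int M - 2)"
  proof -
    have "const (c (i, j)) * w0 i j \<in> lau (\<lambda>a b. a \<le> int N - 2 \<and> b \<le> int M - 2)" if "(i, j) \<in> indices" for i j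
    proof -
      have "const (c (i, j)) * w0 i j = const (c (i, j) * of_nat (N * M)) * mm (int i - 1) (int j - 1)"
        unfolding w0_def const_mult[symmetric] single_of_nat by (simp add: mult.assoc)
      then show ?thesis
        using that by (simp only:) (auto intro!: lau_monomial simp: indices_def)
    qed
    then show ?thesis
      unfolding g0_sum by (intro lau_sum) auto
  qed
  \<comment> \<open>A nonzero \<open>z\<close> in the first quadrant would give the product a term
    in a column of at least N, whereas those of \<open>g0\<close> are at most N - 2.\<close>
  have "z = 0"
  proof (rule ccontr)
    assume "z \<noteq> 0"
    then obtain a b where ab: "coef z a b \<noteq> 0" "coef (G * z) (a + int N) b \<noteq> 0"
      using right_bottom[OF z(2)] by metis
    then show False
      using lau_coefD[OF z(2) ab(1)] lau_coefD[OF g0[unfolded z(1)] ab(2)] by (simp add: first_quadrant_def)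
  qed
  have "c (i, j) = 0" if ij: "(i, j) \<in> indices" for i j
  proof -
    have "coef g0 (int i - 1) (int j - 1) = (\<Sum>k\<in>indices. if k = (i, j) then c k * of_nat (N * M) else 0)"
      unfolding g0_sum coef_sum
    proof (intro sum.cong refl)
      fix k assume "k \<in> indices"
      obtain i' j' where k: "k = (i', j')" by fastforce
      have "const (c k) * case_prod w0 k = const (c k * of_nat (N * M)) * mm (int i' - 1) (int j' - 1)"
        unfolding k w0_def const_mult[symmetric] single_of_nat by (simp add: mult.assoc)
      then show "coef (const (c k) * case_prod w0 k) (int i - 1) (int j - 1) = (if k = (i, j) then c k * of_nat (N * M) else 0)"
        by (simp only: coef_const_mult coef_mm) (auto simp: k)
    qed
    then have "c (i, j) * of_nat (N * M) = 0"
      using ij finite_indices z(1) \<open>z = 0\<close> by simp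
    \<comment> \<open>The factor N M is cancelled by its inverse, which remains valid in the
      presence of zero divisors.\<close>
    then have "c (i, j) * of_nat (N * M) * (n' * m') = 0"
      by simp
    moreover have "c (i, j) * of_nat (N * M) * (n' * m') = c (i, j) * (of_nat N * n') * (of_nat M * m')"
      by (simp add: mult_ac)
    ultimately show ?thesis
      by (simp add: N_unit M_unit)
  qed
  then show ?thesis
    using e0 by auto
qed

theorem H1dR_free:
  "free_with_basis ring_of_type_algebra (H1dR N M t)
     ({1..N - 1} \<times> {1..M - 1} <+> {1..N - 1} \<times> {1..M - 1})
     (case_sum (\<lambda>(i, j). omega N M t i j) (\<lambda>(i, j). eta N M t i j))"
proof -
  let ?I = "indices <+> indices" and ?e = "case_sum (\<lambda>(i, j). omega N M t i j) (\<lambda>(i, j). eta N M t i j)"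
  let ?f = "case_sum omega_triple eta_triple"
  have f: "?f k \<in> ZV" "?e k = cl (?f k)" if "k \<in> ?I" for k
    using that omega_triple_ZV eta_triple_ZV omega_cl eta_cl by auto
  interpret Q: module ring_of_type_algebra "H1dR N M t" by (rule module_H)
  have fin: "finite ?I"
    using finite_indices by simp
  have sum: "(\<Oplus>\<^bsub>H1dR N M t\<^esub>k\<in>?I. c k \<odot>\<^bsub>H1dR N M t\<^esub> ?e k)
      = cl ((\<Sum>k\<in>indices. scale (c (Inl k)) (omega_triple k)) + (\<Sum>k\<in>indices. scale (c (Inr k)) (eta_triple k)))" for c
  proof -
    have "(\<Oplus>\<^bsub>H1dR N M t\<^esub>k\<in>?I. c k \<odot>\<^bsub>H1dR N M t\<^esub> ?e k) = (\<Oplus>\<^bsub>H1dR N M t\<^esub>k\<in>?I. c k \<odot>\<^bsub>H1dR N M t\<^esub> cl (?f k))"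
      using f by (intro Q.M.finsum_cong') (auto simp: cl_smult carrier_H ZV_scale)
    also have "\<dots> = cl (\<Sum>k\<in>?I. scale (c k) (?f k))"
      using fin f(1) by (rule finsum_cl)
    also have "(\<Sum>k\<in>?I. scale (c k) (?f k))
        = (\<Sum>k\<in>indices. scale (c (Inl k)) (omega_triple k)) + (\<Sum>k\<in>indices. scale (c (Inr k)) (eta_triple k))"
      using finite_indices by (subst sum.Plus) simp_all
    finally show ?thesis .
  qed
  have "?e \<in> ?I \<rightarrow> carrier (H1dR N M t)"
    using f unfolding carrier_H by auto
  moreover have "\<exists>c \<in> ?I \<rightarrow> carrier ring_of_type_algebra. m = (\<Oplus>\<^bsub>H1dR N M t\<^esub>k\<in>?I. c k \<odot>\<^bsub>H1dR N M t\<^esub> ?e k)"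
    if m: "m \<in> carrier (H1dR N M t)" for m
  proof -
    obtain v where v: "v \<in> ZV" "m = cl v"
      using m unfolding carrier_H by blast
    obtain c e where "cl v = cl ((\<Sum>k\<in>indices. scale (c k) (omega_triple k)) + (\<Sum>k\<in>indices. scale (e k) (eta_triple k)))"
      using spanning[OF v(1)] by blast
    then show ?thesis
      unfolding sum v(2) by (intro bexI[of _ "case_sum c e"]) (simp_all add: type_algebra_simps)
  qed
  moreover have "\<forall>k\<in>?I. c k = \<zero>\<^bsub>ring_of_type_algebra\<^esub>"
    if "(\<Oplus>\<^bsub>H1dR N M t\<^esub>k\<in>?I. c k \<odot>\<^bsub>H1dR N M t\<^esub> ?e k) = \<zero>\<^bsub>H1dR N M t\<^esub>" for c
    using independent[of "\<lambda>k. c (Inl k)" "\<lambda>k. c (Inr k)"] that unfolding sum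
    by (auto simp: type_algebra_simps)
  ultimately show ?thesis
    unfolding free_with_basis_def indices_def[symmetric] using module_H fin by blast
qed

end

theorem theorem3p4:
  fixes N M :: nat and \<zeta> :: "'w::comm_ring_1"
  assumes "2 \<le> N" and "2 \<le> M"
    and "(of_nat (N * M) :: 'w) dvd 1"
    and "primitive_root_of_unity (lcm N M) \<zeta>"
  shows "free_with_basis (ring_of_type_algebra :: 'w param_ring ring) (H1dR N M param)
           ({1..N - 1} \<times> {1..M - 1} <+> {1..N - 1} \<times> {1..M - 1})
           (case_sum (\<lambda>(i, j). omega N M param i j) (\<lambda>(i, j). eta N M param i j))"
proof -
  have of_nat_param: "of_nat n = (abs_param_ring ([:of_nat n:], 0) :: 'w param_ring)" for n
  proof (induction n)
    case 0
    then show ?case by (simp add: zero_param_ring_def)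
  next
    case (Suc n)
    then show ?case
      by (simp add: one_param_ring_def plus_param_ring.abs_eq one_pCons add.commute)
  qed
  obtain k :: 'w where k: "1 = of_nat (N * M) * k"
    using assms(3) by (rule dvdE)
  have "of_nat (N * M) * abs_param_ring ([:k:], 0) = (1 :: 'w param_ring)"
    unfolding of_nat_param one_param_ring_def times_param_ring.abs_eq
    using k by (simp add: one_pCons)
  then have NM: "of_nat N * (of_nat M * abs_param_ring ([:k:], 0)) = (1 :: 'w param_ring)"
    "of_nat M * (of_nat N * abs_param_ring ([:k:], 0)) = (1 :: 'w param_ring)"
    by (simp_all add: mult_ac)
  obtain r :: "'w param_ring" where "1 = (param - param ^ 2) * r"
    using param_unit by (rule dvdE)
  \<comment> \<open>One inverse \<open>r\<close> of t (1 - t) yields inverses of both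
    factors.\<close>
  then have t: "param * ((1 - param) * r) = 1" "(1 - param) * (param * r) = 1"
    by (simp_all add: power2_eq_square algebra_simps)
  show ?thesis
    by (rule fermat_curve.H1dR_free[OF fermat_curve.intro[OF assms(1,2) t NM]])
qed

end
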